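(* Let $p>k\ge 3$ be fixed, with $p$ an odd prime. Let $\alpha\in(0,1/p)$, and let $t$ be the positive integer such that $\alpha\in[p^{-(t+1)},p^{-t})$. Then, as $n\to\infty$, $$\mathcal{P}(\alpha,k)\,p^n\ \ge\ (1-o(1))\,\frac{\log(p^t)}{\log\left(1+(p^t-1)^{-1}\right)}\binom{n}{k-1},$$ or, with $N=p^n$, $$\mathcal{P}(\alpha,k)N\ \ge\ (1-o(1))\,\frac{\log(p^t)}{(k-1)!\,\log\left(1+(p^t-1)^{-1}\right)}(\log_p N)^{k-1}\ \ge\ \left(1-o_{\alpha\to0,\,n\to\infty}(1)\right)\frac{\alpha^{-1}\log\alpha^{-1}}{p\,(k-1)!}(\log_p N)^{k-1}.$$
   Context: Write $N=p^n=|\mathbb{F}_p^n|$. For a set $M\subseteq\mathbb{F}_p^n$, say that Szemerédi's theorem holds (in $\mathbb{F}_p^n$) for $k$-APs and $\alpha$-dense sets with differences in $M$ if every $A\subseteq\mathbb{F}_p^n$ with $|A|\ge\alpha N$ contains a nontrivial $k$-term arithmetic progression with common difference in $M$, i.e. there are $x\in\mathbb{F}_p^n$ and a nonzero $d\in M$ with $x,x+d,\dots,x+(k-1)d\in A$. This property is monotone in $M$. The threshold $\mathcal{P}(\alpha,k)$ (which depends also on $p$ and $n$) is the minimal density such that, when $M\subseteq\mathbb{F}_p^n$ is sampled uniformly at random among sets of size $|M|=\mathcal{P}(\alpha,k)N$, the probability that Szemerédi's theorem holds for $k$-APs and $\alpha$-dense sets with differences in $M$ is at least $1/2$. The notation $o(1)$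 is with respect to $n\to\infty$ with $p,k,\alpha$ fixed. The notation $o_{\alpha\to0,n\to\infty}(1)$ (with $p,k$ fixed) denotes a quantity that is arbitrarily small in absolute value once $\alpha$ is small enough and then $n$ is large enough in terms of $\alpha$. *)

theory Defs
  imports
    "HOL-Probability.Probability_Mass_Function"
    "Jordan_Normal_Form.Matrix"
    "Berlekamp_Zassenhaus.Finite_Field"
begin

text \<open>
  The field with \<open>p\<close> elements is the type \<open>'p mod_ring\<close> with \<open>CARD('p) = p\<close> prime, and its
  \<open>n\<close>-th power is the set \<open>carrier_vec n\<close> of vectors of dimension \<open>n\<close>. Since \<open>n\<close> tends to
  infinity, it is a term and not a type.
\<close>

definition szemeredi_holds ::
  "nat \<Rightarrow> nat \<Rightarrow> real \<Rightarrow> 'p::prime_card mod_ring Matrix.vec set \<Rightarrow> bool" where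
  "szemeredi_holds n k \<alpha> M \<longleftrightarrow>
     (\<forall>A \<subseteq> carrier_vec n. real (card A) \<ge> \<alpha> * real (CARD('p) ^ n) \<longrightarrow>
        (\<exists>x \<in> carrier_vec n. \<exists>d \<in> M. d \<noteq> 0\<^sub>v n \<and>
           (\<forall>j<k. x + of_nat j \<cdot>\<^sub>v d \<in> A)))"

definition szemeredi_prob :: "'p::prime_card itself \<Rightarrow> nat \<Rightarrow> nat \<Rightarrow> real \<Rightarrow> nat \<Rightarrow> real" where
  "szemeredi_prob _ n k \<alpha> m =
     measure_pmf.prob
       (pmf_of_set {M :: 'p mod_ring Matrix.vec set. M \<subseteq> carrier_vec n \<and> card M = m})
       {M. szemeredi_holds n k \<alpha> M}"

text \<open>
  The infimum ranges over a finite set of densities, so it is the minimum whenever that set is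
  nonempty. The set is empty when not even \<open>M = carrier_vec n\<close> works, which can happen for small
  \<open>n\<close>; the value is then \<open>\<infinity>\<close>.
\<close>

definition szemeredi_threshold :: "'p::prime_card itself \<Rightarrow> nat \<Rightarrow> real \<Rightarrow> nat \<Rightarrow> ereal" where
  "szemeredi_threshold P n \<alpha> k =
     Inf {ereal (real m / real (CARD('p) ^ n)) | m.
            m \<le> CARD('p) ^ n \<and> szemeredi_prob P n k \<alpha> m \<ge> 1 / 2}"

end

theory Submission
  imports
    Defs
    "HOL-Library.Discrete_Functions"
begin

text \<open>
  Put \<open>q = k - 1\<close>. Let \<open>P\<close> be a homogeneous polynomial of degree \<open>q\<close> over the field with \<open>p\<close> elements. On
  a line, \<open>P (x + j d)\<close> is a polynomial in \<open>j\<close> of degree at most \<open>q\<close> whose coefficient at \<open>j ^ q\<close> is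
  \<open>P d\<close>. If it vanishes for \<open>j = 0, \<dots>, k - 1\<close>, then it has more roots than its degree, so
  \<open>P d = 0\<close> (\<open>pev_difference_eq_0\<close>). Hence, if \<open>A\<close> is the set of common zeros of \<open>t\<close> such
  polynomials, every \<open>k\<close>-term progression in \<open>A\<close> has its difference in \<open>A\<close>, and Szemeredi's theorem
  fails for every set \<open>M\<close> of differences that is disjoint from \<open>A\<close>. For typical polynomials \<open>A\<close> has
  density about \<open>p ^ - t\<close>, which exceeds \<open>\<alpha>\<close>.

  It remains to show that a random \<open>M\<close> of size \<open>m\<close> below the claimed bound is, with probability more
  than one half, disjoint from the zero set of some tuple. If the polynomials form a space of dimension
  \<open>D\<close>, there are \<open>p ^ (t D)\<close> tuples, and each avoids \<open>M\<close> with probability about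
  \<open>(1 - p ^ - t) ^ m\<close>. The expected number of tuples that avoid \<open>M\<close> is large as long as
  \<open>m < (1 - \<epsilon>) * D * ln (p ^ t) / ln (1 + 1 / (p ^ t - 1))\<close>, and \<open>D\<close> can be taken asymptotic to
  \<open>n choose q\<close>: this is where the constant of the theorem comes from. The second moment of this
  number decides (\<open>good_tuple_avoids\<close>). Two tuples behave independently unless some linear
  combination of their members is biased, that is, has an exponential sum that is not small. Two facts
  control the exceptions.

  \<^item> Biased polynomials are rare, so rare that their number is at most \<open>p ^ (\<delta> D)\<close> for every fixed
    \<open>\<delta> > 0\<close> and large \<open>n\<close>, even when biased means a sum of relative size about \<open>n ^ (- q - 1 / 2)\<close> (\<open>few_biased_transversals\<close>).
    The variables are split into about \<open>sqrt n\<close> blocks of \<open>sqrt n\<close> variables, and only monomials with at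
    most one variable in each block are used. They are asymptotically all squarefree monomials, and a
    polynomial built from them is linear in each block. A biased polynomial stays biased for many
    values of one block, which gives many independent linear conditions on its coefficients: an
    induction on the number of blocks and on the degree (\<open>few_biased_Un\<close>).

  \<^item> Suppose that the biased combinations of two tuples span a space of dimension \<open>r\<close>. The probability
    of avoiding both zero sets is then larger than for independent tuples by a factor of at most
    \<open>(1 - p ^ - t) ^ (- r m / t)\<close> (\<open>overlap_growth_le\<close>), which below the threshold is
    \<open>p ^ (r (1 - \<epsilon>) D)\<close>, while such pairs form only a fraction of about \<open>p ^ (- r D)\<close> of all pairs
    (\<open>card_large_overlap\<close>).
\<close>

section \<open>Characters and linear systems over a prime field\<close>

abbreviation vecs :: "'i set \<Rightarrow> ('i \<Rightarrow> 'p::prime_card mod_ring) set" where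
  "vecs I \<equiv> I \<rightarrow>\<^sub>E UNIV"

lemma finite_vecs: "finite I \<Longrightarrow> finite (vecs I :: ('i \<Rightarrow> 'p::prime_card mod_ring) set)"
  by (intro finite_PiE) auto

lemma card_vecs:
  "finite I \<Longrightarrow> card (vecs I :: ('i \<Rightarrow> 'p::prime_card mod_ring) set) = CARD('p) ^ card I"
  by (simp add: card_PiE)

lemma prime_card_gt_1: "1 < CARD('p::prime_card)"
  using prime_card[where 'a='p] prime_gt_1_nat by blast

lemma card_le_card_times_fibre:
  assumes "finite B" "f ` A \<subseteq> B" "\<And>b. b \<in> B \<Longrightarrow> card {a \<in> A. f a = b} \<le> k"
  shows "card A \<le> card B * k"
proof -
  have "A = (\<Union>b\<in>B. {a \<in> A. f a = b})" using assms(2) by auto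
  then have "card A \<le> (\<Sum>b\<in>B. card {a \<in> A. f a = b})"
    using card_UN_le[OF assms(1), of "\<lambda>b. {a \<in> A. f a = b}"] by simp
  also have "\<dots> \<le> (\<Sum>b\<in>B. k)" by (rule sum_mono) (rule assms(3))
  finally show ?thesis by simp
qed

text \<open>
  The standard additive character \<open>exp (2 \<pi> i a / p)\<close>; all counting below goes through its
  orthogonality relations.
\<close>

definition chi :: "'p::prime_card mod_ring \<Rightarrow> complex" where
  "chi a = cis (2 * pi * real_of_int (to_int_mod_ring a) / real CARD('p))"

lemma chi_0 [simp]: "chi 0 = 1"
  by (simp add: chi_def)

lemma norm_chi [simp]: "cmod (chi a) = 1"
  by (simp add: chi_def)

lemma cis_int_mod:
  assumes "p > 0"
  shows "cis (2 * pi * real_of_int (x mod int p) / real p) = cis (2 * pi * real_of_int x / real p)"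
proof -
  have "real_of_int x = real_of_int (x mod int p) + real p * real_of_int (x div int p)"
    by (metis add.commute mult_div_mod_eq of_int_add of_int_mult of_int_of_nat_eq)
  then have "2 * pi * real_of_int x / real p
      = 2 * pi * real_of_int (x mod int p) / real p + 2 * pi * real_of_int (x div int p)"
    using assms by (simp add: field_simps)
  then show ?thesis
    by (simp add: cis_mult[symmetric])
qed

lemma chi_add: "chi (a + b) = chi a * chi (b :: 'p::prime_card mod_ring)"
proof -
  have "chi (a + b) = cis (2 * pi * real_of_int
      ((to_int_mod_ring a + to_int_mod_ring b) mod int CARD('p)) / real CARD('p))"
    by (simp add: chi_def to_int_mod_ring_add)
  also have "\<dots> = cis (2 * pi * real_of_int (to_int_mod_ring a + to_int_mod_ring b) / real CARD('p))"
    by (rule cis_int_mod) simp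
  also have "\<dots> = chi a * chi b"
    by (simp add: chi_def cis_mult ring_distribs add_divide_distrib)
  finally show ?thesis .
qed

lemma chi_minus: "chi (- a) = cnj (chi (a :: 'p::prime_card mod_ring))"
proof -
  have 1: "chi (- a) * chi a = 1" using chi_add[of "- a" a] by simp
  have 2: "cnj (chi a) * chi a = 1"
    using complex_norm_square[of "chi a"] by (simp add: mult.commute)
  have "chi (- a) = chi (- a) * (cnj (chi a) * chi a)" using 2 by simp
  also have "\<dots> = cnj (chi a) * (chi (- a) * chi a)" by (simp only: mult_ac)
  finally show ?thesis using 1 by simp
qed

lemma chi_sum: "finite A \<Longrightarrow> chi (\<Sum>i\<in>A. f i) = (\<Prod>i\<in>A. chi (f i :: 'p::prime_card mod_ring))"
  by (induction A rule: finite_induct) (auto simp: chi_add)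

lemma chi_eq_1_iff: "chi (a :: 'p::prime_card mod_ring) = 1 \<longleftrightarrow> a = 0"
proof
  assume h: "chi a = 1"
  define z where "z = to_int_mod_ring a"
  have z: "0 \<le> z" "z < int CARD('p)"
    using range_to_int_mod_ring[where 'a='p] unfolding z_def by auto
  have "cos (2 * pi * real_of_int z / real CARD('p)) = 1"
    using h unfolding chi_def z_def by (metis cis.sel(1) one_complex.sel(1))
  then obtain m :: int where m: "2 * pi * real_of_int z / real CARD('p) = real_of_int m * 2 * pi"
    using cos_one_2pi_int by auto
  have "real_of_int z = real_of_int m * real CARD('p)"
    using m by (simp add: field_simps)
  then have "z = m * int CARD('p)"
    by (metis of_int_eq_iff of_int_mult of_int_of_nat_eq)
  then have "z = 0" using z
    by (metis mod_mult_self2_is_0 mod_pos_pos_trivial)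
  then show "a = 0" unfolding z_def
    by (metis of_int_mod_ring_to_int_mod_ring to_int_mod_ring_hom.hom_zero)
qed simp

text \<open>
  Shifting \<open>a\<close> by \<open>1\<close> multiplies the sum by \<open>chi b\<close>, which differs from \<open>1\<close> unless \<open>b = 0\<close>.
\<close>

lemma sum_chi_mult:
  "(\<Sum>a\<in>UNIV. chi (a * b :: 'p::prime_card mod_ring)) = (if b = 0 then of_nat CARD('p) else 0)"
proof (cases "b = 0")
  case False
  define S where "S = (\<Sum>a\<in>UNIV. chi (a * b))"
  have "S = (\<Sum>a\<in>UNIV. chi ((a + 1) * b))"
    unfolding S_def
    by (rule sum.reindex_bij_witness[of _ "\<lambda>a. a + 1" "\<lambda>a. a - 1"]) auto
  also have "\<dots> = chi b * S"
    by (simp add: S_def sum_distrib_left ring_distribs chi_add mult.commute)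
  finally have "S * (1 - chi b) = 0" by (simp add: algebra_simps)
  then have "S = 0" using False by (simp add: chi_eq_1_iff[of b, symmetric])
  then show ?thesis using False by (simp add: S_def)
qed simp

lemma sum_vecs_chi:
  fixes y :: "'i \<Rightarrow> 'p::prime_card mod_ring"
  assumes "finite I"
  shows "(\<Sum>u\<in>vecs I. chi (\<Sum>i\<in>I. u i * y i))
    = (if \<forall>i\<in>I. y i = 0 then of_nat (CARD('p) ^ card I) else 0)"
proof -
  have "(\<Sum>u\<in>vecs I. chi (\<Sum>i\<in>I. u i * y i)) = (\<Sum>u\<in>vecs I. \<Prod>i\<in>I. chi (u i * y i))"
    using assms by (simp add: chi_sum)
  also have "\<dots> = (\<Prod>i\<in>I. \<Sum>a\<in>UNIV. chi (a * y i))"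
    by (rule prod_sum_PiE[symmetric]) (use assms in auto)
  also have "\<dots> = (\<Prod>i\<in>I. if y i = 0 then of_nat CARD('p) else 0)"
    by (simp add: sum_chi_mult)
  also have "\<dots> = (if \<forall>i\<in>I. y i = 0 then of_nat (CARD('p) ^ card I) else 0)"
    using assms by (auto intro!: prod_zero)
  finally show ?thesis .
qed

text \<open>
  Linear independence of vectors that are represented as functions on \<open>W\<close>. Only the values on \<open>W\<close>
  matter, so no separate vector type for each finite index set is needed.
\<close>

definition indep :: "'i set \<Rightarrow> nat \<Rightarrow> (nat \<Rightarrow> 'i \<Rightarrow> 'p::prime_card mod_ring) \<Rightarrow> bool" where
  "indep W l ys \<longleftrightarrow>
     (\<forall>a\<in>vecs {..<l}. (\<forall>i\<in>W. (\<Sum>j<l. a j * ys j i) = 0) \<longrightarrow> (\<forall>j<l. a j = 0))"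

text \<open>
  Detect each of the \<open>l\<close> equations with the character and exchange the sums. The combination of the
  equations with coefficients \<open>a\<close> contributes only if the same combination of the vectors \<open>ys j\<close>
  vanishes, which by independence leaves \<open>a = 0\<close> alone.
\<close>

lemma card_solutions:
  fixes ys :: "nat \<Rightarrow> 'i \<Rightarrow> 'p::prime_card mod_ring"
  assumes W: "finite W" and ind: "indep W l ys"
  shows "card {u \<in> vecs W. \<forall>j<l. (\<Sum>i\<in>W. ys j i * u i) = b j} * CARD('p) ^ l = CARD('p) ^ card W"
proof -
  let ?d = "\<lambda>u j. (\<Sum>i\<in>W. ys j i * u i) - b j"
  have fin: "finite (vecs W :: ('i \<Rightarrow> 'p mod_ring) set)" "finite (vecs {..<l} :: (nat \<Rightarrow> 'p mod_ring) set)"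
    by (rule finite_vecs, use W in simp)+
  define z :: "nat \<Rightarrow> 'p mod_ring" where "z = restrict (\<lambda>_. 0) {..<l}"
  have z: "z \<in> vecs {..<l}" and z0: "\<And>j. j < l \<Longrightarrow> z j = 0" by (auto simp: z_def)
  have ex: "chi (\<Sum>j<l. a j * ?d u j) = chi (- (\<Sum>j<l. a j * b j)) *
        chi (\<Sum>i\<in>W. u i * (\<Sum>j<l. a j * ys j i))" for u a
  proof -
    have "(\<Sum>j<l. a j * ?d u j) = - (\<Sum>j<l. a j * b j) + (\<Sum>j<l. \<Sum>i\<in>W. a j * ys j i * u i)"
      by (simp add: ring_distribs sum_subtractf sum_distrib_left mult_ac)
    also have "(\<Sum>j<l. \<Sum>i\<in>W. a j * ys j i * u i) = (\<Sum>i\<in>W. u i * (\<Sum>j<l. a j * ys j i))"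
      by (subst sum.swap) (simp add: sum_distrib_left mult_ac)
    finally show ?thesis by (simp only: chi_add)
  qed
  have "of_nat (card {u \<in> vecs W. \<forall>j<l. (\<Sum>i\<in>W. ys j i * u i) = b j} * CARD('p) ^ l)
      = (\<Sum>u\<in>vecs W. if \<forall>j\<in>{..<l}. ?d u j = 0 then of_nat (CARD('p) ^ card {..<l}) else (0::complex))"
  proof -
    have "vecs W \<inter> {u. \<forall>j\<in>{..<l}. ?d u j = 0} = {u \<in> vecs W. \<forall>j<l. (\<Sum>i\<in>W. ys j i * u i) = b j}"
      by auto
    then show ?thesis by (simp only: sum.If_cases[OF fin(1)] sum_constant sum.neutral_const
          add_0_right of_nat_mult card_lessThan mult_zero_right)
  qed
  also have "\<dots> = (\<Sum>u\<in>vecs W. \<Sum>a\<in>vecs {..<l}. chi (\<Sum>j<l. a j * ?d u j))"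
    by (simp only: sum_vecs_chi[OF finite_lessThan])
  also have "\<dots> = (\<Sum>u\<in>vecs W. \<Sum>a\<in>vecs {..<l}. chi (- (\<Sum>j<l. a j * b j)) *
        chi (\<Sum>i\<in>W. u i * (\<Sum>j<l. a j * ys j i)))"
    by (intro sum.cong refl ex)
  also have "\<dots> = (\<Sum>a\<in>vecs {..<l}. \<Sum>u\<in>vecs W. chi (- (\<Sum>j<l. a j * b j)) *
        chi (\<Sum>i\<in>W. u i * (\<Sum>j<l. a j * ys j i)))"
    by (rule sum.swap)
  also have "\<dots> = (\<Sum>a\<in>vecs {..<l}. chi (- (\<Sum>j<l. a j * b j)) *
        (if \<forall>i\<in>W. (\<Sum>j<l. a j * ys j i) = 0 then of_nat (CARD('p) ^ card W) else 0))"
    by (simp only: sum_distrib_left[symmetric] sum_vecs_chi[OF W])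
  also have "\<dots> = (\<Sum>a\<in>vecs {..<l}. if a = z then of_nat (CARD('p) ^ card W) else 0)"
  proof (rule sum.cong[OF refl])
    fix a :: "nat \<Rightarrow> 'p mod_ring" assume a: "a \<in> vecs {..<l}"
    have iff: "(\<forall>i\<in>W. (\<Sum>j<l. a j * ys j i) = 0) \<longleftrightarrow> a = z"
    proof
      assume "\<forall>i\<in>W. (\<Sum>j<l. a j * ys j i) = 0"
      then have "\<forall>j<l. a j = 0" using ind a unfolding indep_def by blast
      then show "a = z" by (intro PiE_ext[OF a z]) (simp add: z0)
    next
      assume "a = z"
      then show "\<forall>i\<in>W. (\<Sum>j<l. a j * ys j i) = 0" by (simp add: z0)
    qed
    have one: "chi (- (\<Sum>j<l. z j * b j)) = 1" by (simp add: z0)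
    show "chi (- (\<Sum>j<l. a j * b j)) *
        (if \<forall>i\<in>W. (\<Sum>j<l. a j * ys j i) = 0 then of_nat (CARD('p) ^ card W) else 0)
      = (if a = z then of_nat (CARD('p) ^ card W) else 0)"
    proof (cases "a = z")
      case True
      then show ?thesis using iff one by (simp only: if_True mult_1)
    next
      case False
      then show ?thesis using iff by (simp only: if_False mult_zero_right)
    qed
  qed
  also have "\<dots> = of_nat (CARD('p) ^ card W)"
    by (subst sum.delta[OF fin(2)]) (simp only: z if_True)
  finally show ?thesis by (simp only: of_nat_eq_iff)
qed

text \<open>
  A tuple \<open>(Q\<^sub>i)\<close> of coefficient vectors, indexed by \<open>i \<in> W\<close>, is stored as one function on \<open>W \<times> E\<close>;
  \<open>comb W E y Q\<close> is the coefficient vector of the linear combination of the \<open>Q\<^sub>i\<close> with weights \<open>y i\<close>.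
\<close>

definition comb :: "'i set \<Rightarrow> 'e set \<Rightarrow> ('i \<Rightarrow> 'p::prime_card mod_ring) \<Rightarrow> ('i \<times> 'e \<Rightarrow> 'p mod_ring) \<Rightarrow> 'e \<Rightarrow> 'p mod_ring" where
  "comb W E y Q = (\<lambda>e\<in>E. \<Sum>i\<in>W. y i * Q (i, e))"

lemma comb_in_vecs [simp]: "comb W E y Q \<in> vecs E"
  by (simp add: comb_def)

text \<open>
  Requiring \<open>l\<close> independent combinations of the members of a tuple to lie in small sets costs a factor
  \<open>p ^ (card E)\<close> for each combination. This single count serves twice: for polynomials whose
  restrictions to many values of a block are biased, and for pairs of tuples that have several biased
  combinations.

  Once the values of the \<open>l\<close> combinations are fixed, the coordinates \<open>e \<in> E\<close> decouple, and each of them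
  is a linear system as in \<open>card_solutions\<close>.
\<close>

lemma card_comb_in_le:
  fixes ys :: "nat \<Rightarrow> 'i \<Rightarrow> 'p::prime_card mod_ring" and C :: "nat \<Rightarrow> ('e \<Rightarrow> 'p mod_ring) set"
  assumes W: "finite W" and E: "finite E" and ind: "indep W l ys" and l: "l \<le> card W"
    and C: "\<And>j. j < l \<Longrightarrow> C j \<subseteq> vecs E"
  shows "card {Q \<in> vecs (W \<times> E). \<forall>j<l. comb W E (ys j) Q \<in> C j}
      \<le> (\<Prod>j<l. card (C j)) * CARD('p) ^ (card E * (card W - l))"
proof -
  let ?A = "{Q \<in> vecs (W \<times> E). \<forall>j<l. comb W E (ys j) Q \<in> C j}"
  have finC: "finite (C j)" if "j < l" for j
    using C[OF that] finite_vecs[OF E] by (rule finite_subset)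
  have "card ?A \<le> card (PiE {..<l} C) * CARD('p) ^ (card E * (card W - l))"
  proof (rule card_le_card_times_fibre)
    show "finite (PiE {..<l} C)" using finC by (intro finite_PiE) auto
    show "(\<lambda>Q. \<lambda>j\<in>{..<l}. comb W E (ys j) Q) ` ?A \<subseteq> PiE {..<l} C" by auto
    fix b assume "b \<in> PiE {..<l} C"
    let ?F = "{Q \<in> ?A. (\<lambda>j\<in>{..<l}. comb W E (ys j) Q) = b}"
    let ?S = "\<lambda>e. {u \<in> vecs W. \<forall>j<l. (\<Sum>i\<in>W. ys j i * u i) = b j e}"
    have S: "card (?S e) = CARD('p) ^ (card W - l)" for e
    proof -
      have "card (?S e) * CARD('p) ^ l = CARD('p) ^ (card W - l) * CARD('p) ^ l"
        using card_solutions[OF W ind, of "\<lambda>j. b j e"] l by (simp flip: power_add)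
      then show ?thesis by simp
    qed
    have finS: "finite (?S e)" for e by (rule finite_subset[OF _ finite_vecs[OF W]]) auto
    have "card ?F \<le> card (PiE E ?S)"
    proof (rule card_inj_on_le)
      show "finite (PiE E ?S)" using E finS by (intro finite_PiE) auto
      show "(\<lambda>Q. \<lambda>e\<in>E. \<lambda>i\<in>W. Q (i, e)) ` ?F \<subseteq> PiE E ?S"
        by (auto simp: comb_def)
      show "inj_on (\<lambda>Q. \<lambda>e\<in>E. \<lambda>i\<in>W. Q (i, e)) ?F"
      proof (rule inj_onI)
        fix Q Q' :: "'i \<times> 'e \<Rightarrow> 'p mod_ring" assume Q: "Q \<in> ?F" "Q' \<in> ?F"
          and eq: "(\<lambda>e\<in>E. \<lambda>i\<in>W. Q (i, e)) = (\<lambda>e\<in>E. \<lambda>i\<in>W. Q' (i, e))"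
        have "Q (i, e) = Q' (i, e)" if "i \<in> W" "e \<in> E" for i e
          using fun_cong[OF fun_cong[OF eq], of e i] that by simp
        then show "Q = Q'" using Q by (intro PiE_ext[of Q "W \<times> E" "\<lambda>_. UNIV" Q']) auto
      qed
    qed
    also have "\<dots> = CARD('p) ^ (card E * (card W - l))"
      using E by (simp only: card_PiE S prod_constant power_mult[symmetric] mult.commute[of "card E"])
    finally show "card ?F \<le> CARD('p) ^ (card E * (card W - l))" .
  qed
  then show ?thesis by (simp add: card_PiE)
qed

lemma indep_extend:
  fixes ys :: "nat \<Rightarrow> 'i \<Rightarrow> 'p::prime_card mod_ring"
  assumes ind: "indep W l ys" and y: "y \<in> vecs W"
    and new: "y \<notin> (\<lambda>a. \<lambda>i\<in>W. \<Sum>j<l. a j * ys j i) ` vecs {..<l}"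
  shows "indep W (Suc l) (ys(l := y))"
  unfolding indep_def
proof (intro ballI impI)
  fix a :: "nat \<Rightarrow> 'p mod_ring" assume a: "a \<in> vecs {..<Suc l}"
    and "\<forall>i\<in>W. (\<Sum>j<Suc l. a j * (ys(l := y)) j i) = 0"
  then have z: "(\<Sum>j<l. a j * ys j i) + a l * y i = 0" if "i \<in> W" for i
    using that by simp
  have al: "a l = 0"
  proof (rule ccontr)
    assume nz: "a l \<noteq> 0"
    define c where "c = (\<lambda>j\<in>{..<l}. - inverse (a l) * a j)"
    have "y i = (\<lambda>i\<in>W. \<Sum>j<l. c j * ys j i) i" if i: "i \<in> W" for i
    proof -
      have "(\<lambda>i\<in>W. \<Sum>j<l. c j * ys j i) i = (\<Sum>j<l. - inverse (a l) * (a j * ys j i))"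
        using i by (simp add: c_def mult.assoc)
      also have "\<dots> = - inverse (a l) * (\<Sum>j<l. a j * ys j i)"
        by (simp only: sum_distrib_left)
      also have "(\<Sum>j<l. a j * ys j i) = - (a l * y i)"
        using z[OF i] by (simp only: eq_neg_iff_add_eq_0)
      also have "- inverse (a l) * (- (a l * y i)) = y i" using nz by simp
      finally show ?thesis by (rule sym)
    qed
    then have "y = (\<lambda>i\<in>W. \<Sum>j<l. c j * ys j i)"
      by (intro PiE_ext[OF y]) simp_all
    moreover have "c \<in> vecs {..<l}" unfolding c_def by simp
    ultimately have "y \<in> (\<lambda>a. \<lambda>i\<in>W. \<Sum>j<l. a j * ys j i) ` vecs {..<l}"
      by (rule image_eqI)
    then show False using new by (rule notE[rotated])
  qed
  have m: "restrict a {..<l} \<in> vecs {..<l}" by simp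
  have "\<forall>i\<in>W. (\<Sum>j<l. restrict a {..<l} j * ys j i) = 0" using z al by simp
  then have "\<forall>j<l. restrict a {..<l} j = 0" using ind m unfolding indep_def by blast
  then show "\<forall>j<Suc l. a j = 0" using al by (auto simp: less_Suc_eq)
qed

text \<open>
  Choose the vectors greedily: the span of \<open>j\<close> vectors has at most \<open>p ^ j\<close> elements, and every element of
  \<open>Y\<close> outside it extends the tuple.
\<close>

lemma card_indep_tuples_ge:
  fixes Y :: "('i \<Rightarrow> 'p::prime_card mod_ring) set"
  assumes W: "finite W" and Y: "Y \<subseteq> vecs W"
  shows "(\<Prod>j<l. card Y - CARD('p) ^ j) \<le> card {ys \<in> {..<l} \<rightarrow>\<^sub>E Y. indep W l ys}"
proof (induction l)
  case 0
  have "{ys \<in> {..<0} \<rightarrow>\<^sub>E Y. indep W 0 ys} = {\<lambda>_. undefined}"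
    by (auto simp: indep_def)
  then show ?case by simp
next
  case (Suc l)
  let ?I = "\<lambda>l. {ys \<in> {..<l} \<rightarrow>\<^sub>E Y. indep W l ys}"
  let ?sp = "\<lambda>ys. (\<lambda>a. \<lambda>i\<in>W. \<Sum>j<l. a j * ys j i) ` vecs {..<l}"
  have finY: "finite Y" using Y finite_vecs[OF W] by (rule finite_subset)
  have finI: "finite (?I l)" for l using finY by (simp add: finite_PiE)
  have sp: "card Y - CARD('p) ^ l \<le> card (Y - ?sp ys)" for ys :: "nat \<Rightarrow> 'i \<Rightarrow> 'p mod_ring"
  proof -
    have f: "finite (vecs {..<l} :: (nat \<Rightarrow> 'p mod_ring) set)" by (rule finite_vecs) simp
    have "card (?sp ys) \<le> card (vecs {..<l} :: (nat \<Rightarrow> 'p mod_ring) set)"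
      by (rule card_image_le[OF f])
    also have "\<dots> = CARD('p) ^ l" by (simp add: card_vecs)
    finally have "card Y - CARD('p) ^ l \<le> card Y - card (?sp ys)" by simp
    also have "\<dots> \<le> card (Y - ?sp ys)"
      by (rule diff_card_le_card_Diff[OF finite_imageI[OF f]])
    finally show ?thesis .
  qed
  have "(\<Prod>j<Suc l. card Y - CARD('p) ^ j) \<le> card (?I l) * (card Y - CARD('p) ^ l)"
    using mult_right_mono[OF Suc] by (simp only: prod.lessThan_Suc)
  also have "\<dots> \<le> (\<Sum>ys\<in>?I l. card (Y - ?sp ys))"
    using sum_mono[of "?I l" "\<lambda>_. card Y - CARD('p) ^ l" "\<lambda>ys. card (Y - ?sp ys)"] sp by simp
  also have "\<dots> = card (SIGMA ys:?I l. Y - ?sp ys)"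
    by (rule card_SigmaI[symmetric]) (use finI finY in auto)
  also have "\<dots> \<le> card (?I (Suc l))"
  proof (rule card_inj_on_le[OF _ _ finI])
    show "inj_on (\<lambda>(ys, y). ys(l := y)) (SIGMA ys:?I l. Y - ?sp ys)"
    proof (rule inj_onI)
      fix a b assume ab: "a \<in> (SIGMA ys:?I l. Y - ?sp ys)" "b \<in> (SIGMA ys:?I l. Y - ?sp ys)"
        "(\<lambda>(ys, y). ys(l := y)) a = (\<lambda>(ys, y). ys(l := y)) b"
      obtain ys y ys' y' where e: "a = (ys, y)" "b = (ys', y')" by (metis surj_pair)
      have h: "ys \<in> {..<l} \<rightarrow>\<^sub>E Y" "ys' \<in> {..<l} \<rightarrow>\<^sub>E Y" "ys(l := y) = ys'(l := y')"
        using ab unfolding e mem_Sigma_iff mem_Collect_eq by simp_all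
      have "ys j = ys' j" if "j < l" for j using fun_cong[OF h(3), of j] that by simp
      then have "ys = ys'" by (intro PiE_ext[OF h(1,2)]) auto
      moreover have "y = y'" using fun_cong[OF h(3), of l] by simp
      ultimately show "a = b" unfolding e by simp
    qed
    show "(\<lambda>(ys, y). ys(l := y)) ` (SIGMA ys:?I l. Y - ?sp ys) \<subseteq> ?I (Suc l)"
    proof clarify
      fix ys y assume h: "ys \<in> {..<l} \<rightarrow>\<^sub>E Y" "indep W l ys" "y \<in> Y" "y \<notin> ?sp ys"
      have "ys(l := y) \<in> {..<Suc l} \<rightarrow>\<^sub>E Y"
        using PiE_fun_upd[OF h(3) h(1)] by (simp add: lessThan_Suc)
      then show "ys(l := y) \<in> {..<Suc l} \<rightarrow>\<^sub>E Y \<and> indep W (Suc l) (ys(l := y))"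
        using indep_extend[OF h(2) subsetD[OF Y h(3)] h(4)] by (rule conjI)
    qed
  qed
  finally show ?case .
qed

section \<open>Few polynomials are biased\<close>

text \<open>
  The monomials \<open>f\<close> are a parameter because they are evaluated both on functions and on vectors.
\<close>

definition pev :: "('e \<Rightarrow> 'x \<Rightarrow> 'p mod_ring) \<Rightarrow> 'e set \<Rightarrow> ('e \<Rightarrow> 'p::prime_card mod_ring) \<Rightarrow> 'x \<Rightarrow> 'p mod_ring" where
  "pev f E c x = (\<Sum>e\<in>E. c e * f e x)"

definition var_prod :: "'i set \<Rightarrow> ('i \<Rightarrow> 'p::prime_card mod_ring) \<Rightarrow> 'p mod_ring" where
  "var_prod e x = (\<Prod>i\<in>e. x i)"

text \<open>
  The weight \<open>R\<close> makes the notion stable under induction: terms that are already fixed are absorbed into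
  \<open>R\<close>, and the bound \<open>N\<close> does not depend on them.
\<close>

definition few_biased :: "'p::prime_card itself \<Rightarrow> 'i set \<Rightarrow> 'i set set \<Rightarrow> real \<Rightarrow> real \<Rightarrow> bool" where
  "few_biased _ V E \<eta> N \<longleftrightarrow> (\<forall>R :: ('i \<Rightarrow> 'p mod_ring) \<Rightarrow> complex. (\<forall>x. cmod (R x) \<le> 1) \<longrightarrow>
     real (card {c \<in> vecs E. cmod (\<Sum>x\<in>vecs V. R x * chi (pev var_prod E c x)) \<ge> \<eta> * real CARD('p) ^ card V}) \<le> N)"

lemma few_biasedD:
  fixes R :: "('i \<Rightarrow> 'p::prime_card mod_ring) \<Rightarrow> complex"
  assumes "few_biased TYPE('p) V E \<eta> N" "\<And>x. cmod (R x) \<le> 1"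
  shows "real (card {c \<in> vecs E. cmod (\<Sum>x\<in>vecs V. R x * chi (pev var_prod E c x)) \<ge> \<eta> * real CARD('p) ^ card V}) \<le> N"
  using assms unfolding few_biased_def by blast

definition glue :: "'i set \<Rightarrow> ('i \<Rightarrow> 'a) \<Rightarrow> ('i \<Rightarrow> 'a) \<Rightarrow> 'i \<Rightarrow> 'a" where
  "glue W y z = (\<lambda>i. if i \<in> W then y i else z i)"

lemma sum_vecs_Un:
  fixes f :: "('i \<Rightarrow> 'p::prime_card mod_ring) \<Rightarrow> 'b::comm_monoid_add"
  assumes "W \<inter> V = {}"
  shows "(\<Sum>x\<in>vecs (W \<union> V). f x) = (\<Sum>y\<in>vecs W. \<Sum>z\<in>vecs V. f (glue W y z))"
proof -
  have "(\<Sum>x\<in>vecs (W \<union> V). f x) = (\<Sum>(y, z)\<in>vecs W \<times> vecs V. f (glue W y z))"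
  proof (rule sum.reindex_bij_witness[of _ "\<lambda>(y, z). glue W y z" "\<lambda>x. (restrict x W, restrict x V)"])
    fix x :: "'i \<Rightarrow> 'p mod_ring" assume x: "x \<in> vecs (W \<union> V)"
    have "glue W (restrict x W) (restrict x V) = x"
      using PiE_arb[OF x] by (intro ext) (simp add: glue_def)
    then show "(case (restrict x W, restrict x V) of (y, z) \<Rightarrow> glue W y z) = x"
      "(case (restrict x W, restrict x V) of (y, z) \<Rightarrow> f (glue W y z)) = f x" by simp_all
    show "(restrict x W, restrict x V) \<in> vecs W \<times> vecs V" by simp
  next
    fix b :: "('i \<Rightarrow> 'p mod_ring) \<times> ('i \<Rightarrow> 'p mod_ring)" assume b: "b \<in> vecs W \<times> vecs V"
    then obtain y z where yz: "b = (y, z)" "y \<in> vecs W" "z \<in> vecs V" by blast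
    have "restrict (glue W y z) W = y"
      using PiE_arb[OF yz(2)] by (intro ext) (simp add: glue_def)
    moreover have "restrict (glue W y z) V = z"
      using PiE_arb[OF yz(3)] assms by (intro ext) (auto simp: glue_def)
    ultimately show "(restrict (case b of (y, z) \<Rightarrow> glue W y z) W, restrict (case b of (y, z) \<Rightarrow> glue W y z) V) = b"
      using yz by simp
    show "(case b of (y, z) \<Rightarrow> glue W y z) \<in> vecs (W \<union> V)"
      using PiE_arb[OF yz(3)] by (simp add: yz(1) glue_def PiE_iff extensional_def)
  qed
  then show ?thesis by (simp add: sum.cartesian_product)
qed

text \<open>
  Here \<open>Q\<close> ranges over the part of the polynomial that is linear in the variables of the block \<open>W\<close>,
  and \<open>R\<close> contains everything else. If the whole sum is at least \<open>\<eta>\<close> times its trivial bound, then for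
  at least a share \<open>\<eta> / 2\<close> of the values \<open>y\<close> of the block the remaining polynomial \<open>comb W E y Q\<close> is
  biased with parameter \<open>\<eta> / 2\<close>. Count the pairs of such a \<open>Q\<close> and \<open>l\<close> independent values \<open>y\<close> of this
  kind. Each \<open>Q\<close> admits at least \<open>(\<eta> / 4 * p ^ card W) ^ l\<close> of them by \<open>card_indep_tuples_ge\<close>,
  whereas \<open>card_comb_in_le\<close> bounds the number of \<open>Q\<close> for each choice of the values.
\<close>

lemma card_biased_fibre:
  fixes R :: "('i \<Rightarrow> 'p::prime_card mod_ring) \<Rightarrow> ('i \<Rightarrow> 'p mod_ring) \<Rightarrow> complex"
  assumes W: "finite W" and V: "finite V" and E: "finite E"
    and R: "\<And>y z. cmod (R y z) \<le> 1"
    and few: "few_biased TYPE('p) V E (\<eta> / 2) N" and \<eta>: "0 < \<eta>"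
    and l: "l \<le> card W" "4 * real CARD('p) ^ l \<le> \<eta> * real CARD('p) ^ card W"
  shows "real (card {Q \<in> vecs (W \<times> E).
        cmod (\<Sum>y\<in>vecs W. \<Sum>z\<in>vecs V. R y z * chi (pev var_prod E (comb W E y Q) z))
          \<ge> \<eta> * real CARD('p) ^ (card W + card V)})
     \<le> (4 / \<eta>) ^ l * N ^ l * real CARD('p) ^ (card E * (card W - l))"
proof -
  let ?p = "real CARD('p)"
  define inner where "inner y d = (\<Sum>z\<in>vecs V. R y z * chi (pev var_prod E d z))" for y d
  define Bad where "Bad y = {d \<in> vecs E. cmod (inner y d) \<ge> \<eta> / 2 * ?p ^ card V}" for y
  define F where "F = {Q \<in> vecs (W \<times> E). cmod (\<Sum>y\<in>vecs W. inner y (comb W E y Q))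
          \<ge> \<eta> * ?p ^ (card W + card V)}"
  define Y where "Y Q = {y \<in> vecs W. comb W E y Q \<in> Bad y}" for Q
  define I where "I = {ys \<in> {..<l} \<rightarrow>\<^sub>E vecs W. indep W l (ys :: nat \<Rightarrow> 'i \<Rightarrow> 'p mod_ring)}"
  have p0: "?p > 0" by simp
  have finF: "finite F" unfolding F_def
    by (rule finite_subset[OF _ finite_vecs[OF finite_cartesian_product[OF W E]]]) auto
  have finW: "finite (vecs W :: ('i \<Rightarrow> 'p mod_ring) set)" by (rule finite_vecs[OF W])
  have finI: "finite I" unfolding I_def
    by (rule finite_subset[of _ "{..<l} \<rightarrow>\<^sub>E vecs W"]) (auto intro!: finite_PiE finW)
  have Bad: "real (card (Bad y)) \<le> N" for y
    unfolding Bad_def inner_def by (rule few_biasedD[OF few R])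
  have N0: "0 \<le> N" using Bad[of undefined] by (meson of_nat_0_le_iff order_trans)
  have inner_le: "cmod (inner y d) \<le> ?p ^ card V" for y d
  proof -
    have "cmod (inner y d) \<le> (\<Sum>z\<in>(vecs V :: ('i \<Rightarrow> 'p mod_ring) set). 1)"
      unfolding inner_def by (rule sum_norm_le) (simp add: norm_mult R)
    then show ?thesis by (simp add: card_vecs[OF V])
  qed
  have Yge: "\<eta> / 2 * ?p ^ card W \<le> real (card (Y Q))" if "Q \<in> F" for Q
  proof -
    have "\<eta> * ?p ^ (card W + card V) \<le> (\<Sum>y\<in>vecs W. cmod (inner y (comb W E y Q)))"
      using that unfolding F_def by (auto intro: order_trans[OF _ norm_sum])
    also have "\<dots> \<le> (\<Sum>y\<in>vecs W. \<eta> / 2 * ?p ^ card V + of_bool (y \<in> Y Q) * ?p ^ card V)"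
    proof (rule sum_mono)
      fix y :: "'i \<Rightarrow> 'p mod_ring" assume y: "y \<in> vecs W"
      show "cmod (inner y (comb W E y Q)) \<le> \<eta> / 2 * ?p ^ card V + of_bool (y \<in> Y Q) * ?p ^ card V"
      proof (cases "y \<in> Y Q")
        case True
        have "0 \<le> \<eta> / 2 * ?p ^ card V" using \<eta> by simp
        then show ?thesis using True inner_le[of y "comb W E y Q"] by simp
      next
        case False
        then show ?thesis using y by (auto simp: Y_def Bad_def)
      qed
    qed
    also have "\<dots> = ?p ^ card W * (\<eta> / 2 * ?p ^ card V) + real (card (Y Q)) * ?p ^ card V"
    proof -
      have "(\<Sum>y\<in>vecs W. of_bool (y \<in> Y Q) :: real) = real (card (Y Q))"
        using finW by (subst sum_of_bool_eq) (auto simp: Y_def Int_def intro!: arg_cong[where f = card])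
      then show ?thesis
        by (simp only: sum.distrib sum_distrib_right[symmetric]) (simp add: card_vecs[OF W])
    qed
    finally have "?p ^ card V * (\<eta> * ?p ^ card W) \<le> ?p ^ card V * (\<eta> / 2 * ?p ^ card W + real (card (Y Q)))"
      by (simp add: power_add algebra_simps)
    then have "\<eta> * ?p ^ card W \<le> \<eta> / 2 * ?p ^ card W + real (card (Y Q))"
      using p0 by (simp only: mult_le_cancel_left_pos zero_less_power)
    then show ?thesis by simp
  qed
  \<comment> \<open>The span of fewer than \<open>l\<close> vectors has at most \<open>\<eta> / 4 * p ^ card W\<close> elements, which leaves half of \<open>Y Q\<close> at each step.\<close>
  have low: "(\<eta> / 4 * ?p ^ card W) ^ l \<le> real (card {ys \<in> I. \<forall>j<l. ys j \<in> Y Q})" if Q: "Q \<in> F" for Q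
  proof -
    have YW: "Y Q \<subseteq> vecs W" by (auto simp: Y_def)
    have "(\<eta> / 4 * ?p ^ card W) ^ l = (\<Prod>j<l. \<eta> / 4 * ?p ^ card W)" by simp
    also have "\<dots> \<le> (\<Prod>j<l. real (card (Y Q) - CARD('p) ^ j))"
    proof (rule prod_mono, intro conjI)
      fix j assume "j \<in> {..<l}"
      then have "?p ^ j \<le> ?p ^ l" using prime_card_gt_1[where 'p='p] by (intro power_increasing) auto
      then have "\<eta> / 4 * ?p ^ card W \<le> real (card (Y Q)) - ?p ^ j" using l(2) Yge[OF Q] by simp
      also have "\<dots> \<le> real (card (Y Q) - CARD('p) ^ j)"
        using of_nat_diff_real[of "card (Y Q)" "CARD('p) ^ j"] by simp
      finally show "\<eta> / 4 * ?p ^ card W \<le> real (card (Y Q) - CARD('p) ^ j)" .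
    qed (use \<eta> in simp)
    also have "\<dots> = real (\<Prod>j<l. card (Y Q) - CARD('p) ^ j)" by simp
    also have "\<dots> \<le> real (card {ys \<in> {..<l} \<rightarrow>\<^sub>E Y Q. indep W l ys})"
      using card_indep_tuples_ge[OF W YW, of l] by (simp only: of_nat_le_iff)
    also have "\<dots> \<le> real (card {ys \<in> I. \<forall>j<l. ys j \<in> Y Q})"
    proof -
      have "{ys \<in> {..<l} \<rightarrow>\<^sub>E Y Q. indep W l ys} \<subseteq> {ys \<in> I. \<forall>j<l. ys j \<in> Y Q}"
      proof
        fix ys assume ys: "ys \<in> {ys \<in> {..<l} \<rightarrow>\<^sub>E Y Q. indep W l ys}"
        then have "ys \<in> {..<l} \<rightarrow>\<^sub>E vecs W" using PiE_mono[of "{..<l}" "\<lambda>_. Y Q" "\<lambda>_. vecs W"] YW by blast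
        then show "ys \<in> {ys \<in> I. \<forall>j<l. ys j \<in> Y Q}" using ys unfolding I_def by simp blast
      qed
      then have "card {ys \<in> {..<l} \<rightarrow>\<^sub>E Y Q. indep W l ys} \<le> card {ys \<in> I. \<forall>j<l. ys j \<in> Y Q}"
        using finI by (intro card_mono) simp_all
      then show ?thesis by (simp only: of_nat_le_iff)
    qed
    finally show ?thesis .
  qed
  have up: "real (card {Q \<in> F. \<forall>j<l. ys j \<in> Y Q}) \<le> N ^ l * ?p ^ (card E * (card W - l))" if ys: "ys \<in> I" for ys
  proof -
    have "card {Q \<in> F. \<forall>j<l. ys j \<in> Y Q} \<le> card {Q \<in> vecs (W \<times> E). \<forall>j<l. comb W E (ys j) Q \<in> Bad (ys j)}"
      using finite_vecs[of "W \<times> E"] W E by (intro card_mono) (auto simp: F_def Y_def)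
    also have "\<dots> \<le> (\<Prod>j<l. card (Bad (ys j))) * CARD('p) ^ (card E * (card W - l))"
      by (rule card_comb_in_le[OF W E _ l(1)]) (use ys in \<open>auto simp: I_def Bad_def\<close>)
    finally have "real (card {Q \<in> F. \<forall>j<l. ys j \<in> Y Q})
        \<le> (\<Prod>j<l. real (card (Bad (ys j)))) * ?p ^ (card E * (card W - l))"
      by (simp only: of_nat_mult[symmetric] of_nat_prod[symmetric] of_nat_power[symmetric] of_nat_le_iff)
    also have "(\<Prod>j<l. real (card (Bad (ys j)))) \<le> (\<Prod>j<l. N)"
      by (rule prod_mono) (simp add: Bad)
    finally show ?thesis by (simp add: mult_right_mono)
  qed
  have cardI: "real (card I) \<le> (?p ^ card W) ^ l"
  proof -
    have "card I \<le> card ({..<l} \<rightarrow>\<^sub>E (vecs W :: ('i \<Rightarrow> 'p mod_ring) set))"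
      unfolding I_def by (intro card_mono finite_PiE finW) auto
    also have "\<dots> = (CARD('p) ^ card W) ^ l" by (simp add: card_PiE card_vecs[OF W])
    finally show ?thesis by (simp only: of_nat_power[symmetric] of_nat_le_iff)
  qed
  have "real (card F) * (\<eta> / 4 * ?p ^ card W) ^ l \<le> (\<Sum>Q\<in>F. real (card {ys \<in> I. \<forall>j<l. ys j \<in> Y Q}))"
    using sum_mono[of F "\<lambda>_. (\<eta> / 4 * ?p ^ card W) ^ l", OF low] by simp
  also have "\<dots> = (\<Sum>Q\<in>F. \<Sum>ys\<in>I. of_bool (\<forall>j<l. ys j \<in> Y Q))"
    using finI by (simp add: sum_of_bool_eq Int_def)
  also have "\<dots> = (\<Sum>ys\<in>I. \<Sum>Q\<in>F. of_bool (\<forall>j<l. ys j \<in> Y Q))" by (rule sum.swap)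
  also have "\<dots> = (\<Sum>ys\<in>I. real (card {Q \<in> F. \<forall>j<l. ys j \<in> Y Q}))"
    using finF by (simp add: sum_of_bool_eq Int_def)
  also have "\<dots> \<le> real (card I) * (N ^ l * ?p ^ (card E * (card W - l)))"
    using sum_mono[of I _ "\<lambda>_. N ^ l * ?p ^ (card E * (card W - l))", OF up] by simp
  also have "\<dots> \<le> (?p ^ card W) ^ l * (N ^ l * ?p ^ (card E * (card W - l)))"
    using N0 by (intro mult_right_mono cardI) simp
  finally have main: "real (card F) * (\<eta> / 4 * ?p ^ card W) ^ l
      \<le> (?p ^ card W) ^ l * (N ^ l * ?p ^ (card E * (card W - l)))" .
  have pos: "0 < (\<eta> / 4 * ?p ^ card W) ^ l" using \<eta> by simp
  have "(?p ^ card W) ^ l * (N ^ l * ?p ^ (card E * (card W - l)))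
      = ((4 / \<eta>) ^ l * N ^ l * ?p ^ (card E * (card W - l))) * (\<eta> / 4 * ?p ^ card W) ^ l"
  proof -
    have "(4 / \<eta>) ^ l * (\<eta> / 4 * ?p ^ card W) ^ l = (?p ^ card W) ^ l"
      using \<eta> by (simp flip: power_mult_distrib)
    then show ?thesis by (simp add: mult_ac)
  qed
  then have "real (card F) \<le> (4 / \<eta>) ^ l * N ^ l * ?p ^ (card E * (card W - l))"
    using main pos by (simp only: mult_le_cancel_right_pos)
  then show ?thesis unfolding F_def inner_def by simp
qed

text \<open>
  The variable of a monomial that comes from \<open>W\<close> can be recovered when the remaining ones avoid \<open>W\<close>.
\<close>

lemma inj_on_insert_Times:
  assumes "W \<inter> V = {}" "F \<subseteq> Pow V"
  shows "inj_on (\<lambda>(i, e). insert i e) (W \<times> F)"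
proof (rule inj_onI)
  fix a b assume ab: "a \<in> W \<times> F" "b \<in> W \<times> F" "(\<lambda>(i, e). insert i e) a = (\<lambda>(i, e). insert i e) b"
  obtain i e i' e' where e: "a = (i, e)" "b = (i', e')" by (metis surj_pair)
  have h: "i \<in> W" "i' \<in> W" "e \<subseteq> V" "e' \<subseteq> V" "insert i e = insert i' e'"
    using ab assms(2) unfolding e by auto
  have n: "i \<notin> e" "i' \<notin> e" "i \<notin> e'" "i' \<notin> e'" using h assms(1) by blast+
  then have "i = i'" using h(5) by blast
  moreover have "e = e'" using h(5) n \<open>i = i'\<close> by (simp add: insert_ident)
  ultimately show "a = b" unfolding e by simp
qed

text \<open>
  A polynomial on \<open>W \<union> V\<close> that is linear in the block \<open>W\<close> consists of a part \<open>E0\<close> free of \<open>W\<close> and a part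
  in which every monomial has one variable from \<open>W\<close>. For the first part, fix a value of the block that
  keeps the sum large: the second part then becomes one of only \<open>p ^ card E1\<close> polynomials of lower
  degree, and a union bound over these and over the values of the block gives the factor
  \<open>p ^ card W * p ^ card E1 * N0\<close>. Given the first part, the second one is counted by
  \<open>card_biased_fibre\<close>.

  The gain is in the last factor: with \<open>l\<close> close to \<open>card W\<close>, almost all of the \<open>p ^ (card E1 * card W)\<close>
  possible second parts are excluded.
\<close>

lemma few_biased_Un:
  fixes W V :: "'i set" and N0 N1 :: real
  assumes W: "finite W" and V: "finite V" and WV: "W \<inter> V = {}"
    and E0: "E0 \<subseteq> Pow V" and E1: "E1 \<subseteq> Pow V"
    and few0: "few_biased TYPE('p::prime_card) V E0 \<eta> N0"
    and few1: "few_biased TYPE('p) V E1 (\<eta> / 2) N1" and \<eta>: "0 < \<eta>"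
    and l: "l \<le> card W" "4 * real CARD('p) ^ l \<le> \<eta> * real CARD('p) ^ card W"
  shows "few_biased TYPE('p) (W \<union> V) (E0 \<union> (\<lambda>(i, e). insert i e) ` (W \<times> E1)) \<eta>
     (real CARD('p) ^ card W * real CARD('p) ^ card E1 * N0 *
       ((4 / \<eta>) ^ l * N1 ^ l * real CARD('p) ^ (card E1 * (card W - l))))"
  unfolding few_biased_def
proof (intro allI impI)
  fix R :: "('i \<Rightarrow> 'p mod_ring) \<Rightarrow> complex" assume R: "\<forall>x. cmod (R x) \<le> 1"
  let ?p = "real CARD('p)"
  let ?ins = "\<lambda>(i, e). insert i e :: 'i set"
  let ?E = "E0 \<union> ?ins ` (W \<times> E1)"
  have fin: "finite E0" "finite E1" using E0 E1 V by (auto intro: finite_subset)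
  have finWE: "finite (W \<times> E1)" using W fin by simp
  define dec where "dec c = (restrict c E0, \<lambda>x\<in>W \<times> E1. c (?ins x))" for c :: "'i set \<Rightarrow> 'p mod_ring"
  define G where "G c0 Q = (\<Sum>y\<in>vecs W. \<Sum>z\<in>vecs V. (R (glue W y z) * chi (pev var_prod E0 c0 z))
      * chi (pev var_prod E1 (comb W E1 y Q) z))" for c0 Q
  define S where "S = {c \<in> vecs ?E. cmod (\<Sum>x\<in>vecs (W \<union> V). R x * chi (pev var_prod ?E c x)) \<ge> \<eta> * ?p ^ card (W \<union> V)}"
  define S' where "S' = {(c0, Q). c0 \<in> vecs E0 \<and> Q \<in> vecs (W \<times> E1) \<and> cmod (G c0 Q) \<ge> \<eta> * ?p ^ (card W + card V)}"
  have finS': "finite S'"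
  proof (rule finite_subset)
    show "S' \<subseteq> vecs E0 \<times> vecs (W \<times> E1)" by (auto simp: S'_def)
    show "finite (vecs E0 \<times> vecs (W \<times> E1) :: (('i set \<Rightarrow> 'p mod_ring) \<times> ('i \<times> 'i set \<Rightarrow> 'p mod_ring)) set)"
      using finite_vecs[OF fin(1)] finite_vecs[OF finWE] by blast
  qed
  have inj: "inj_on ?ins (W \<times> E1)" by (rule inj_on_insert_Times[OF WV E1])
  have disj: "E0 \<inter> ?ins ` (W \<times> E1) = {}" using E0 WV by fastforce
  have split: "pev var_prod ?E c (glue W y z) = pev var_prod E0 (fst (dec c)) z + pev var_prod E1 (comb W E1 y (snd (dec c))) z" for c y z
  proof -
    have m: "var_prod e (glue W y z) = var_prod e z" if "e \<subseteq> V" for e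
      unfolding var_prod_def using that WV by (intro prod.cong) (auto simp: glue_def)
    have mi: "var_prod (insert i e) (glue W y z) = y i * var_prod e z" if "i \<in> W" "e \<subseteq> V" for i e
    proof -
      have "i \<notin> e" "finite e" using that WV V by (auto intro: finite_subset)
      then have "var_prod (insert i e) (glue W y z) = glue W y z i * var_prod e (glue W y z)" by (simp add: var_prod_def)
      then show ?thesis using m[OF that(2)] that(1) by (simp add: glue_def)
    qed
    have "pev var_prod ?E c (glue W y z) = (\<Sum>e\<in>E0. c e * var_prod e (glue W y z))
        + (\<Sum>e\<in>?ins ` (W \<times> E1). c e * var_prod e (glue W y z))"
      unfolding pev_def by (rule sum.union_disjoint) (use fin finWE disj in auto)
    also have "(\<Sum>e\<in>E0. c e * var_prod e (glue W y z)) = pev var_prod E0 (fst (dec c)) z"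
      unfolding pev_def by (rule sum.cong) (use E0 in \<open>auto simp: m dec_def\<close>)
    also have "(\<Sum>e\<in>?ins ` (W \<times> E1). c e * var_prod e (glue W y z))
        = (\<Sum>(i, e)\<in>W \<times> E1. c (insert i e) * (y i * var_prod e z))"
      by (subst sum.reindex[OF inj]) (rule sum.cong, use E1 mi in auto)
    also have "\<dots> = (\<Sum>i\<in>W. \<Sum>e\<in>E1. c (insert i e) * (y i * var_prod e z))"
      by (rule sum.cartesian_product[symmetric])
    also have "\<dots> = (\<Sum>e\<in>E1. \<Sum>i\<in>W. c (insert i e) * (y i * var_prod e z))" by (rule sum.swap)
    also have "\<dots> = (\<Sum>e\<in>E1. comb W E1 y (snd (dec c)) e * var_prod e z)"
      by (rule sum.cong) (simp_all add: comb_def dec_def sum_distrib_left sum_distrib_right mult_ac)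
    finally show ?thesis unfolding pev_def .
  qed
  have cardWV: "card (W \<union> V) = card W + card V" using W V WV by (rule card_Un_disjoint)
  have "card S \<le> card S'"
  proof (rule card_inj_on_le[OF _ _ finS'])
    show "inj_on dec S"
    proof (rule inj_onI)
      fix c c' assume h: "c \<in> S" "c' \<in> S" "dec c = dec c'"
      have c0: "c e = c' e" if "e \<in> E0" for e
        using fun_cong[OF arg_cong[OF h(3), of fst], of e] that by (simp add: dec_def)
      have c1: "c (insert i e) = c' (insert i e)" if "i \<in> W" "e \<in> E1" for i e
        using fun_cong[OF arg_cong[OF h(3), of snd], of "(i, e)"] that by (simp add: dec_def)
      have "c \<in> vecs ?E" "c' \<in> vecs ?E" using h by (simp_all add: S_def)
      then show "c = c'" by (rule PiE_ext) (use c0 c1 in auto)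
    qed
    show "dec ` S \<subseteq> S'"
    proof (rule image_subsetI)
      fix c assume c: "c \<in> S"
      have "(\<Sum>x\<in>vecs (W \<union> V). R x * chi (pev var_prod ?E c x)) = G (fst (dec c)) (snd (dec c))"
        unfolding G_def sum_vecs_Un[OF WV]
        by (intro sum.cong refl) (simp only: split chi_add mult.assoc)
      then have "cmod (G (fst (dec c)) (snd (dec c))) \<ge> \<eta> * ?p ^ (card W + card V)"
        using c unfolding S_def cardWV by simp
      then show "dec c \<in> S'" by (simp add: S'_def dec_def)
    qed
  qed
  also have "card S' \<le> (\<Sum>c0\<in>fst ` S'. card {Q. (c0, Q) \<in> S'})"
  proof -
    have "S' \<subseteq> (SIGMA c0:fst ` S'. {Q. (c0, Q) \<in> S'})"
    proof
      fix a assume a: "a \<in> S'"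
      then have "fst a \<in> fst ` S'" by (rule imageI)
      then show "a \<in> (SIGMA c0:fst ` S'. {Q. (c0, Q) \<in> S'})"
        using a by (simp add: mem_Sigma_iff[of "fst a" "snd a", simplified])
    qed
    moreover have fin2: "finite {Q. (c0, Q) \<in> S'}" for c0
    proof (rule finite_subset[OF _ finite_imageI[OF finS', of snd]])
      show "{Q. (c0, Q) \<in> S'} \<subseteq> snd ` S'"
      proof
        fix Q assume "Q \<in> {Q. (c0, Q) \<in> S'}"
        then have "(c0, Q) \<in> S'" by (rule CollectD)
        from imageI[OF this, of snd] show "Q \<in> snd ` S'" by (simp only: snd_conv)
      qed
    qed
    ultimately have "card S' \<le> card (SIGMA c0:fst ` S'. {Q. (c0, Q) \<in> S'})"
      by (intro card_mono finite_SigmaI finite_imageI finS')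
    then show ?thesis using fin2 finS' by (simp add: card_SigmaI)
  qed
  finally have "real (card S) \<le> (\<Sum>c0\<in>fst ` S'. real (card {Q. (c0, Q) \<in> S'}))"
    by (simp flip: of_nat_sum)
  also have "\<dots> \<le> (\<Sum>c0\<in>fst ` S'. (4 / \<eta>) ^ l * N1 ^ l * real CARD('p) ^ (card E1 * (card W - l)))"
  proof (rule sum_mono)
    fix c0 assume c0: "c0 \<in> fst ` S'"
    have c0v: "c0 \<in> vecs E0" using c0 by (auto simp: S'_def)
    have "{Q. (c0, Q) \<in> S'} = {Q \<in> vecs (W \<times> E1). cmod (G c0 Q) \<ge> \<eta> * real CARD('p) ^ (card W + card V)}"
      using c0v by (auto simp: S'_def)
    then show "real (card {Q. (c0, Q) \<in> S'}) \<le> (4 / \<eta>) ^ l * N1 ^ l * real CARD('p) ^ (card E1 * (card W - l))"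
      unfolding G_def using card_biased_fibre[OF W V fin(2) _ few1 \<eta> l,
          of "\<lambda>y z. R (glue W y z) * chi (pev var_prod E0 c0 z)"] R
      by (simp add: norm_mult)
  qed
  also have "\<dots> = real (card (fst ` S')) * ((4 / \<eta>) ^ l * N1 ^ l * real CARD('p) ^ (card E1 * (card W - l)))"
    by simp
  also have "\<dots> \<le> (real CARD('p) ^ card W * real CARD('p) ^ card E1 * N0) *
      ((4 / \<eta>) ^ l * N1 ^ l * real CARD('p) ^ (card E1 * (card W - l)))"
  proof (rule mult_right_mono)
    define Bad where "Bad = (\<lambda>(y, d). {c \<in> vecs E0. cmod (\<Sum>z\<in>vecs V. (R (glue W y z) * chi (pev var_prod E1 d z))
        * chi (pev var_prod E0 c z)) \<ge> \<eta> * ?p ^ card V})"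
    have Bad: "real (card (Bad yd)) \<le> N0" for yd
    proof -
      obtain y d where yd: "yd = (y, d)" by fastforce
      show ?thesis unfolding yd Bad_def prod.case
        by (rule few_biasedD[OF few0]) (use R in \<open>simp add: norm_mult\<close>)
    qed
    have finB: "finite (Bad yd)" for yd
      by (rule finite_subset[OF _ finite_vecs[OF fin(1)]]) (auto simp: Bad_def split: prod.splits)
    let ?YD = "vecs W \<times> vecs E1 :: (('i \<Rightarrow> 'p mod_ring) \<times> ('i set \<Rightarrow> 'p mod_ring)) set"
    have finYD: "finite ?YD" using finite_vecs[OF W] finite_vecs[OF fin(2)] by blast
    have "fst ` S' \<subseteq> (\<Union>yd\<in>?YD. Bad yd)"
    proof
      fix c0 assume "c0 \<in> fst ` S'"
      then obtain Q where c0: "c0 \<in> vecs E0" and Q: "cmod (G c0 Q) \<ge> \<eta> * ?p ^ (card W + card V)"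
        by (auto simp: S'_def)
      have "\<exists>y\<in>vecs W. cmod (\<Sum>z\<in>vecs V. (R (glue W y z) * chi (pev var_prod E0 c0 z))
          * chi (pev var_prod E1 (comb W E1 y Q) z)) \<ge> \<eta> * ?p ^ card V"
      proof (rule ccontr)
        assume "\<not> ?thesis"
        then have lt: "cmod (\<Sum>z\<in>vecs V. (R (glue W y z) * chi (pev var_prod E0 c0 z))
          * chi (pev var_prod E1 (comb W E1 y Q) z)) < \<eta> * ?p ^ card V" if "y \<in> vecs W" for y
          using that by force
        have "cmod (G c0 Q) \<le> (\<Sum>y\<in>vecs W. cmod (\<Sum>z\<in>vecs V. (R (glue W y z) * chi (pev var_prod E0 c0 z))
          * chi (pev var_prod E1 (comb W E1 y Q) z)))" unfolding G_def by (rule norm_sum)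
        also have "\<dots> < (\<Sum>y\<in>(vecs W :: ('i \<Rightarrow> 'p mod_ring) set). \<eta> * ?p ^ card V)"
          by (rule sum_strict_mono[OF finite_vecs[OF W]]) (auto simp: PiE_eq_empty_iff lt)
        also have "\<dots> = \<eta> * ?p ^ (card W + card V)"
          by (simp add: card_vecs[OF W] power_add)
        finally show False using Q by simp
      qed
      then obtain y where y: "y \<in> vecs W" "cmod (\<Sum>z\<in>vecs V. (R (glue W y z) * chi (pev var_prod E0 c0 z))
          * chi (pev var_prod E1 (comb W E1 y Q) z)) \<ge> \<eta> * ?p ^ card V" by blast
      have "c0 \<in> Bad (y, comb W E1 y Q)"
      proof -
        have es: "(\<Sum>z\<in>vecs V. R (glue W y z) * chi (pev var_prod E1 d z) * chi (pev var_prod E0 c0 z))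
            = (\<Sum>z\<in>vecs V. R (glue W y z) * chi (pev var_prod E0 c0 z) * chi (pev var_prod E1 d z))" for d
          by (rule sum.cong[OF refl]) (simp only: mult_ac)
        show ?thesis unfolding Bad_def prod.case mem_Collect_eq es by (rule conjI[OF c0 y(2)])
      qed
      moreover have "(y, comb W E1 y Q) \<in> ?YD" using y(1) by simp
      ultimately show "c0 \<in> (\<Union>yd\<in>?YD. Bad yd)" by (rule UN_I[rotated])
    qed
    then have "card (fst ` S') \<le> card (\<Union>yd\<in>?YD. Bad yd)"
      using finYD finB by (intro card_mono) auto
    also have "\<dots> \<le> (\<Sum>yd\<in>?YD. card (Bad yd))" by (rule card_UN_le[OF finYD])
    finally have "real (card (fst ` S')) \<le> (\<Sum>yd\<in>?YD. real (card (Bad yd)))" by (simp flip: of_nat_sum)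
    also have "\<dots> \<le> (\<Sum>yd\<in>?YD. N0)" by (rule sum_mono) (rule Bad)
    also have "\<dots> = real CARD('p) ^ card W * real CARD('p) ^ card E1 * N0"
      by (simp only: sum_constant card_cartesian_product card_vecs[OF W] card_vecs[OF fin(2)] of_nat_mult of_nat_power)
    finally show "real (card (fst ` S')) \<le> real CARD('p) ^ card W * real CARD('p) ^ card E1 * N0" .
    have "0 \<le> N1" using few_biasedD[OF few1, of "\<lambda>_. 0"] by (simp add: order_trans[OF of_nat_0_le_iff])
    then show "0 \<le> (4 / \<eta>) ^ l * N1 ^ l * real CARD('p) ^ (card E1 * (card W - l))" using \<eta> by simp
  qed
  finally show "real (card {c \<in> vecs ?E. \<eta> * real CARD('p) ^ card (W \<union> V)
           \<le> cmod (\<Sum>x\<in>vecs (W \<union> V). R x * chi (pev var_prod ?E c x))})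
    \<le> real CARD('p) ^ card W * real CARD('p) ^ card E1 * N0 *
       ((4 / \<eta>) ^ l * N1 ^ l * real CARD('p) ^ (card E1 * (card W - l)))"
    unfolding S_def by simp
qed

lemma few_biased_mono:
  assumes "few_biased TYPE('p::prime_card) V E \<eta> N" "N \<le> N'"
  shows "few_biased TYPE('p) V E \<eta> N'"
  using assms unfolding few_biased_def by (blast intro: order_trans)

text \<open>
  Parseval's identity, for points that are separated by the monomials.
\<close>

lemma sum_norm_square_chi:
  fixes R :: "'x \<Rightarrow> complex" and f :: "'e \<Rightarrow> 'x \<Rightarrow> 'p::prime_card mod_ring"
  assumes X: "finite X" and E: "finite E"
    and sep: "\<And>x x'. x \<in> X \<Longrightarrow> x' \<in> X \<Longrightarrow> (\<forall>e\<in>E. f e x = f e x') \<Longrightarrow> x = x'"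
  shows "(\<Sum>c\<in>vecs E. (cmod (\<Sum>x\<in>X. R x * chi (pev f E c x)))\<^sup>2)
    = real CARD('p) ^ card E * (\<Sum>x\<in>X. (cmod (R x))\<^sup>2)"
proof -
  have diff: "chi (pev f E c x) * cnj (chi (pev f E c x')) = chi (\<Sum>e\<in>E. c e * (f e x - f e x'))" for c x x'
  proof -
    have "(\<Sum>e\<in>E. c e * (f e x - f e x')) = pev f E c x + - pev f E c x'"
      unfolding pev_def by (simp only: right_diff_distrib sum_subtractf add_uminus_conv_diff)
    then show ?thesis by (simp only: chi_add chi_minus)
  qed
  have "complex_of_real (\<Sum>c\<in>vecs E. (cmod (\<Sum>x\<in>X. R x * chi (pev f E c x)))\<^sup>2)
    = (\<Sum>c\<in>vecs E. (\<Sum>x\<in>X. R x * chi (pev f E c x)) * cnj (\<Sum>x\<in>X. R x * chi (pev f E c x)))"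
    unfolding of_real_sum by (intro sum.cong refl) (simp only: complex_norm_square)
  also have "\<dots> = (\<Sum>c\<in>vecs E. \<Sum>x\<in>X. \<Sum>x'\<in>X. (R x * cnj (R x')) * chi (\<Sum>e\<in>E. c e * (f e x - f e x')))"
    unfolding diff[symmetric] cnj_sum sum_product complex_cnj_mult
    by (intro sum.cong refl) (simp only: mult_ac)
  also have "\<dots> = (\<Sum>x\<in>X. \<Sum>x'\<in>X. \<Sum>c\<in>vecs E. (R x * cnj (R x')) * chi (\<Sum>e\<in>E. c e * (f e x - f e x')))"
    by (subst sum.swap, rule sum.cong[OF refl], rule sum.swap)
  also have "\<dots> = (\<Sum>x\<in>X. \<Sum>x'\<in>X. (R x * cnj (R x')) *
      (if \<forall>e\<in>E. f e x - f e x' = 0 then of_nat (CARD('p) ^ card E) else 0))"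
    by (simp only: sum_distrib_left[symmetric] sum_vecs_chi[OF E])
  also have "\<dots> = (\<Sum>x\<in>X. \<Sum>x'\<in>X. if x' = x then of_nat (CARD('p) ^ card E) * (R x * cnj (R x)) else 0)"
  proof (intro sum.cong refl)
    fix x x' assume "x \<in> X" "x' \<in> X"
    then have iff: "(\<forall>e\<in>E. f e x - f e x' = 0) \<longleftrightarrow> x' = x" using sep[of x x'] by auto
    show "(R x * cnj (R x')) * (if \<forall>e\<in>E. f e x - f e x' = 0 then of_nat (CARD('p) ^ card E) else 0)
      = (if x' = x then of_nat (CARD('p) ^ card E) * (R x * cnj (R x)) else 0)"
      unfolding iff by (cases "x' = x") simp_all
  qed
  also have "\<dots> = (\<Sum>x\<in>X. of_nat (CARD('p) ^ card E) * (R x * cnj (R x)))"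
    by (rule sum.cong[OF refl]) (simp add: sum.delta[OF X])
  also have "\<dots> = complex_of_real (real CARD('p) ^ card E * (\<Sum>x\<in>X. (cmod (R x))\<^sup>2))"
    unfolding of_real_mult of_real_sum complex_norm_square sum_distrib_left by simp
  finally show ?thesis by (simp only: of_real_eq_iff)
qed

text \<open>
  In degree one, Parseval's identity gives a bound without any dependence on the number of variables. The
  induction on the degree starts here because a start in degree zero would give nothing: the factor
  \<open>(4 / \<eta>) ^ l\<close> of \<open>few_biased_Un\<close> can exceed the number of linear forms in a block.
\<close>

lemma few_biased_linear:
  fixes V :: "'i set"
  assumes V: "finite V" and \<eta>: "0 < \<eta>"
  shows "few_biased TYPE('p::prime_card) V ((\<lambda>i. {i}) ` V) \<eta> (1 / \<eta>\<^sup>2)"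
  unfolding few_biased_def
proof (intro allI impI)
  fix R :: "('i \<Rightarrow> 'p mod_ring) \<Rightarrow> complex" assume R: "\<forall>x. cmod (R x) \<le> 1"
  let ?p = "real CARD('p)" and ?E = "(\<lambda>i. {i}) ` V"
  define F where "F c = cmod (\<Sum>x\<in>vecs V. R x * chi (pev var_prod ?E c x))" for c
  define S where "S = {c \<in> vecs ?E. F c \<ge> \<eta> * ?p ^ card V}"
  have E: "finite ?E" using V by simp
  have finE: "finite (vecs ?E :: ('i set \<Rightarrow> 'p mod_ring) set)" by (rule finite_vecs[OF E])
  have cE: "card ?E = card V" by (rule card_image) simp
  have S: "S \<subseteq> vecs ?E" by (auto simp: S_def)
  have "real (card S) * (\<eta> * ?p ^ card V)\<^sup>2 = (\<Sum>c\<in>S. (\<eta> * ?p ^ card V)\<^sup>2)" by simp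
  also have "\<dots> \<le> (\<Sum>c\<in>S. (F c)\<^sup>2)"
    by (rule sum_mono, rule power_mono) (use \<eta> in \<open>auto simp: S_def\<close>)
  also have "\<dots> \<le> (\<Sum>c\<in>vecs ?E. (F c)\<^sup>2)" by (rule sum_mono2[OF finE S]) simp
  also have "\<dots> = ?p ^ card ?E * (\<Sum>x\<in>(vecs V :: ('i \<Rightarrow> 'p mod_ring) set). (cmod (R x))\<^sup>2)"
    unfolding F_def
  proof (rule sum_norm_square_chi[OF finite_vecs[OF V] E])
    fix x x' :: "'i \<Rightarrow> 'p mod_ring"
    assume x: "x \<in> vecs V" "x' \<in> vecs V" "\<forall>e\<in>?E. var_prod e x = var_prod e x'"
    show "x = x'" by (rule PiE_ext[OF x(1,2)]) (use x(3) in \<open>simp add: var_prod_def\<close>)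
  qed
  also have "\<dots> \<le> ?p ^ card V * (\<Sum>x\<in>(vecs V :: ('i \<Rightarrow> 'p mod_ring) set). 1)"
    unfolding cE by (intro mult_left_mono sum_mono) (use R in \<open>simp_all add: power_le_one\<close>)
  also have "\<dots> = (?p ^ card V)\<^sup>2" by (simp add: card_vecs[OF V] power2_eq_square)
  finally have "(real (card S) * \<eta>\<^sup>2) * (?p ^ card V)\<^sup>2 \<le> 1 * (?p ^ card V)\<^sup>2"
    by (simp add: power_mult_distrib mult.assoc)
  then have "real (card S) * \<eta>\<^sup>2 \<le> 1" by (rule mult_right_le_imp_le) simp
  then show "real (card {c \<in> vecs ?E. \<eta> * ?p ^ card V \<le> cmod (\<Sum>x\<in>vecs V. R x * chi (pev var_prod ?E c x))}) \<le> 1 / \<eta>\<^sup>2"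
    unfolding S_def F_def using \<eta> by (simp add: pos_le_divide_eq)
qed

section \<open>Transversal monomials\<close>

text \<open>
  The squarefree monomials of degree \<open>q\<close> in \<open>K\<close> blocks of \<open>w\<close> consecutive variables with at most one
  variable from each block, as sets of variables. The recursion peels off the last block, as
  \<open>few_biased_Un\<close> does.
\<close>

fun transversals :: "nat \<Rightarrow> nat \<Rightarrow> nat \<Rightarrow> nat set set" where
  "transversals w K 0 = {{}}"
| "transversals w 0 (Suc q) = {}"
| "transversals w (Suc K) (Suc q) = transversals w K (Suc q) \<union>
     (\<lambda>(i, e). insert i e) ` ({K * w..<Suc K * w} \<times> transversals w K q)"

lemma transversals_subset: "transversals w K q \<subseteq> Pow {..<K * w}"
proof (induction w K q rule: transversals.induct)
  case (3 w K q)
  then show ?case by (fastforce simp: subset_iff)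
qed auto

lemma finite_transversals: "finite (transversals w K q)"
  by (rule finite_subset[OF transversals_subset]) simp

lemma card_in_transversals: "e \<in> transversals w K q \<Longrightarrow> card e = q"
proof (induction w K q arbitrary: e rule: transversals.induct)
  case (3 w K q)
  show ?case
  proof (cases "e \<in> transversals w K (Suc q)")
    case False
    then obtain i e' where e: "e = insert i e'" "i \<in> {K * w..<Suc K * w}" "e' \<in> transversals w K q"
      using 3(3) by auto
    have "e' \<subseteq> {..<K * w}" using transversals_subset e(3) by blast
    then have "finite e'" "i \<notin> e'" using e(2) by (auto intro: finite_subset)
    then show ?thesis using 3(2)[OF e(3)] e(1) by simp
  qed (rule 3(1))
qed auto

lemma card_transversals: "card (transversals w K q) = (K choose q) * w ^ q"
proof (induction w K q rule: transversals.induct)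
  case (3 w K q)
  let ?ins = "\<lambda>(i, e). insert i e :: nat set" and ?B = "{K * w..<Suc K * w}"
  have sub: "e \<subseteq> {..<K * w}" if "e \<in> transversals w K q" for e q
    using transversals_subset that by blast
  have inj: "inj_on ?ins (?B \<times> transversals w K q)"
    by (rule inj_on_insert_Times[OF _ transversals_subset]) auto
  have disj: "transversals w K (Suc q) \<inter> ?ins ` (?B \<times> transversals w K q) = {}"
  proof -
    have "K * w \<le> i \<Longrightarrow> insert i e \<notin> transversals w K (Suc q)" for i e
      using sub[of "insert i e" "Suc q"] by auto
    then show ?thesis by auto
  qed
  have "card (transversals w (Suc K) (Suc q))
      = card (transversals w K (Suc q)) + card (?ins ` (?B \<times> transversals w K q))"
    unfolding transversals.simps
    by (rule card_Un_disjoint[OF finite_transversals _ disj]) (simp add: finite_transversals)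
  also have "card (?ins ` (?B \<times> transversals w K q)) = w * card (transversals w K q)"
    unfolding card_image[OF inj] card_cartesian_product by simp
  finally have "card (transversals w (Suc K) (Suc q)) = card (transversals w K (Suc q)) + w * card (transversals w K q)" .
  then show ?case unfolding 3 by (simp add: ring_distribs)
qed auto

lemma transversals_1: "transversals w K (Suc 0) = (\<lambda>i. {i}) ` {..<K * w}"
proof (induction K)
  case (Suc K)
  have "(\<lambda>(i, e). insert i e) ` ({K * w..<Suc K * w} \<times> transversals w K 0) = (\<lambda>i. {i}) ` {K * w..<Suc K * w}"
    by force
  then have "transversals w (Suc K) (Suc 0) = (\<lambda>i. {i}) ` ({..<K * w} \<union> {K * w..<Suc K * w})"
    by (simp only: transversals.simps Suc image_Un)
  also have "{..<K * w} \<union> {K * w..<Suc K * w} = {..<Suc K * w}" by auto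
  finally show ?case .
qed simp

lemma binomial_le_power: "n choose k \<le> n ^ k"
proof (cases "k \<le> n")
  case True then show ?thesis by (rule binomial_le_pow)
qed (simp add: binomial_eq_0)

text \<open>
  Induction on the degree, and for each degree on the number \<open>K\<close> of blocks, with \<open>few_biased_Un\<close> for
  \<open>l = w - s\<close>. Adding a block multiplies the bound by at most \<open>p ^ B\<close>, where every term of
  \<open>B = w + (\<kappa> w) ^ q + w s + w b + s (\<kappa> w) ^ q\<close> is at most of order \<open>s (\<kappa> w) ^ q\<close> if \<open>b\<close> is the exponent for
  degree \<open>q\<close>. After \<open>\<kappa>\<close> blocks the exponent in degree \<open>q + 1\<close> is of order \<open>s (\<kappa> w) ^ (q + 1) / w\<close>. The
  total number of coefficients is of order \<open>(\<kappa> w) ^ (q + 1)\<close>, so the biased polynomials are negligible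
  once \<open>s\<close>, which is logarithmic in the bias, is small compared with the block size \<open>w\<close>.
\<close>

lemma few_biased_transversals:
  fixes w \<kappa> s q :: nat and \<theta> :: real
  assumes \<kappa>: "1 \<le> \<kappa>" and s: "1 \<le> s" "s \<le> w" and \<theta>: "0 < \<theta>" "4 \<le> \<theta> * real CARD('p::prime_card) ^ s"
  shows "\<exists>b. w * b \<le> 4 * Suc q * s * (\<kappa> * w) ^ Suc q \<and>
     (\<forall>K\<le>\<kappa>. few_biased TYPE('p) {..<K * w} (transversals w K (Suc q)) (2 ^ Suc q * \<theta>) (real CARD('p) ^ b))"
proof (induction q)
  case 0
  let ?p = "real CARD('p)"
  have p1: "1 \<le> ?p" using prime_card_gt_1[where 'p='p] by simp
  have "1 / (2 * \<theta>)\<^sup>2 \<le> ?p ^ (2 * s)"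
  proof -
    have "1 \<le> (2 * \<theta> * ?p ^ s)\<^sup>2" using \<theta>(2) by (intro one_le_power) simp
    also have "\<dots> = (2 * \<theta>)\<^sup>2 * ?p ^ (2 * s)" by (simp add: power_mult_distrib power_mult[symmetric] mult.commute)
    finally show ?thesis using \<theta>(1) by (simp add: divide_le_eq mult.commute)
  qed
  moreover have "few_biased TYPE('p) {..<K * w} (transversals w K (Suc 0)) (2 * \<theta>) (1 / (2 * \<theta>)\<^sup>2)" for K
    unfolding transversals_1 by (rule few_biased_linear) (use \<theta>(1) in simp_all)
  ultimately have "few_biased TYPE('p) {..<K * w} (transversals w K (Suc 0)) (2 ^ Suc 0 * \<theta>) (?p ^ (2 * s))" for K
    unfolding power_Suc0_right by (rule few_biased_mono[rotated])
  moreover have "w * (2 * s) \<le> 4 * Suc 0 * s * (\<kappa> * w) ^ Suc 0"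
    using \<kappa> by (simp add: mult_le_mono algebra_simps)
  ultimately show ?case by blast
next
  case (Suc q)
  let ?p = "real CARD('p)" and ?\<eta> = "2 ^ Suc (Suc q) * \<theta>" and ?n = "\<kappa> * w"
  obtain b where b: "w * b \<le> 4 * Suc q * s * ?n ^ Suc q"
    and few: "\<And>K. K \<le> \<kappa> \<Longrightarrow> few_biased TYPE('p) {..<K * w} (transversals w K (Suc q)) (2 ^ Suc q * \<theta>) (?p ^ b)"
    using Suc by blast
  define B where "B = w + ?n ^ Suc q + w * s + w * b + s * ?n ^ Suc q"
  have p1: "1 \<le> ?p" using prime_card_gt_1[where 'p='p] by simp
  have \<eta>: "0 < ?\<eta>" using \<theta> by simp
  have \<eta>\<theta>: "\<theta> \<le> ?\<eta>" using \<theta> by (simp add: mult_le_cancel_right1 one_le_power del: power_Suc)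
  have few': "few_biased TYPE('p) {..<K * w} (transversals w K (Suc (Suc q))) ?\<eta> (?p ^ (K * B))" if "K \<le> \<kappa>" for K
    using that
  proof (induction K)
    case 0
    have "real (card {c \<in> vecs {}. P c}) \<le> 1" for P :: "(nat set \<Rightarrow> 'p mod_ring) \<Rightarrow> bool"
    proof -
      have "card {c \<in> vecs {}. P c} \<le> card (vecs {} :: (nat set \<Rightarrow> 'p mod_ring) set)"
        by (rule card_mono) auto
      then show ?thesis by (simp add: card_vecs)
    qed
    then show ?case by (simp add: few_biased_def)
  next
    case (Suc K)
    let ?W = "{K * w..<Suc K * w}" and ?V = "{..<K * w}" and ?E = "transversals w K (Suc q)" and ?l = "w - s"
    have cW: "card ?W = w" by simp
    have cE: "card ?E \<le> ?n ^ Suc q"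
    proof -
      have "card ?E \<le> K ^ Suc q * w ^ Suc q"
        unfolding card_transversals by (rule mult_right_mono[OF binomial_le_power]) simp
      also have "\<dots> = (K * w) ^ Suc q" by (rule power_mult_distrib[symmetric])
      also have "\<dots> \<le> ?n ^ Suc q" using Suc.prems by (intro power_mono mult_right_mono) simp_all
      finally show ?thesis .
    qed
    have pw: "4 * ?p ^ ?l \<le> ?\<eta> * ?p ^ w"
    proof -
      have "4 * ?p ^ ?l \<le> (\<theta> * ?p ^ s) * ?p ^ ?l" by (rule mult_right_mono[OF \<theta>(2)]) simp
      also have "\<dots> = \<theta> * ?p ^ w" using s by (simp flip: power_add)
      also have "\<dots> \<le> ?\<eta> * ?p ^ w" by (rule mult_right_mono[OF \<eta>\<theta>]) simp
      finally show ?thesis .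
    qed
    have fb: "few_biased TYPE('p) (?W \<union> ?V)
       (transversals w K (Suc (Suc q)) \<union> (\<lambda>(i, e). insert i e) ` (?W \<times> ?E)) ?\<eta>
       (?p ^ card ?W * ?p ^ card ?E * ?p ^ (K * B) *
         ((4 / ?\<eta>) ^ ?l * (?p ^ b) ^ ?l * ?p ^ (card ?E * (card ?W - ?l))))"
    proof (rule few_biased_Un)
      show "few_biased TYPE('p) ?V ?E (?\<eta> / 2) (?p ^ b)"
      proof -
        have "?\<eta> / 2 = 2 ^ Suc q * \<theta>" by simp
        then show ?thesis using few[of K] Suc.prems by (simp only: Suc_leD)
      qed
      show "few_biased TYPE('p) ?V (transversals w K (Suc (Suc q))) ?\<eta> (?p ^ (K * B))"
        using Suc by simp
      show "4 * ?p ^ ?l \<le> ?\<eta> * ?p ^ card ?W" using pw cW by simp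
      show "?l \<le> card ?W" using cW by simp
    qed (use \<eta> transversals_subset in \<open>auto simp del: power_Suc\<close>)
    have WV: "?W \<union> ?V = {..<Suc K * w}" by auto
    have le: "?p ^ card ?W * ?p ^ card ?E * ?p ^ (K * B) *
         ((4 / ?\<eta>) ^ ?l * (?p ^ b) ^ ?l * ?p ^ (card ?E * (card ?W - ?l))) \<le> ?p ^ (Suc K * B)"
    proof -
      have "4 / ?\<eta> \<le> ?p ^ s"
      proof -
        have "4 \<le> ?\<eta> * ?p ^ s" using \<theta>(2) mult_right_mono[OF \<eta>\<theta>, of "?p ^ s"] by simp
        then show ?thesis using \<eta> by (simp add: divide_le_eq mult.commute del: power_Suc)
      qed
      then have "(4 / ?\<eta>) ^ ?l \<le> (?p ^ s) ^ ?l"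
        using \<eta> by (intro power_mono) (simp_all del: power_Suc)
      then have "?p ^ card ?W * ?p ^ card ?E * ?p ^ (K * B) *
         ((4 / ?\<eta>) ^ ?l * (?p ^ b) ^ ?l * ?p ^ (card ?E * (card ?W - ?l)))
        \<le> ?p ^ card ?W * ?p ^ card ?E * ?p ^ (K * B) *
         ((?p ^ s) ^ ?l * (?p ^ b) ^ ?l * ?p ^ (card ?E * (card ?W - ?l)))"
        by (intro mult_left_mono mult_right_mono) simp_all
      also have "\<dots> = ?p ^ (w + card ?E + K * B + s * ?l + b * ?l + card ?E * s)"
        unfolding cW using s(2) by (simp add: power_add power_mult)
      also have "\<dots> \<le> ?p ^ (Suc K * B)"
      proof (rule power_increasing[OF _ p1])
        have "s * ?l \<le> w * s" "b * ?l \<le> w * b" by (simp_all add: mult.commute)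
        moreover have "card ?E * s \<le> s * ?n ^ Suc q" using cE by (simp add: mult.commute del: power_Suc)
        ultimately have "w + card ?E + s * ?l + b * ?l + card ?E * s \<le> B"
          unfolding B_def using cE by linarith
        then show "w + card ?E + K * B + s * ?l + b * ?l + card ?E * s \<le> Suc K * B"
          unfolding mult_Suc by linarith
      qed
      finally show ?thesis .
    qed
    show ?case
      unfolding transversals.simps(3) WV[symmetric] by (rule few_biased_mono[OF fb le])
  qed
  have B: "B \<le> 4 * Suc (Suc q) * s * ?n ^ Suc q"
  proof -
    have w: "w \<le> ?n ^ Suc q"
    proof -
      have "w \<le> ?n" using \<kappa> by simp
      also have "?n \<le> ?n ^ Suc q" using \<kappa> s by (intro self_le_power) simp_all
      finally show ?thesis .
    qed
    define X where "X = s * ?n ^ Suc q"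
    have n: "?n ^ Suc q \<le> X" unfolding X_def using s by simp
    have ws: "w * s \<le> X" unfolding X_def using w by (simp add: mult.commute del: power_Suc)
    have b': "w * b \<le> 4 * (Suc q * X)" using b by (simp only: X_def mult.assoc)
    have "4 * Suc (Suc q) * s * ?n ^ Suc q = 4 * (Suc q * X) + 4 * X"
      by (simp add: X_def algebra_simps del: power_Suc)
    moreover have "B = w + ?n ^ Suc q + w * s + w * b + X" by (simp only: B_def X_def)
    ultimately show ?thesis using w n ws b' by linarith
  qed
  have "w * (\<kappa> * B) = ?n * B" by (simp add: mult_ac)
  also have "\<dots> \<le> ?n * (4 * Suc (Suc q) * s * ?n ^ Suc q)" by (rule mult_left_mono[OF B]) simp
  also have "\<dots> = 4 * Suc (Suc q) * s * ?n ^ Suc (Suc q)" by (simp only: power_Suc mult_ac)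
  finally have "w * (\<kappa> * B) \<le> 4 * Suc (Suc q) * s * ?n ^ Suc (Suc q)" .
  moreover have "few_biased TYPE('p) {..<K * w} (transversals w K (Suc (Suc q))) ?\<eta> (?p ^ (\<kappa> * B))"
    if K: "K \<le> \<kappa>" for K
    by (rule few_biased_mono[OF few'[OF K]], rule power_increasing[OF _ p1]) (use K in simp)
  ultimately show ?case by blast
qed

definition vec_prod :: "nat set \<Rightarrow> 'p::prime_card mod_ring Matrix.vec \<Rightarrow> 'p mod_ring" where
  "vec_prod e x = (\<Prod>i\<in>e. x $ i)"

lemma sum_carrier_vec:
  fixes f :: "'p::prime_card mod_ring Matrix.vec \<Rightarrow> 'b::comm_monoid_add"
  shows "(\<Sum>x\<in>carrier_vec n. f x) = (\<Sum>x\<in>vecs {..<n}. f (Matrix.vec n x))"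
proof (rule sum.reindex_bij_witness[of _ "Matrix.vec n" "\<lambda>x. \<lambda>i\<in>{..<n}. x $ i"])
  fix x :: "'p mod_ring Matrix.vec" assume x: "x \<in> carrier_vec n"
  show e: "Matrix.vec n (\<lambda>i\<in>{..<n}. x $ i) = x" using x by (intro eq_vecI) auto
  show "f (Matrix.vec n (\<lambda>i\<in>{..<n}. x $ i)) = f x" by (simp only: e)
  show "(\<lambda>i\<in>{..<n}. x $ i) \<in> vecs {..<n}" by simp
next
  fix x :: "nat \<Rightarrow> 'p mod_ring" assume x: "x \<in> vecs {..<n}"
  show "(\<lambda>i\<in>{..<n}. Matrix.vec n x $ i) = x" using PiE_arb[OF x] by (intro ext) simp
  show "Matrix.vec n x \<in> carrier_vec n" by simp
qed

lemma finite_carrier_vec: "finite (carrier_vec n :: 'p::prime_card mod_ring Matrix.vec set)"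
proof (rule finite_subset)
  show "carrier_vec n \<subseteq> Matrix.vec n ` (vecs {..<n} :: (nat \<Rightarrow> 'p mod_ring) set)"
  proof
    fix x :: "'p mod_ring Matrix.vec" assume x: "x \<in> carrier_vec n"
    have "Matrix.vec n (\<lambda>i\<in>{..<n}. x $ i) = x" using x by (intro eq_vecI) auto
    moreover have "(\<lambda>i\<in>{..<n}. x $ i) \<in> vecs {..<n}" by simp
    ultimately show "x \<in> Matrix.vec n ` vecs {..<n}" by (metis image_eqI)
  qed
qed (simp add: finite_vecs)

lemma card_carrier_vec: "card (carrier_vec n :: 'p::prime_card mod_ring Matrix.vec set) = CARD('p) ^ n"
proof -
  have "card (carrier_vec n :: 'p mod_ring Matrix.vec set) = (\<Sum>x\<in>(carrier_vec n :: 'p mod_ring Matrix.vec set). 1)" by simp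
  also have "\<dots> = card (vecs {..<n} :: (nat \<Rightarrow> 'p mod_ring) set)" by (subst sum_carrier_vec) simp
  finally show ?thesis by (simp add: card_vecs)
qed

text \<open>
  Variables that occur in no monomial only multiply the exponential sum by the number of their values.
\<close>

lemma card_biased_carrier_vec:
  assumes few: "few_biased TYPE('p::prime_card) {..<m} E \<eta> N" and m: "m \<le> n" and E: "E \<subseteq> Pow {..<m}"
  shows "real (card {c \<in> vecs E. cmod (\<Sum>x\<in>carrier_vec n. chi (pev vec_prod E c (x :: 'p mod_ring Matrix.vec)))
     \<ge> \<eta> * real CARD('p) ^ n}) \<le> N"
proof -
  let ?p = "real CARD('p)"
  have eq: "(\<Sum>x\<in>carrier_vec n. chi (pev vec_prod E c (x :: 'p mod_ring Matrix.vec)))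
      = of_real (?p ^ (n - m)) * (\<Sum>z\<in>vecs {..<m}. chi (pev var_prod E c z))" for c :: "nat set \<Rightarrow> 'p mod_ring"
  proof -
    have mono: "vec_prod e (Matrix.vec n (glue {m..<n} y z)) = var_prod e z" if "e \<in> E" for e and y z :: "nat \<Rightarrow> 'p mod_ring"
      unfolding vec_prod_def var_prod_def
    proof (rule prod.cong[OF refl])
      fix i assume "i \<in> e"
      then have "i < m" using that E by blast
      then show "Matrix.vec n (glue {m..<n} y z) $ i = z i" using m by (simp add: glue_def)
    qed
    have u: "{..<n} = {m..<n} \<union> {..<m}" using m by auto
    have "(\<Sum>x\<in>carrier_vec n. chi (pev vec_prod E c (x :: 'p mod_ring Matrix.vec)))
       = (\<Sum>y\<in>vecs {m..<n}. \<Sum>z\<in>vecs {..<m}. chi (pev vec_prod E c (Matrix.vec n (glue {m..<n} y z))))"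
      unfolding sum_carrier_vec u by (rule sum_vecs_Un) auto
    also have "\<dots> = (\<Sum>y\<in>(vecs {m..<n} :: (nat \<Rightarrow> 'p mod_ring) set). \<Sum>z\<in>vecs {..<m}. chi (pev var_prod E c z))"
      by (simp add: pev_def mono)
    also have "\<dots> = of_real (?p ^ (n - m)) * (\<Sum>z\<in>vecs {..<m}. chi (pev var_prod E c z))"
      by (simp add: card_vecs)
    finally show ?thesis .
  qed
  have iff: "cmod (\<Sum>x\<in>carrier_vec n. chi (pev vec_prod E c (x :: 'p mod_ring Matrix.vec))) \<ge> \<eta> * ?p ^ n
      \<longleftrightarrow> cmod (\<Sum>z\<in>vecs {..<m}. 1 * chi (pev var_prod E c z)) \<ge> \<eta> * ?p ^ card {..<m}" for c :: "nat set \<Rightarrow> 'p mod_ring"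
  proof -
    have "?p ^ n = ?p ^ (n - m) * ?p ^ m" using m by (simp flip: power_add)
    moreover have "0 < ?p ^ (n - m)" by simp
    ultimately show ?thesis unfolding eq norm_mult norm_of_real
      by (simp only: mult_1_left card_lessThan mult.left_commute[of \<eta>] abs_of_pos mult_le_cancel_left_pos)
  qed
  show ?thesis unfolding iff by (rule few_biasedD[OF few]) simp
qed

section \<open>Binomial quotients and a concavity estimate\<close>

lemma Suc_times_choose: "Suc k * (n choose Suc k) = (n - k) * (n choose k)"
  by (simp only: binomial_absorption binomial_absorb_comp)

text \<open>
  The quotient of the two binomial coefficients is the probability that a random \<open>m\<close>-subset of \<open>N\<close> points
  misses \<open>z\<close> given ones. Drawing without replacement makes this less likely than with replacement.
\<close>

lemma binomial_diff_le:
  assumes "z \<le> N" "0 < N"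
  shows "real ((N - z) choose m) \<le> real (N choose m) * (1 - real z / real N) ^ m"
proof (induction m)
  case (Suc m)
  let ?q = "1 - real z / real N"
  have q: "0 \<le> ?q" using assms by simp
  have st: "real (N - z - m) \<le> ?q * real (N - m)"
  proof (cases "m \<le> N - z")
    case True
    have "real z * real m / real N \<ge> 0" by simp
    moreover have "?q * real (N - m) = real N - real m - real z + real z * real m / real N"
      using True assms by (simp add: of_nat_diff field_simps)
    ultimately show ?thesis using True assms by (simp add: of_nat_diff)
  qed (use q in simp)
  have "real (Suc m) * real ((N - z) choose Suc m) = real (N - z - m) * real ((N - z) choose m)"
    by (simp only: of_nat_mult[symmetric] Suc_times_choose)
  also have "\<dots> \<le> (?q * real (N - m)) * (real (N choose m) * ?q ^ m)"
    by (rule mult_mono[OF st Suc]) (use q in simp_all)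
  also have "\<dots> = (real (N - m) * real (N choose m)) * ?q ^ Suc m" by (simp only: power_Suc mult_ac)
  also have "real (N - m) * real (N choose m) = real (Suc m) * real (N choose Suc m)"
    by (simp only: of_nat_mult[symmetric] Suc_times_choose)
  finally have "real (Suc m) * real ((N - z) choose Suc m) \<le> real (Suc m) * (real (N choose Suc m) * ?q ^ Suc m)"
    by (simp only: mult.assoc)
  then show ?case by (rule mult_left_le_imp_le) simp
qed simp

text \<open>
  Conversely, at each of the first \<open>m\<close> draws at least \<open>N - m\<close> points are left.
\<close>

lemma binomial_diff_ge:
  assumes "k \<le> m" "m < N" "z \<le> N - m"
  shows "real (N choose k) * (1 - real z / real (N - m)) ^ k \<le> real ((N - z) choose k)"
  using assms(1)
proof (induction k)
  case (Suc k)
  let ?q = "1 - real z / real (N - m)"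
  have q: "0 \<le> ?q" using assms by simp
  have st: "?q * real (N - k) \<le> real (N - z - k)"
  proof -
    have "real z * 1 \<le> real z * (real (N - k) / real (N - m))"
      using Suc.prems assms by (intro mult_left_mono) (simp_all add: le_divide_eq)
    then show ?thesis using Suc.prems assms by (simp add: of_nat_diff left_diff_distrib)
  qed
  have "real (Suc k) * (real (N choose Suc k) * ?q ^ Suc k) = (real (N - k) * real (N choose k)) * ?q ^ Suc k"
    by (simp only: mult.assoc[symmetric] of_nat_mult[symmetric] Suc_times_choose)
  also have "\<dots> = (?q * real (N - k)) * (real (N choose k) * ?q ^ k)" by (simp only: power_Suc mult_ac)
  also have "\<dots> \<le> real (N - z - k) * real ((N - z) choose k)"
    by (rule mult_mono[OF st Suc.IH]) (use q Suc.prems in simp_all)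
  also have "\<dots> = real (Suc k) * real ((N - z) choose Suc k)"
    by (simp only: of_nat_mult[symmetric] Suc_times_choose)
  finally show ?case by (rule mult_left_le_imp_le) simp
qed simp

text \<open>
  The quantity inside the logarithm is \<open>1 - b + b * p ^ r\<close> with \<open>b = u\<^sup>2 / (1 - u)\<^sup>2 \<le> 1\<close>, the mean of
  \<open>X powr (r / t)\<close> for a variable \<open>X\<close> with values \<open>p ^ t\<close> and \<open>1\<close>. By concavity it is at most
  the mean of \<open>X\<close> to the power \<open>r / t\<close>, and this mean is exactly \<open>1 / (1 - u)\<close>. So a pair of tuples
  with an \<open>r\<close>-dimensional dependence gains at most the \<open>r / t\<close>-th part, on the logarithmic scale, of what
  two equal tuples gain.
\<close>

lemma overlap_growth_le:
  fixes p :: real and r t :: nat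
  defines "u \<equiv> 1 / p ^ t"
  assumes p: "2 \<le> p" and r: "r \<le> t" and t: "1 \<le> t"
  shows "0 < 1 + u\<^sup>2 * (p ^ r - 1) / (1 - u)\<^sup>2"
    and "ln (1 + u\<^sup>2 * (p ^ r - 1) / (1 - u)\<^sup>2) \<le> real r / real t * ln (1 / (1 - u))"
proof -
  define b where "b = u\<^sup>2 / (1 - u)\<^sup>2"
  define A where "A = 1 / (1 - u)"
  define \<theta> where "\<theta> = real r / real t"
  have pt: "2 \<le> p ^ t" using power_increasing[of 1 t p] p t by simp
  have u: "0 < u" "u \<le> 1 / 2" using pt p by (simp_all add: u_def field_simps)
  have A: "0 < A" using u by (simp add: A_def)
  have b0: "0 \<le> b" by (simp add: b_def)
  have b1: "b \<le> 1"
  proof -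
    have "u\<^sup>2 \<le> (1 - u)\<^sup>2" using u by (intro power_mono) simp_all
    then show ?thesis using u by (simp add: b_def divide_le_eq)
  qed
  have bA: "b * p ^ t + (1 - b) = A"
  proof -
    have "p ^ t = 1 / u" using p by (simp add: u_def)
    then have "b * p ^ t = u / (1 - u)\<^sup>2" using u by (simp add: b_def power2_eq_square)
    moreover have "1 - b = ((1 - u)\<^sup>2 - u\<^sup>2) / (1 - u)\<^sup>2" using u by (simp add: b_def diff_divide_distrib)
    ultimately have "b * p ^ t + (1 - b) = (u + ((1 - u)\<^sup>2 - u\<^sup>2)) / (1 - u)\<^sup>2"
      by (simp only: add_divide_distrib)
    also have "u + ((1 - u)\<^sup>2 - u\<^sup>2) = 1 - u" by (simp add: power2_eq_square algebra_simps)
    finally show ?thesis using u by (simp add: A_def power2_eq_square)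
  qed
  have \<theta>: "0 \<le> \<theta>" "\<theta> \<le> 1" using r t by (simp_all add: \<theta>_def)
  have pr: "1 \<le> p ^ r" using p by (intro one_le_power) simp
  have eq: "1 + u\<^sup>2 * (p ^ r - 1) / (1 - u)\<^sup>2 = b * p ^ r + (1 - b)"
    unfolding b_def by (simp add: left_diff_distrib right_diff_distrib diff_divide_distrib mult.commute)
  have "1 \<le> 1 + u\<^sup>2 * (p ^ r - 1) / (1 - u)\<^sup>2" using pr by simp
  then show pos: "0 < 1 + u\<^sup>2 * (p ^ r - 1) / (1 - u)\<^sup>2" by linarith
  have Y: "z powr \<theta> \<le> \<theta> * z + (1 - \<theta>)" if "0 < z" for z :: real
    using Youngs_inequality_0[of \<theta> "1 - \<theta>" z 1] \<theta> that by simp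
  have ptr: "(p ^ t) powr \<theta> = p ^ r"
  proof -
    have "(p ^ t) powr \<theta> = p powr (real t * \<theta>)" using p by (simp add: powr_powr flip: powr_realpow)
    also have "real t * \<theta> = real r" using t by (simp add: \<theta>_def)
    finally show ?thesis using p by (simp add: powr_realpow)
  qed
  have "(b * p ^ r + (1 - b)) / A powr \<theta> = b * (p ^ t / A) powr \<theta> + (1 - b) * (1 / A) powr \<theta>"
    using A p by (simp add: powr_divide ptr add_divide_distrib)
  also have "\<dots> \<le> b * (\<theta> * (p ^ t / A) + (1 - \<theta>)) + (1 - b) * (\<theta> * (1 / A) + (1 - \<theta>))"
    by (intro add_mono mult_left_mono Y) (use A p b0 b1 in simp_all)
  also have "\<dots> = \<theta> * ((b * p ^ t + (1 - b)) / A) + (1 - \<theta>)"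
    by (simp add: algebra_simps add_divide_distrib diff_divide_distrib)
  also have "\<dots> = 1" unfolding bA using A by simp
  finally have "1 + u\<^sup>2 * (p ^ r - 1) / (1 - u)\<^sup>2 \<le> A powr \<theta>"
    unfolding eq using A by (simp add: divide_le_eq)
  then have "ln (1 + u\<^sup>2 * (p ^ r - 1) / (1 - u)\<^sup>2) \<le> ln (A powr \<theta>)"
    using pos A by (subst ln_le_cancel_iff) simp_all
  then show "ln (1 + u\<^sup>2 * (p ^ r - 1) / (1 - u)\<^sup>2) \<le> real r / real t * ln (1 / (1 - u))"
    using A by (simp add: ln_powr \<theta>_def A_def)
qed

section \<open>Systems of polynomials and their common zeros\<close>

text \<open>
  Tuples of \<open>t\<close> polynomials with monomials \<open>f e\<close> on a finite set \<open>X\<close> of points. The monomials enter the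
  second moment argument through the number of biased polynomials only.
\<close>

locale poly_system =
  fixes X :: "'x set" and E :: "'e set" and f :: "'e \<Rightarrow> 'x \<Rightarrow> 'p::prime_card mod_ring"
    and t :: nat and \<eta> :: real
  assumes finX: "finite X" and X_ne: "X \<noteq> {}" and finE: "finite E" and t: "1 \<le> t"
    and \<eta>: "0 < \<eta>" "\<eta> \<le> 1 / 10" and p3: "3 \<le> CARD('p)"
begin

definition biased :: "('e \<Rightarrow> 'p mod_ring) set" where
  "biased = {c \<in> vecs E. cmod (\<Sum>x\<in>X. chi (pev f E c x)) \<ge> \<eta> * real (card X)}"

text \<open>
  If two joint combinations of a pair of tuples are biased and agree on the second tuple, their
  difference is a combination of the first tuple alone and lies in this set.
\<close>

definition differences :: "('e \<Rightarrow> 'p mod_ring) set" where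
  "differences = (\<lambda>(b, b'). \<lambda>e\<in>E. b e - b' e) ` (biased \<times> biased)"

abbreviation lin :: "(nat \<Rightarrow> 'p mod_ring) \<Rightarrow> (nat \<times> 'e \<Rightarrow> 'p mod_ring) \<Rightarrow> 'e \<Rightarrow> 'p mod_ring" where
  "lin \<equiv> comb {..<t} E"

abbreviation coeffs :: "(nat \<Rightarrow> 'p mod_ring) set" where
  "coeffs \<equiv> vecs {..<t}"

definition zeros :: "(nat \<times> 'e \<Rightarrow> 'p mod_ring) \<Rightarrow> 'x set" where
  "zeros Q = {x \<in> X. \<forall>i<t. pev f E (\<lambda>e. Q (i, e)) x = 0}"

text \<open>
  All nontrivial combinations of a good tuple lie outside \<open>differences\<close>. In particular they are unbiased,
  so the common zeros have the expected number; and a good tuple cannot have two biased combinations with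
  the same combination of another tuple.
\<close>

definition good :: "(nat \<times> 'e \<Rightarrow> 'p mod_ring) set" where
  "good = {Q \<in> vecs ({..<t} \<times> E). \<forall>\<mu>\<in>coeffs. lin \<mu> Q \<in> differences \<longrightarrow> (\<forall>i<t. \<mu> i = 0)}"

lemma card_X_pos: "0 < real (card X)"
  using finX X_ne by (simp add: card_gt_0_iff)

lemma finite_coeffs: "finite coeffs" by (rule finite_vecs) simp

lemma card_coeffs: "card coeffs = CARD('p) ^ t" by (simp add: card_vecs)

lemma finite_tuples: "finite (vecs ({..<t} \<times> E) :: (nat \<times> 'e \<Rightarrow> 'p mod_ring) set)"
  by (rule finite_vecs) (simp add: finE)

lemma card_tuples: "card (vecs ({..<t} \<times> E) :: (nat \<times> 'e \<Rightarrow> 'p mod_ring) set) = CARD('p) ^ (t * card E)"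
  using finE by (subst card_vecs) simp_all

lemma finite_good: "finite good"
  unfolding good_def by (rule finite_subset[OF _ finite_tuples]) auto

lemma field_power_ge: "3 \<le> real CARD('p) ^ t"
proof -
  have "3 \<le> real CARD('p) ^ 1" using p3 by simp
  also have "\<dots> \<le> real CARD('p) ^ t" using t p3 by (intro power_increasing) simp_all
  finally show ?thesis .
qed

lemma inverse_field_power_bounds: "0 < (1 / real CARD('p) ^ t)" "(1 / real CARD('p) ^ t) \<le> 1 / 3"
  using field_power_ge by (simp_all add: divide_le_eq)

lemma biased_subset: "biased \<subseteq> vecs E" by (auto simp: biased_def)

lemma finite_biased: "finite biased"
  by (rule finite_subset[OF biased_subset finite_vecs[OF finE]])

lemma zero_biased: "(\<lambda>e\<in>E. 0) \<in> biased"
proof -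
  have "pev f E (\<lambda>e\<in>E. 0) x = 0" for x by (simp add: pev_def)
  then show ?thesis using \<eta> card_X_pos by (simp add: biased_def mult_le_cancel_right1)
qed

text \<open>
  The zero polynomial is biased.
\<close>

lemma biased_differences: "b \<in> biased \<Longrightarrow> b \<in> differences"
proof -
  assume b: "b \<in> biased"
  have "b = (\<lambda>e\<in>E. b e - (\<lambda>e\<in>E. 0) e)"
    using biased_subset b by (intro PiE_ext[of b E "\<lambda>_. UNIV"]) auto
  moreover have "(b, \<lambda>e\<in>E. 0) \<in> biased \<times> biased" using b zero_biased by simp
  ultimately show ?thesis unfolding differences_def
    by (intro image_eqI[of _ _ "(b, \<lambda>e\<in>E. 0)"]) simp_all
qed

lemma card_differences: "card differences \<le> card biased ^ 2"
proof -
  have "card differences \<le> card (biased \<times> biased)"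
    unfolding differences_def by (rule card_image_le) (simp add: finite_biased)
  then show ?thesis by (simp add: card_cartesian_product power2_eq_square)
qed

lemma pev_lin: "pev f E (lin \<mu> Q) x = (\<Sum>i<t. \<mu> i * pev f E (\<lambda>e. Q (i, e)) x)"
proof -
  have "pev f E (lin \<mu> Q) x = (\<Sum>e\<in>E. \<Sum>i<t. \<mu> i * (Q (i, e) * f e x))"
    unfolding pev_def by (rule sum.cong[OF refl]) (simp add: comb_def sum_distrib_right mult.assoc)
  also have "\<dots> = (\<Sum>i<t. \<Sum>e\<in>E. \<mu> i * (Q (i, e) * f e x))" by (rule sum.swap)
  finally show ?thesis unfolding pev_def by (simp only: sum_distrib_left)
qed

lemma sum_coeffs_chi:
  "(\<Sum>\<mu>\<in>coeffs. chi (pev f E (lin \<mu> Q) x)) = (if \<forall>i<t. pev f E (\<lambda>e. Q (i, e)) x = 0 then of_nat (CARD('p) ^ t) else 0)"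
  unfolding pev_lin by (subst sum_vecs_chi) auto

lemma card_zeros_fourier:
  "of_nat (card (zeros Q)) * of_nat (CARD('p) ^ t) = (\<Sum>\<mu>\<in>coeffs. \<Sum>x\<in>X. chi (pev f E (lin \<mu> Q) x))"
proof -
  have "(\<Sum>\<mu>\<in>coeffs. \<Sum>x\<in>X. chi (pev f E (lin \<mu> Q) x))
    = (\<Sum>x\<in>X. if \<forall>i<t. pev f E (\<lambda>e. Q (i, e)) x = 0 then of_nat (CARD('p) ^ t) else 0)"
    by (subst sum.swap) (simp only: sum_coeffs_chi)
  also have "\<dots> = (\<Sum>x\<in>zeros Q. of_nat (CARD('p) ^ t))"
    unfolding zeros_def by (rule sum.inter_filter[OF finX, symmetric])
  finally show ?thesis by simp
qed

lemma card_zeros_Int_fourier: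
  "of_nat (card (zeros Q \<inter> zeros Q')) * of_nat (CARD('p) ^ t) * of_nat (CARD('p) ^ t)
    = (\<Sum>(\<nu>, \<mu>)\<in>coeffs \<times> coeffs. \<Sum>x\<in>X. chi (pev f E (\<lambda>e\<in>E. lin \<nu> Q e + lin \<mu> Q' e) x))"
proof -
  have add: "chi (pev f E (\<lambda>e\<in>E. lin \<nu> Q e + lin \<mu> Q' e) x) = chi (pev f E (lin \<nu> Q) x) * chi (pev f E (lin \<mu> Q') x)"
    for \<nu> \<mu> x
  proof -
    have "pev f E (\<lambda>e\<in>E. lin \<nu> Q e + lin \<mu> Q' e) x = pev f E (lin \<nu> Q) x + pev f E (lin \<mu> Q') x"
      unfolding pev_def sum.distrib[symmetric] by (rule sum.cong[OF refl]) (simp only: restrict_apply' ring_distribs)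
    then show ?thesis by (simp only: chi_add)
  qed
  have "(\<Sum>(\<nu>, \<mu>)\<in>coeffs \<times> coeffs. \<Sum>x\<in>X. chi (pev f E (\<lambda>e\<in>E. lin \<nu> Q e + lin \<mu> Q' e) x))
    = (\<Sum>x\<in>X. \<Sum>(\<nu>, \<mu>)\<in>coeffs \<times> coeffs. chi (pev f E (lin \<nu> Q) x) * chi (pev f E (lin \<mu> Q') x))"
    unfolding add case_prod_unfold by (rule sum.swap)
  also have "\<dots> = (\<Sum>x\<in>X. (\<Sum>\<nu>\<in>coeffs. chi (pev f E (lin \<nu> Q) x)) * (\<Sum>\<mu>\<in>coeffs. chi (pev f E (lin \<mu> Q') x)))"
    by (simp only: sum_product sum.cartesian_product)
  also have "\<dots> = (\<Sum>x\<in>X. if x \<in> zeros Q \<inter> zeros Q' then of_nat (CARD('p) ^ t) * of_nat (CARD('p) ^ t) else 0)"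
    unfolding sum_coeffs_chi by (rule sum.cong[OF refl]) (simp add: zeros_def)
  also have "\<dots> = (\<Sum>x\<in>{x \<in> X. x \<in> zeros Q \<inter> zeros Q'}. of_nat (CARD('p) ^ t) * of_nat (CARD('p) ^ t))"
    by (rule sum.inter_filter[OF finX, symmetric])
  also have "{x \<in> X. x \<in> zeros Q \<inter> zeros Q'} = zeros Q \<inter> zeros Q'" by (auto simp: zeros_def)
  finally show ?thesis by (simp only: sum_constant mult.assoc)
qed

lemma bias_le: "cmod (\<Sum>x\<in>X. chi (pev f E c x)) \<le> real (card X)"
  using sum_norm_le[of X "\<lambda>x. chi (pev f E c x)" "\<lambda>_. 1"] by simp

lemma bias_le_of_not_biased: "c \<in> vecs E \<Longrightarrow> c \<notin> biased \<Longrightarrow> cmod (\<Sum>x\<in>X. chi (pev f E c x)) \<le> \<eta> * real (card X)"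
  by (auto simp: biased_def)

text \<open>
  In the Fourier expansion \<open>card_zeros_fourier\<close> the trivial combination gives the main term, and all others
  are unbiased because \<open>Q\<close> is good.
\<close>

lemma card_zeros:
  assumes Q: "Q \<in> good"
  shows "\<bar>real (card (zeros Q)) - (1 / real CARD('p) ^ t) * real (card X)\<bar> \<le> \<eta> * real (card X)"
proof -
  let ?S = "\<lambda>\<mu>. \<Sum>x\<in>X. chi (pev f E (lin \<mu> Q) x)"
  define z :: "nat \<Rightarrow> 'p mod_ring" where "z = (\<lambda>i\<in>{..<t}. 0)"
  have z: "z \<in> coeffs" by (simp add: z_def)
  have Sz: "?S z = of_nat (card X)" unfolding pev_lin z_def by simp
  have small: "cmod (?S \<mu>) \<le> \<eta> * real (card X)" if \<mu>: "\<mu> \<in> coeffs - {z}" for \<mu>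
  proof (rule bias_le_of_not_biased)
    show "lin \<mu> Q \<notin> biased"
    proof
      assume "lin \<mu> Q \<in> biased"
      then have "\<forall>i<t. \<mu> i = 0" using Q \<mu> biased_differences by (simp add: good_def)
      then have "\<mu> = z" using \<mu> z by (intro PiE_ext[of \<mu> "{..<t}" "\<lambda>_. UNIV" z]) (simp_all add: z_def)
      then show False using \<mu> by simp
    qed
  qed simp
  have "complex_of_real (real (card (zeros Q)) * real CARD('p) ^ t - real (card X)) = (\<Sum>\<mu>\<in>coeffs - {z}. ?S \<mu>)"
  proof -
    have "of_nat (card (zeros Q)) * of_nat (CARD('p) ^ t) = ?S z + (\<Sum>\<mu>\<in>coeffs - {z}. ?S \<mu>)"
      unfolding card_zeros_fourier by (rule sum.remove[OF finite_coeffs z])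
    then show ?thesis unfolding Sz by (simp add: algebra_simps)
  qed
  then have "\<bar>real (card (zeros Q)) * real CARD('p) ^ t - real (card X)\<bar> = cmod (\<Sum>\<mu>\<in>coeffs - {z}. ?S \<mu>)"
    by (metis norm_of_real)
  also have "\<dots> \<le> (\<Sum>\<mu>\<in>coeffs - {z}. \<eta> * real (card X))" by (rule sum_norm_le) (rule small)
  also have "\<dots> \<le> (\<Sum>\<mu>\<in>coeffs. \<eta> * real (card X))"
    by (rule sum_mono2[OF finite_coeffs]) (use \<eta> in auto)
  also have "\<dots> = real CARD('p) ^ t * (\<eta> * real (card X))" by (simp add: card_coeffs)
  finally have "\<bar>real (card (zeros Q)) * real CARD('p) ^ t - real (card X)\<bar> / real CARD('p) ^ t \<le> \<eta> * real (card X)"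
    using field_power_ge by (simp add: divide_le_eq mult.commute)
  moreover have "\<bar>real (card (zeros Q)) * real CARD('p) ^ t - real (card X)\<bar> / real CARD('p) ^ t = \<bar>real (card (zeros Q)) - (1 / real CARD('p) ^ t) * real (card X)\<bar>"
  proof -
    have "real (card (zeros Q)) - (1 / real CARD('p) ^ t) * real (card X) = (real (card (zeros Q)) * real CARD('p) ^ t - real (card X)) / real CARD('p) ^ t"
      using field_power_ge by (simp add: field_simps)
    then show ?thesis by (simp add: abs_divide)
  qed
  ultimately show ?thesis by simp
qed

lemma card_not_good:
  "card (vecs ({..<t} \<times> E) - good) \<le> CARD('p) ^ t * (card biased ^ 2 * CARD('p) ^ (card E * (t - 1)))"
proof -
  define nz where "nz = {\<mu> \<in> coeffs. \<exists>i<t. \<mu> i \<noteq> 0}"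
  let ?F = "\<lambda>\<mu>. {Q \<in> vecs ({..<t} \<times> E). \<forall>j<1. lin ((\<lambda>_. \<mu>) j) Q \<in> (\<lambda>_::nat. differences) j}"
  have fin: "finite nz" unfolding nz_def by (rule finite_subset[OF _ finite_coeffs]) auto
  have one: "card (?F \<mu>) \<le> card biased ^ 2 * CARD('p) ^ (card E * (t - 1))" if \<mu>: "\<mu> \<in> nz" for \<mu>
  proof -
    have "indep {..<t} 1 (\<lambda>_. \<mu>)" using \<mu> by (auto simp: indep_def nz_def)
    then have "card (?F \<mu>) \<le> (\<Prod>j<1::nat. card differences) * CARD('p) ^ (card E * (card {..<t} - 1))"
      by (intro card_comb_in_le finE) (use t in \<open>auto simp: differences_def\<close>)
    also have "\<dots> \<le> card biased ^ 2 * CARD('p) ^ (card E * (t - 1))"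
      using card_differences by simp
    finally show ?thesis .
  qed
  have "vecs ({..<t} \<times> E) - good \<subseteq> (\<Union>\<mu>\<in>nz. ?F \<mu>)"
    by (auto simp: good_def nz_def)
  then have "card (vecs ({..<t} \<times> E) - good) \<le> card (\<Union>\<mu>\<in>nz. ?F \<mu>)"
    by (rule card_mono[rotated]) (rule finite_subset[OF _ finite_tuples], auto)
  also have "\<dots> \<le> (\<Sum>\<mu>\<in>nz. card (?F \<mu>))" by (rule card_UN_le[OF fin])
  also have "\<dots> \<le> (\<Sum>\<mu>\<in>nz. card biased ^ 2 * CARD('p) ^ (card E * (t - 1)))" by (rule sum_mono) (rule one)
  also have "\<dots> = card nz * (card biased ^ 2 * CARD('p) ^ (card E * (t - 1)))" by simp
  also have "\<dots> \<le> CARD('p) ^ t * (card biased ^ 2 * CARD('p) ^ (card E * (t - 1)))"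
  proof (rule mult_right_mono)
    have "card nz \<le> card coeffs" unfolding nz_def by (rule card_mono[OF finite_coeffs]) auto
    then show "card nz \<le> CARD('p) ^ t" by (simp only: card_coeffs)
  qed simp
  finally show ?thesis .
qed

text \<open>
  The polynomials that become biased after some combination of the members of \<open>Q\<close> is added. For a fixed
  \<open>Q\<close> this set is not much larger than \<open>biased\<close>, so a second tuple rarely has a combination in it.
\<close>

definition cosets :: "(nat \<times> 'e \<Rightarrow> 'p mod_ring) \<Rightarrow> ('e \<Rightarrow> 'p mod_ring) set" where
  "cosets Q = {c \<in> vecs E. \<exists>\<nu>\<in>coeffs. (\<lambda>e\<in>E. lin \<nu> Q e + c e) \<in> biased}"

text \<open>
  The combinations of \<open>Q'\<close> that are dependent on \<open>Q\<close>, up to bias. Its size measures how far the two tuples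
  are from being independent.
\<close>

definition overlap :: "(nat \<times> 'e \<Rightarrow> 'p mod_ring) \<Rightarrow> (nat \<times> 'e \<Rightarrow> 'p mod_ring) \<Rightarrow> (nat \<Rightarrow> 'p mod_ring) set" where
  "overlap Q Q' = {\<mu> \<in> coeffs. lin \<mu> Q' \<in> cosets Q}"

lemma card_cosets: "card (cosets Q) \<le> CARD('p) ^ t * card biased"
proof -
  have "cosets Q \<subseteq> (\<lambda>(\<nu>, b). \<lambda>e\<in>E. b e - lin \<nu> Q e) ` (coeffs \<times> biased)"
  proof
    fix c assume "c \<in> cosets Q"
    then obtain \<nu> where c: "c \<in> vecs E" "\<nu> \<in> coeffs" "(\<lambda>e\<in>E. lin \<nu> Q e + c e) \<in> biased"
      by (auto simp: cosets_def)
    have "c = (\<lambda>e\<in>E. (\<lambda>e\<in>E. lin \<nu> Q e + c e) e - lin \<nu> Q e)"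
      by (rule PiE_ext[OF c(1)]) simp_all
    then show "c \<in> (\<lambda>(\<nu>, b). \<lambda>e\<in>E. b e - lin \<nu> Q e) ` (coeffs \<times> biased)"
      using c(2,3) by (intro image_eqI[of _ _ "(\<nu>, \<lambda>e\<in>E. lin \<nu> Q e + c e)"]) simp_all
  qed
  then have "card (cosets Q) \<le> card (coeffs \<times> biased)"
    by (rule surj_card_le[rotated]) (simp add: finite_coeffs finite_biased)
  then show ?thesis by (simp only: card_cartesian_product card_coeffs)
qed

text \<open>
  Among the \<open>p ^ (2 t)\<close> terms of the Fourier expansion only those with a biased joint combination
  are not small. The map that sends such a combination to its \<open>Q'\<close>-part is injective since \<open>Q\<close> is good, and
  its image lies in \<open>overlap Q Q'\<close>.
\<close>

lemma card_zeros_Int: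
  assumes Q: "Q \<in> good"
  shows "real (card (zeros Q \<inter> zeros Q')) \<le> ((1 / real CARD('p) ^ t)\<^sup>2 * real (card (overlap Q Q')) + \<eta>) * real (card X)"
proof -
  let ?c = "\<lambda>\<nu> \<mu>. \<lambda>e\<in>E. lin \<nu> Q e + lin \<mu> Q' e"
  let ?S = "\<lambda>\<nu> \<mu>. \<Sum>x\<in>X. chi (pev f E (?c \<nu> \<mu>) x)"
  define L where "L = {(\<nu>, \<mu>). \<nu> \<in> coeffs \<and> \<mu> \<in> coeffs \<and> ?c \<nu> \<mu> \<in> biased}"
  have L: "L \<subseteq> coeffs \<times> coeffs" by (auto simp: L_def)
  have finCC: "finite (coeffs \<times> coeffs)" using finite_coeffs by blast
  have finL: "finite L" by (rule finite_subset[OF L finCC])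
  have cardL: "card L \<le> card (overlap Q Q')"
  proof (rule card_inj_on_le)
    show "finite (overlap Q Q')" 
      unfolding overlap_def by (rule finite_subset[OF Collect_restrict finite_coeffs])
    show "snd ` L \<subseteq> overlap Q Q'"
    proof (rule image_subsetI)
      fix a assume a: "a \<in> L"
      obtain \<nu> \<mu> where e: "a = (\<nu>, \<mu>)" by fastforce
      have h: "\<nu> \<in> coeffs" "\<mu> \<in> coeffs" "?c \<nu> \<mu> \<in> biased" using a unfolding e L_def by simp_all
      have "lin \<mu> Q' \<in> cosets Q"
        unfolding cosets_def mem_Collect_eq by (rule conjI[OF comb_in_vecs], rule bexI[OF _ h(1)], rule h(3))
      then show "snd a \<in> overlap Q Q'" using h(2) by (simp add: e overlap_def)
    qed
    show "inj_on snd L"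
    proof (rule inj_onI)
      fix a b assume ab: "a \<in> L" "b \<in> L" "snd a = snd b"
      obtain \<nu> \<mu> \<nu>' where e: "a = (\<nu>, \<mu>)" "b = (\<nu>', \<mu>)" using ab(3) by (metis prod.collapse)
      have h: "\<nu> \<in> coeffs" "\<nu>' \<in> coeffs" "?c \<nu> \<mu> \<in> biased" "?c \<nu>' \<mu> \<in> biased"
        using ab unfolding e L_def by simp_all
      define d where "d = (\<lambda>i\<in>{..<t}. \<nu> i - \<nu>' i)"
      have "lin d Q = (\<lambda>e\<in>E. ?c \<nu> \<mu> e - ?c \<nu>' \<mu> e)"
      proof (rule PiE_ext[of _ E "\<lambda>_. UNIV"])
        fix e assume "e \<in> E"
        then show "lin d Q e = (\<lambda>e\<in>E. ?c \<nu> \<mu> e - ?c \<nu>' \<mu> e) e"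
          by (simp add: comb_def d_def left_diff_distrib sum_subtractf)
      qed simp_all
      moreover have "(\<lambda>e\<in>E. ?c \<nu> \<mu> e - ?c \<nu>' \<mu> e) \<in> differences"
        unfolding differences_def using h(3,4)
        by (intro image_eqI[of _ _ "(?c \<nu> \<mu>, ?c \<nu>' \<mu>)"]) simp_all
      ultimately have "lin d Q \<in> differences" by (simp only:)
      moreover have "d \<in> coeffs" by (simp add: d_def)
      ultimately have "\<forall>i<t. d i = 0" using Q unfolding good_def by blast
      then have "\<nu> = \<nu>'" by (intro PiE_ext[OF h(1,2)]) (simp add: d_def)
      then show "a = b" by (simp add: e)
    qed
  qed
  have "real (card (zeros Q \<inter> zeros Q')) * real CARD('p) ^ t * real CARD('p) ^ t = cmod (\<Sum>(\<nu>, \<mu>)\<in>coeffs \<times> coeffs. ?S \<nu> \<mu>)"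
    unfolding card_zeros_Int_fourier[symmetric] by (simp add: norm_mult norm_power)
  also have "\<dots> \<le> (\<Sum>(\<nu>, \<mu>)\<in>coeffs \<times> coeffs. cmod (?S \<nu> \<mu>))"
    unfolding case_prod_unfold by (rule norm_sum)
  also have "\<dots> \<le> (\<Sum>a\<in>coeffs \<times> coeffs. (if a \<in> L then real (card X) else 0) + \<eta> * real (card X))"
  proof (rule sum_mono)
    fix a assume a: "a \<in> coeffs \<times> coeffs"
    obtain \<nu> \<mu> where e: "a = (\<nu>, \<mu>)" by fastforce
    have "0 \<le> \<eta> * real (card X)" using \<eta> by simp
    then show "(case a of (\<nu>, \<mu>) \<Rightarrow> cmod (?S \<nu> \<mu>)) \<le> (if a \<in> L then real (card X) else 0) + \<eta> * real (card X)"
    proof (cases "a \<in> L")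
      case False
      then have "?c \<nu> \<mu> \<notin> biased" using a by (simp add: L_def e)
      then show ?thesis using bias_le_of_not_biased[of "?c \<nu> \<mu>"] False unfolding e by simp
    next
      case True
      then show ?thesis using bias_le[of "?c \<nu> \<mu>"] \<open>0 \<le> \<eta> * real (card X)\<close> unfolding e by simp
    qed
  qed
  also have "\<dots> = (\<Sum>a\<in>coeffs \<times> coeffs. if a \<in> L then real (card X) else 0) + real CARD('p) ^ t * real CARD('p) ^ t * (\<eta> * real (card X))"
    by (simp add: sum.distrib card_cartesian_product card_coeffs)
  also have "(\<Sum>a\<in>coeffs \<times> coeffs. if a \<in> L then real (card X) else 0) = real (card L) * real (card X)"
  proof -
    have "coeffs \<times> coeffs \<inter> L = L" using L by auto
    then show ?thesis by (simp add: sum.inter_restrict[OF finCC, symmetric])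
  qed
  also have "real (card L) * real (card X) \<le> real (card (overlap Q Q')) * real (card X)"
    using cardL by (intro mult_right_mono) simp_all
  finally have "real (card (zeros Q \<inter> zeros Q')) * real CARD('p) ^ t * real CARD('p) ^ t
      \<le> real (card (overlap Q Q')) * real (card X) + real CARD('p) ^ t * real CARD('p) ^ t * (\<eta> * real (card X))" by simp
  moreover have "((1 / real CARD('p) ^ t)\<^sup>2 * real (card (overlap Q Q')) + \<eta>) * real (card X) * (real CARD('p) ^ t * real CARD('p) ^ t)
      = real (card (overlap Q Q')) * real (card X) + real CARD('p) ^ t * real CARD('p) ^ t * (\<eta> * real (card X))"
    using field_power_ge by (simp add: field_simps power2_eq_square)
  ultimately have "real (card (zeros Q \<inter> zeros Q')) * (real CARD('p) ^ t * real CARD('p) ^ t)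
      \<le> ((1 / real CARD('p) ^ t)\<^sup>2 * real (card (overlap Q Q')) + \<eta>) * real (card X) * (real CARD('p) ^ t * real CARD('p) ^ t)"
    by (simp only: mult.assoc)
  then show ?thesis by (rule mult_right_le_imp_le) (use field_power_ge in simp)
qed

text \<open>
  A set of more than \<open>p ^ r\<close> coefficient vectors contains \<open>r + 1\<close> independent ones, so \<open>r + 1\<close> independent
  combinations of \<open>Q'\<close> lie in the small set \<open>cosets Q\<close>.
\<close>

lemma card_large_overlap:
  assumes r: "r < t"
  shows "card {Q' \<in> vecs ({..<t} \<times> E). card (overlap Q Q') > CARD('p) ^ r}
    \<le> (CARD('p) ^ t) ^ Suc r * ((CARD('p) ^ t * card biased) ^ Suc r * CARD('p) ^ (card E * (t - Suc r)))"
proof -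
  define I where "I = {ys \<in> {..<Suc r} \<rightarrow>\<^sub>E coeffs. indep {..<t} (Suc r) ys}"
  let ?F = "\<lambda>ys. {Q' \<in> vecs ({..<t} \<times> E). \<forall>j<Suc r. lin (ys j) Q' \<in> (\<lambda>_. cosets Q) j}"
  have finPi: "finite ({..<Suc r} \<rightarrow>\<^sub>E coeffs)" by (intro finite_PiE finite_coeffs) simp
  have finI: "finite I" unfolding I_def by (rule finite_subset[OF _ finPi]) auto
  have cardI: "card I \<le> (CARD('p) ^ t) ^ Suc r"
  proof -
    have "card I \<le> card ({..<Suc r} \<rightarrow>\<^sub>E coeffs)" unfolding I_def by (rule card_mono[OF finPi]) auto
    then show ?thesis by (simp only: card_PiE finite_lessThan prod_constant card_lessThan card_coeffs)
  qed
  have one: "card (?F ys) \<le> (CARD('p) ^ t * card biased) ^ Suc r * CARD('p) ^ (card E * (t - Suc r))" if ys: "ys \<in> I" for ys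
  proof -
    have "card (?F ys) \<le> (\<Prod>j<Suc r. card (cosets Q)) * CARD('p) ^ (card E * (card {..<t} - Suc r))"
      by (rule card_comb_in_le) (use ys r in \<open>auto simp: I_def finE cosets_def\<close>)
    also have "\<dots> = card (cosets Q) ^ Suc r * CARD('p) ^ (card E * (t - Suc r))" by (simp only: prod_constant card_lessThan)
    also have "\<dots> \<le> (CARD('p) ^ t * card biased) ^ Suc r * CARD('p) ^ (card E * (t - Suc r))"
      by (intro mult_right_mono power_mono card_cosets) simp_all
    finally show ?thesis .
  qed
  have "{Q' \<in> vecs ({..<t} \<times> E). card (overlap Q Q') > CARD('p) ^ r} \<subseteq> (\<Union>ys\<in>I. ?F ys)"
  proof
    fix Q' assume "Q' \<in> {Q' \<in> vecs ({..<t} \<times> E). card (overlap Q Q') > CARD('p) ^ r}"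
    then have Q': "Q' \<in> vecs ({..<t} \<times> E)" "card (overlap Q Q') > CARD('p) ^ r" by simp_all
    have sub: "overlap Q Q' \<subseteq> coeffs" by (auto simp: overlap_def)
    have "0 < (\<Prod>j<Suc r. card (overlap Q Q') - CARD('p) ^ j)"
    proof (rule prod_pos)
      fix j assume "j \<in> {..<Suc r}"
      then have "CARD('p) ^ j \<le> CARD('p) ^ r" using p3 by (intro power_increasing) simp_all
      then show "0 < card (overlap Q Q') - CARD('p) ^ j" using Q'(2) by simp
    qed
    also have "\<dots> \<le> card {ys \<in> {..<Suc r} \<rightarrow>\<^sub>E overlap Q Q'. indep {..<t} (Suc r) ys}"
      by (rule card_indep_tuples_ge[OF _ sub]) simp
    finally have "{ys \<in> {..<Suc r} \<rightarrow>\<^sub>E overlap Q Q'. indep {..<t} (Suc r) ys} \<noteq> {}" by (metis card.empty less_irrefl)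
    then obtain ys where ys: "ys \<in> {..<Suc r} \<rightarrow>\<^sub>E overlap Q Q'" "indep {..<t} (Suc r) ys" by blast
    have "ys \<in> I" using ys PiE_mono[of "{..<Suc r}" "\<lambda>_. overlap Q Q'" "\<lambda>_. coeffs"] sub
      by (simp add: I_def subset_iff)
    moreover have "Q' \<in> ?F ys"
    proof -
      have "lin (ys j) Q' \<in> cosets Q" if "j < Suc r" for j
        using PiE_mem[OF ys(1), of j] that by (simp add: overlap_def)
      then show ?thesis using Q'(1) by simp
    qed
    ultimately show "Q' \<in> (\<Union>ys\<in>I. ?F ys)" unfolding UN_iff by (intro bexI[of _ ys])
  qed
  then have "card {Q' \<in> vecs ({..<t} \<times> E). card (overlap Q Q') > CARD('p) ^ r} \<le> card (\<Union>ys\<in>I. ?F ys)"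
    by (rule card_mono[rotated]) (rule finite_subset[OF _ finite_tuples], auto)
  also have "\<dots> \<le> (\<Sum>ys\<in>I. card (?F ys))" by (rule card_UN_le[OF finI])
  also have "\<dots> \<le> (\<Sum>ys\<in>I. (CARD('p) ^ t * card biased) ^ Suc r * CARD('p) ^ (card E * (t - Suc r)))"
    by (rule sum_mono) (rule one)
  also have "\<dots> = card I * ((CARD('p) ^ t * card biased) ^ Suc r * CARD('p) ^ (card E * (t - Suc r)))" by simp
  also have "\<dots> \<le> (CARD('p) ^ t) ^ Suc r * ((CARD('p) ^ t * card biased) ^ Suc r * CARD('p) ^ (card E * (t - Suc r)))"
    by (rule mult_right_mono[OF cardI]) simp
  finally show ?thesis .
qed

end

section \<open>The second moment\<close>

lemma card_subsets_avoiding: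
  assumes "finite X" "Z \<subseteq> X"
  shows "card {M. M \<subseteq> X \<and> card M = m \<and> M \<inter> Z = {}} = (card X - card Z) choose m"
proof -
  have "{M. M \<subseteq> X \<and> card M = m \<and> M \<inter> Z = {}} = {M. M \<subseteq> X - Z \<and> card M = m}" by auto
  moreover have "card (X - Z) = card X - card Z"
    using assms by (simp add: card_Diff_subset finite_subset)
  ultimately show ?thesis using assms by (simp add: n_subsets)
qed

lemma power_bracket:
  fixes b :: nat
  assumes "b ^ 0 < n" "n \<le> b ^ t"
  shows "\<exists>r<t. b ^ r < n \<and> n \<le> b ^ Suc r"
  using assms(2)
proof (induction t)
  case 0
  then show ?case using assms(1) by simp
next
  case (Suc t)
  show ?case
  proof (cases "n \<le> b ^ t")
    case True
    then show ?thesis using Suc.IH less_Suc_eq by blast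
  next
    case False
    then show ?thesis using Suc.prems by (intro exI[of _ t]) simp
  qed
qed

lemma Bernoulli_power_ge:
  fixes x :: real
  assumes "x \<le> 1"
  shows "1 - real m * x \<le> (1 - x) ^ m"
  using Bernoulli_inequality[of "- x" m] assms by simp

context poly_system
begin

lemma card_overlap_le: "card (overlap Q Q') \<le> CARD('p) ^ t"
proof -
  have "card (overlap Q Q') \<le> card coeffs"
    unfolding overlap_def by (rule card_mono[OF finite_coeffs]) auto
  then show ?thesis by (simp only: card_coeffs)
qed

lemma zeros_subset: "zeros Q \<subseteq> X" by (auto simp: zeros_def)

text \<open>
  By inclusion and exclusion, the share of points outside both zero sets is at most
  \<open>1 - 2 u + u\<^sup>2 p ^ r + 3 \<eta>\<close> with \<open>u = p ^ - t\<close>, that is, \<open>(1 - u)\<^sup>2\<close> times the factor from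
  \<open>overlap_growth_le\<close>, up to a relative error of \<open>7 \<eta>\<close>.
\<close>

lemma avoid_pair_le:
  fixes Y :: real and m :: nat
  defines "a \<equiv> 1 - 1 / real CARD('p) ^ t"
  assumes Q: "Q \<in> good" "Q' \<in> good" and r: "r \<le> t" "card (overlap Q Q') \<le> CARD('p) ^ r"
    and Y: "real m * ln (1 / a) \<le> real t * Y" and small: "7 * \<eta> * real m \<le> 1 / 20"
  shows "real (card {M. M \<subseteq> X \<and> card M = m \<and> M \<inter> (zeros Q \<union> zeros Q') = {}})
    \<le> real (card X choose m) * (a\<^sup>2) ^ m * exp (1 / 20) * exp (real r * Y)"
proof -
  let ?p = "real CARD('p)" and ?N = "real (card X)" and ?Z = "zeros Q \<union> zeros Q'"
  define u where "u = 1 / ?p ^ t"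
  define \<rho> where "\<rho> = 1 + u\<^sup>2 * (?p ^ r - 1) / (1 - u)\<^sup>2"
  have au: "a = 1 - u" by (simp add: a_def u_def)
  have u: "0 < u" "u \<le> 1 / 3" using inverse_field_power_bounds by (simp_all add: u_def)
  have Zs: "?Z \<subseteq> X" using zeros_subset by blast
  have Zle: "card ?Z \<le> card X" by (rule card_mono[OF finX Zs])
  have fz: "finite (zeros Q)" for Q by (rule finite_subset[OF zeros_subset finX])
  have "card (zeros Q) + card (zeros Q') = card ?Z + card (zeros Q \<inter> zeros Q')"
    by (rule card_Un_Int[OF fz fz])
  then have c: "real (card ?Z) = real (card (zeros Q)) + real (card (zeros Q')) - real (card (zeros Q \<inter> zeros Q'))"
    by linarith
  have ov: "real (card (overlap Q Q')) \<le> ?p ^ r"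
    using r(2) by (simp only: of_nat_power[symmetric] of_nat_le_iff)
  have z1: "(u - \<eta>) * ?N \<le> real (card (zeros Q))" "(u - \<eta>) * ?N \<le> real (card (zeros Q'))"
    using card_zeros[OF Q(1)] card_zeros[OF Q(2)] unfolding u_def[symmetric] abs_le_iff left_diff_distrib by linarith+
  have "real (card (zeros Q \<inter> zeros Q')) \<le> (u\<^sup>2 * real (card (overlap Q Q')) + \<eta>) * ?N"
    unfolding u_def by (rule card_zeros_Int[OF Q(1)])
  also have "\<dots> \<le> (u\<^sup>2 * ?p ^ r + \<eta>) * ?N"
    by (intro mult_right_mono add_right_mono mult_left_mono ov) simp_all
  finally have "(2 * u - 3 * \<eta> - u\<^sup>2 * ?p ^ r) * ?N \<le> real (card ?Z)"
    unfolding c using z1 by (simp add: algebra_simps)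
  then have "2 * u - 3 * \<eta> - u\<^sup>2 * ?p ^ r \<le> real (card ?Z) / ?N"
    using card_X_pos by (simp add: le_divide_eq)
  then have q: "1 - real (card ?Z) / ?N \<le> 1 - 2 * u + u\<^sup>2 * ?p ^ r + 3 * \<eta>" by linarith
  have a: "2 / 3 \<le> a" using u by (simp add: au)
  have a2: "4 / 9 \<le> a\<^sup>2"
    using power_mono[OF a, of 2] by (simp add: power2_eq_square)
  have \<rho>1: "1 \<le> \<rho>"
  proof -
    have "1 \<le> ?p ^ r" using p3 by (intro one_le_power) simp
    then show ?thesis by (simp add: \<rho>_def)
  qed
  have "1 - 2 * u + u\<^sup>2 * ?p ^ r = a\<^sup>2 * \<rho>"
  proof -
    have "a\<^sup>2 * \<rho> = a\<^sup>2 + u\<^sup>2 * (?p ^ r - 1)" using a unfolding \<rho>_def au[symmetric] by (simp add: field_simps)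
    moreover have "a\<^sup>2 = 1 - 2 * u + u\<^sup>2" by (simp add: au power2_eq_square algebra_simps)
    moreover have "u\<^sup>2 * (?p ^ r - 1) = u\<^sup>2 * ?p ^ r - u\<^sup>2" by (simp add: right_diff_distrib)
    ultimately show ?thesis by linarith
  qed
  moreover have "3 * \<eta> \<le> a\<^sup>2 * \<rho> * (7 * \<eta>)"
  proof -
    have "4 / 9 * 1 \<le> a\<^sup>2 * \<rho>" using a2 \<rho>1 by (intro mult_mono) simp_all
    then have "4 / 9 * 1 * (7 * \<eta>) \<le> a\<^sup>2 * \<rho> * (7 * \<eta>)" using \<eta> by (intro mult_right_mono) simp_all
    moreover have "3 * \<eta> \<le> 4 / 9 * 1 * (7 * \<eta>)" using \<eta> by simp
    ultimately show ?thesis by (rule order_trans[rotated])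
  qed
  ultimately have q2: "1 - real (card ?Z) / ?N \<le> a\<^sup>2 * \<rho> * (1 + 7 * \<eta>)"
    using q by (simp add: ring_distribs)
  have q0: "0 \<le> 1 - real (card ?Z) / ?N" using Zle card_X_pos by (simp add: divide_le_eq)
  have \<rho>m: "\<rho> ^ m \<le> exp (real r * Y)"
  proof -
    have "real m * ln \<rho> \<le> real m * (real r / real t * ln (1 / a))"
      using overlap_growth_le(2)[of ?p r t] p3 r(1) t unfolding \<rho>_def au u_def by (intro mult_left_mono) simp_all
    also have "\<dots> = real r / real t * (real m * ln (1 / a))" by simp
    also have "\<dots> \<le> real r / real t * (real t * Y)" by (rule mult_left_mono[OF Y]) simp
    also have "\<dots> = real r * Y" using t by simp
    finally have "exp (real m * ln \<rho>) \<le> exp (real r * Y)" by simp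
    then show ?thesis using \<rho>1 by (simp add: exp_of_nat_mult)
  qed
  have \<eta>m: "(1 + 7 * \<eta>) ^ m \<le> exp (1 / 20)"
  proof -
    have "(1 + 7 * \<eta>) ^ m \<le> exp (7 * \<eta>) ^ m"
      using \<eta> by (intro power_mono exp_ge_add_one_self) simp
    also have "\<dots> = exp (7 * \<eta> * real m)" by (simp add: exp_of_nat_mult[symmetric] mult.commute)
    also have "\<dots> \<le> exp (1 / 20)" using small by simp
    finally show ?thesis .
  qed
  have "real (card {M. M \<subseteq> X \<and> card M = m \<and> M \<inter> ?Z = {}}) = real ((card X - card ?Z) choose m)"
    by (simp only: card_subsets_avoiding[OF finX Zs])
  also have "\<dots> \<le> real (card X choose m) * (1 - real (card ?Z) / ?N) ^ m"
    by (rule binomial_diff_le[OF Zle]) (use card_X_pos in simp)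
  also have "\<dots> \<le> real (card X choose m) * (a\<^sup>2 * \<rho> * (1 + 7 * \<eta>)) ^ m"
    by (intro mult_left_mono power_mono q2 q0) simp
  also have "\<dots> = real (card X choose m) * ((a\<^sup>2) ^ m * (\<rho> ^ m * (1 + 7 * \<eta>) ^ m))"
    by (simp only: power_mult_distrib mult.assoc)
  also have "\<dots> \<le> real (card X choose m) * ((a\<^sup>2) ^ m * (exp (real r * Y) * exp (1 / 20)))"
    by (intro mult_left_mono mult_mono \<rho>m \<eta>m) (use \<eta> \<rho>1 in simp_all)
  finally show ?thesis by (simp only: mult_ac)
qed

lemma avoid_one_ge:
  fixes m :: nat
  defines "a \<equiv> 1 - 1 / real CARD('p) ^ t"
  assumes Q: "Q \<in> good" and m: "2 * m \<le> card X"
    and small: "real m * (3 * \<eta> + 3 * real m / real (card X)) \<le> 1 / 20"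
  shows "real (card X choose m) * a ^ m * (19 / 20)
    \<le> real (card {M. M \<subseteq> X \<and> card M = m \<and> M \<inter> zeros Q = {}})"
proof -
  let ?N = "real (card X)" and ?z = "real (card (zeros Q))"
  define u where "u = 1 / real CARD('p) ^ t"
  define \<tau> where "\<tau> = 3 * \<eta> + 3 * real m / ?N"
  have au: "a = 1 - u" by (simp add: a_def u_def)
  have u: "0 < u" "u \<le> 1 / 3" using inverse_field_power_bounds by (simp_all add: u_def)
  have N: "0 < ?N" by (rule card_X_pos)
  have mN: "real m \<le> ?N / 2" using m by linarith
  have mX: "m < card X" using m N by linarith
  have d: "real (card X - m) = ?N - real m" using mX by (simp add: of_nat_diff)
  have z: "?z \<le> (u + \<eta>) * ?N"
    using card_zeros[OF Q] unfolding u_def[symmetric] abs_le_iff distrib_right by linarith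
  have "(u + \<eta>) * ?N \<le> 1 / 2 * ?N" using u \<eta> by (intro mult_right_mono) simp_all
  then have "?z \<le> real (card X - m)" unfolding d using z mN by linarith
  then have zX: "card (zeros Q) \<le> card X - m" by linarith
  have \<tau>0: "0 \<le> \<tau>" using \<eta> by (simp add: \<tau>_def)
  have base: "a * (1 - \<tau>) \<le> 1 - ?z / real (card X - m)"
  proof -
    have h: "?z / (?N - real m) \<le> u + 2 * \<eta> + 2 * real m / ?N * u"
    proof -
      have x: "?N \<le> (1 + 2 * real m / ?N) * (?N - real m)"
      proof -
        have "(1 + 2 * real m / ?N) * (?N - real m) = ?N + real m * (1 - 2 * (real m / ?N))"
          using N by (simp add: field_simps)
        moreover have "0 \<le> 1 - 2 * (real m / ?N)" using mN N by (simp add: field_simps)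
        ultimately show ?thesis by simp
      qed
      have "?z \<le> u * ?N + \<eta> * ?N" using z by (simp add: distrib_right)
      also have "\<dots> \<le> u * ((1 + 2 * real m / ?N) * (?N - real m)) + \<eta> * (2 * (?N - real m))"
        by (intro add_mono mult_left_mono x) (use u \<eta> mN in simp_all)
      also have "\<dots> = (u + 2 * \<eta> + 2 * real m / ?N * u) * (?N - real m)" by (simp add: algebra_simps)
      finally show ?thesis using mN N by (simp add: divide_le_eq)
    qed
    have "2 * \<eta> + 2 * real m / ?N * u \<le> 2 / 3 * \<tau>"
    proof -
      have "2 * real m / ?N * u \<le> 2 * real m / ?N * 1" using u by (intro mult_left_mono) simp_all
      then show ?thesis by (simp add: \<tau>_def)
    qed
    also have "\<dots> \<le> a * \<tau>" using u \<tau>0 by (intro mult_right_mono) (simp_all add: au)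
    finally have "a * (1 - \<tau>) \<le> 1 - (u + 2 * \<eta> + 2 * real m / ?N * u)" by (simp add: right_diff_distrib au)
    then show ?thesis using h unfolding d by linarith
  qed
  have \<tau>1: "19 / 20 \<le> (1 - \<tau>) ^ m"
  proof (cases "m = 0")
    case False
    have "1 * \<tau> \<le> real m * \<tau>" using False \<tau>0 by (intro mult_right_mono) simp_all
    then have "\<tau> \<le> 1" using small unfolding \<tau>_def[symmetric] by linarith
    from Bernoulli_power_ge[OF this, of m] show ?thesis using small unfolding \<tau>_def[symmetric] by linarith
  qed simp
  have a1: "0 \<le> 1 - \<tau> \<or> m = 0"
  proof (cases "m = 0")
    case False
    have "1 * \<tau> \<le> real m * \<tau>" using False \<tau>0 by (intro mult_right_mono) simp_all
    then show ?thesis using small unfolding \<tau>_def[symmetric] by linarith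
  qed simp
  have a0: "0 \<le> a" using u by (simp add: au)
  have "a ^ m * (19 / 20) \<le> a ^ m * (1 - \<tau>) ^ m" by (rule mult_left_mono[OF \<tau>1]) (use a0 in simp)
  also have "\<dots> = (a * (1 - \<tau>)) ^ m" by (simp only: power_mult_distrib)
  also have "\<dots> \<le> (1 - ?z / real (card X - m)) ^ m"
    using a1
  proof
    assume "0 \<le> 1 - \<tau>"
    then show ?thesis by (intro power_mono base mult_nonneg_nonneg a0)
  qed simp
  finally have "real (card X choose m) * (a ^ m * (19 / 20)) \<le> real (card X choose m) * (1 - ?z / real (card X - m)) ^ m"
    by (rule mult_left_mono) simp
  also have "\<dots> \<le> real ((card X - card (zeros Q)) choose m)"
    by (rule binomial_diff_ge[OF order_refl mX zX])
  also have "\<dots> = real (card {M. M \<subseteq> X \<and> card M = m \<and> M \<inter> zeros Q = {}})"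
    by (simp only: card_subsets_avoiding[OF finX zeros_subset])
  finally show ?thesis by (simp only: mult.assoc)
qed

text \<open>
  Group the tuples \<open>Q'\<close> by the power of \<open>p\<close> that bounds the size of the overlap. The group with exponent
  \<open>r\<close> contributes at most \<open>\<kappa> ^ r\<close> times the contribution of independent tuples, where
  \<open>\<kappa> = p ^ (2 t) * card biased * exp Y / p ^ card E\<close>, and \<open>\<kappa>\<close> is small by the last assumption.
\<close>

lemma avoid_pairs_sum_le:
  fixes Y :: real and m :: nat
  defines "a \<equiv> 1 - 1 / real CARD('p) ^ t"
  assumes Q: "Q \<in> good"
    and Y: "real m * ln (1 / a) \<le> real t * Y" and small: "7 * \<eta> * real m \<le> 1 / 20"
    and few: "real t * (real CARD('p) ^ (2 * t) * real (card biased) * exp Y / real CARD('p) ^ card E) \<le> 1 / 20"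
  shows "(\<Sum>Q'\<in>good. real (card {M. M \<subseteq> X \<and> card M = m \<and> M \<inter> (zeros Q \<union> zeros Q') = {}}))
    \<le> real CARD('p) ^ (t * card E) * (real (card X choose m) * (a\<^sup>2) ^ m * exp (1 / 20) * (21 / 20))"
proof -
  let ?p = "real CARD('p)" and ?D = "card E"
  define B where "B = real (card X choose m) * (a\<^sup>2) ^ m * exp (1 / 20)"
  define \<kappa> where "\<kappa> = ?p ^ (2 * t) * real (card biased) * exp Y / ?p ^ ?D"
  define T where "T = ?p ^ (t * ?D)"
  let ?L = "\<lambda>r. {Q' \<in> vecs ({..<t} \<times> E). card (overlap Q Q') > CARD('p) ^ r}"
  let ?A = "\<lambda>Q'. real (card {M. M \<subseteq> X \<and> card M = m \<and> M \<inter> (zeros Q \<union> zeros Q') = {}})"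
  have B0: "0 \<le> B" by (simp add: B_def)
  have \<kappa>0: "0 \<le> \<kappa>" by (simp add: \<kappa>_def)
  have \<kappa>t: "real t * \<kappa> \<le> 1 / 20" using few by (simp only: \<kappa>_def)
  have \<kappa>1: "\<kappa> \<le> 1"
  proof -
    have "1 * \<kappa> \<le> real t * \<kappa>" using t \<kappa>0 by (intro mult_right_mono) simp_all
    then show ?thesis using \<kappa>t by linarith
  qed
  have goodv: "good \<subseteq> vecs ({..<t} \<times> E)" by (auto simp: good_def)
  have cg: "real (card good) \<le> T"
  proof -
    have "card good \<le> CARD('p) ^ (t * ?D)"
      using card_mono[OF finite_tuples goodv] by (simp only: card_tuples)
    then show ?thesis unfolding T_def by (simp only: of_nat_power[symmetric] of_nat_le_iff)
  qed
  have pair: "?A Q' \<le> B + (\<Sum>r<t. of_bool (Q' \<in> ?L r) * (B * exp (real (Suc r) * Y)))" if Q': "Q' \<in> good" for Q'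
  proof (cases "card (overlap Q Q') \<le> CARD('p) ^ 0")
    case True
    have "?A Q' \<le> B * exp (real 0 * Y)"
      unfolding B_def a_def by (rule avoid_pair_le[OF Q Q' _ True Y[unfolded a_def] small]) simp
    moreover have "0 \<le> (\<Sum>r<t. of_bool (Q' \<in> ?L r) * (B * exp (real (Suc r) * Y)))"
      using B0 by (intro sum_nonneg) simp
    ultimately show ?thesis by simp
  next
    case False
    then obtain r where r: "r < t" "CARD('p) ^ r < card (overlap Q Q')" "card (overlap Q Q') \<le> CARD('p) ^ Suc r"
      using power_bracket[of "CARD('p)" "card (overlap Q Q')" t] card_overlap_le by (auto simp: not_le)
    have "?A Q' \<le> B * exp (real (Suc r) * Y)"
      unfolding B_def a_def by (rule avoid_pair_le[OF Q Q' _ r(3) Y[unfolded a_def] small]) (use r(1) in simp)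
    also have "\<dots> = of_bool (Q' \<in> ?L r) * (B * exp (real (Suc r) * Y))"
      using r(2) Q' goodv by auto
    also have "\<dots> \<le> (\<Sum>r<t. of_bool (Q' \<in> ?L r) * (B * exp (real (Suc r) * Y)))"
      using r(1) B0 by (intro member_le_sum[of r "{..<t}" "\<lambda>r. of_bool (Q' \<in> ?L r) * (B * exp (real (Suc r) * Y))"]) simp_all
    finally show ?thesis using B0 by linarith
  qed
  have cnt: "real (card (?L r)) * exp (real (Suc r) * Y) \<le> T * \<kappa>" if r: "r < t" for r
  proof -
    have "card (?L r) \<le> (CARD('p) ^ t) ^ Suc r * ((CARD('p) ^ t * card biased) ^ Suc r * CARD('p) ^ (?D * (t - Suc r)))"
      by (rule card_large_overlap[OF r])
    then have "real (card (?L r)) \<le> real ((CARD('p) ^ t) ^ Suc r * ((CARD('p) ^ t * card biased) ^ Suc r * CARD('p) ^ (?D * (t - Suc r))))"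
      by (simp only: of_nat_le_iff)
    also have "\<dots> = (?p ^ (2 * t) * real (card biased)) ^ Suc r * ?p ^ (?D * (t - Suc r))"
      by (simp only: of_nat_mult of_nat_power power_mult_distrib mult.assoc power_mult[symmetric] power_add[symmetric]
          mult_2 distrib_right) (simp add: power_add mult_ac)
    finally have "real (card (?L r)) * exp (real (Suc r) * Y)
        \<le> (?p ^ (2 * t) * real (card biased)) ^ Suc r * ?p ^ (?D * (t - Suc r)) * exp (real (Suc r) * Y)"
      by (rule mult_right_mono) simp
    also have "\<dots> = T * \<kappa> ^ Suc r"
    proof -
      have "t * ?D = ?D * (t - Suc r) + ?D * Suc r"
        using r by (simp only: distrib_left[symmetric]) (simp add: mult.commute)
      then have T: "T = ?p ^ (?D * (t - Suc r)) * (?p ^ ?D) ^ Suc r"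
        by (simp only: T_def power_add power_mult)
      have e: "exp (real (Suc r) * Y) = exp Y ^ Suc r" by (rule exp_of_nat_mult)
      have cancel: "K * A * x = (A * z) * (K * x / z)" if "z \<noteq> 0" for K A x z :: real
        using that by simp
      show ?thesis unfolding T e \<kappa>_def power_divide power_mult_distrib by (rule cancel) simp
    qed
    also have "\<dots> \<le> T * \<kappa>"
    proof (rule mult_left_mono)
      show "\<kappa> ^ Suc r \<le> \<kappa>" using \<kappa>0 \<kappa>1 power_decreasing[of 1 "Suc r" \<kappa>] by simp
    qed (simp add: T_def)
    finally show ?thesis .
  qed
  have "(\<Sum>Q'\<in>good. ?A Q') \<le> (\<Sum>Q'\<in>good. B + (\<Sum>r<t. of_bool (Q' \<in> ?L r) * (B * exp (real (Suc r) * Y))))"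
    by (rule sum_mono) (rule pair)
  also have "\<dots> = real (card good) * B + (\<Sum>r<t. (\<Sum>Q'\<in>good. of_bool (Q' \<in> ?L r)) * (B * exp (real (Suc r) * Y)))"
    unfolding sum.distrib sum_constant sum_distrib_right by (subst sum.swap) (rule refl)
  also have "\<dots> \<le> T * B + (\<Sum>r<t. B * (T * \<kappa>))"
  proof (intro add_mono mult_right_mono cg B0 sum_mono)
    fix r assume r: "r \<in> {..<t}"
    have "(\<Sum>Q'\<in>good. of_bool (Q' \<in> ?L r)) \<le> real (card (?L r))"
    proof -
      have "(\<Sum>Q'\<in>good. of_bool (Q' \<in> ?L r)) = real (card (good \<inter> ?L r))"
        using finite_good by (simp add: sum_of_bool_eq Int_def)
      also have "\<dots> \<le> real (card (?L r))"
        unfolding of_nat_le_iff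
        by (rule card_mono[OF finite_subset[OF Collect_restrict finite_tuples] Int_lower2])
      finally show ?thesis .
    qed
    then have "(\<Sum>Q'\<in>good. of_bool (Q' \<in> ?L r)) * (B * exp (real (Suc r) * Y))
        \<le> real (card (?L r)) * (B * exp (real (Suc r) * Y))"
      by (rule mult_right_mono) (use B0 in simp)
    also have "\<dots> = B * (real (card (?L r)) * exp (real (Suc r) * Y))" by (simp only: mult_ac)
    also have "\<dots> \<le> B * (T * \<kappa>)" by (rule mult_left_mono[OF cnt B0]) (use r in simp)
    finally show "(\<Sum>Q'\<in>good. of_bool (Q' \<in> ?L r)) * (B * exp (real (Suc r) * Y)) \<le> B * (T * \<kappa>)" .
  qed
  also have "\<dots> = T * B * (1 + real t * \<kappa>)" by (simp add: algebra_simps)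
  also have "\<dots> \<le> T * B * (21 / 20)" by (rule mult_left_mono) (use \<kappa>t B0 in \<open>simp_all add: T_def\<close>)
  finally show ?thesis unfolding B_def T_def by (simp only: mult.assoc)
qed

text \<open>
  The second moment method for the number \<open>Z M\<close> of good tuples whose zero set misses \<open>M\<close>. By the
  Cauchy-Schwarz inequality, the number of sets \<open>M\<close> with \<open>Z M > 0\<close> is at least
  \<open>(\<Sum>M. Z M)\<^sup>2 / (\<Sum>M. (Z M)\<^sup>2)\<close>. With the error allowances \<open>1 / 20\<close> of the assumptions this is at least
  \<open>(19 / 20) ^ 4 / (exp (1 / 20) * 21 / 20) > 1 / 2\<close> of all sets.

  The parameter \<open>Y\<close> stands for \<open>(1 - \<epsilon>) * card E * ln p\<close>: the first condition on \<open>m\<close> is then the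
  condition that \<open>m\<close> lies below the threshold.
\<close>

theorem good_tuple_avoids:
  fixes Y :: real and m :: nat
  assumes m: "2 * m \<le> card X"
    and Y: "real m * ln (1 / (1 - 1 / real CARD('p) ^ t)) \<le> real t * Y"
    and h1: "real CARD('p) ^ t * real (card biased) ^ 2 / real CARD('p) ^ card E \<le> 1 / 20"
    and h2: "real m * (3 * \<eta> + 3 * real m / real (card X)) \<le> 1 / 20"
    and h3: "7 * \<eta> * real m \<le> 1 / 20"
    and h4: "real t * (real CARD('p) ^ (2 * t) * real (card biased) * exp Y / real CARD('p) ^ card E) \<le> 1 / 20"
  shows "real (card X choose m) < 2 * real (card {M. M \<subseteq> X \<and> card M = m \<and> (\<exists>Q\<in>good. M \<inter> zeros Q = {})})"
proof -
  let ?p = "real CARD('p)" and ?D = "card E"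
  define a where "a = 1 - 1 / ?p ^ t"
  define C where "C = real (card X choose m)"
  define T where "T = ?p ^ (t * ?D)"
  define Ms where "Ms = {M. M \<subseteq> X \<and> card M = m}"
  define Z where "Z M = card {Q \<in> good. M \<inter> zeros Q = {}}" for M
  define Hit where "Hit = {M. M \<subseteq> X \<and> card M = m \<and> (\<exists>Q\<in>good. M \<inter> zeros Q = {})}"
  have finMs: "finite Ms" unfolding Ms_def using finX by (rule finite_subset[rotated, OF finite_Pow_iff[THEN iffD2]]) auto
  have HM: "Hit \<subseteq> Ms" by (auto simp: Hit_def Ms_def)
  have finHit: "finite Hit" by (rule finite_subset[OF HM finMs])
  have Z0: "Z M = 0" if "M \<in> Ms - Hit" for M
  proof -
    have "{Q \<in> good. M \<inter> zeros Q = {}} = {}" using that by (auto simp: Ms_def Hit_def)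
    then show ?thesis by (simp only: Z_def card.empty)
  qed
  have a: "0 < a" using inverse_field_power_bounds by (simp add: a_def)
  have C: "0 < C" using m by (simp add: C_def)
  have T: "0 < T" by (simp add: T_def)
  have good_ge: "T * (19 / 20) \<le> real (card good)"
  proof -
    let ?V = "vecs ({..<t} \<times> E) :: (nat \<times> 'e \<Rightarrow> 'p mod_ring) set"
    have sub: "good \<subseteq> ?V" by (auto simp: good_def)
    have "card ?V = card good + card (?V - good)"
      using card_Un_disjoint[of good "?V - good"] finite_good finite_tuples sub by (simp add: Un_absorb1)
    then have "T = real (card good) + real (card (?V - good))"
      unfolding T_def card_tuples by (simp only: of_nat_power[symmetric] of_nat_add[symmetric])
    moreover have "real (card (?V - good)) \<le> T * (1 / 20)"
    proof -
      have "real (card (?V - good)) \<le> real (CARD('p) ^ t * (card biased ^ 2 * CARD('p) ^ (?D * (t - 1))))"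
        using card_not_good by (simp only: of_nat_le_iff)
      also have "\<dots> = T * (?p ^ t * real (card biased) ^ 2 / ?p ^ ?D)"
      proof -
        have "t * ?D = ?D * (t - 1) + ?D" using t by (cases t) simp_all
        then have "T = ?p ^ (?D * (t - 1)) * ?p ^ ?D" by (simp only: T_def power_add)
        then show ?thesis by (simp add: field_simps)
      qed
      also have "\<dots> \<le> T * (1 / 20)" by (rule mult_left_mono[OF h1]) (simp add: T_def)
      finally show ?thesis .
    qed
    ultimately show ?thesis by linarith
  qed
  have "(C * a ^ m * (19 / 20)) * (T * (19 / 20)) \<le> real (\<Sum>M\<in>Ms. Z M)"
  proof -
    have sw: "(\<Sum>M\<in>Ms. Z M) = (\<Sum>Q\<in>good. card {M \<in> Ms. M \<inter> zeros Q = {}})"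
      unfolding Z_def by (rule sum_multicount_gen[OF finMs finite_good]) simp
    have "(C * a ^ m * (19 / 20)) * (T * (19 / 20)) \<le> (C * a ^ m * (19 / 20)) * real (card good)"
      by (rule mult_left_mono[OF good_ge]) (use C a in simp)
    also have "\<dots> = (\<Sum>Q\<in>good. C * a ^ m * (19 / 20))" by simp
    also have "\<dots> \<le> (\<Sum>Q\<in>good. real (card {M \<in> Ms. M \<inter> zeros Q = {}}))"
    proof (rule sum_mono)
      fix Q assume "Q \<in> good"
      from avoid_one_ge[OF this m h2]
      show "C * a ^ m * (19 / 20) \<le> real (card {M \<in> Ms. M \<inter> zeros Q = {}})"
        unfolding C_def a_def Ms_def by (simp only: mem_Collect_eq conj_assoc)
    qed
    finally show ?thesis by (simp only: sw of_nat_sum)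
  qed
  also have "(\<Sum>M\<in>Ms. Z M) = (\<Sum>M\<in>Hit. Z M)"
    by (rule sum.mono_neutral_right[OF finMs HM]) (use Z0 in blast)
  finally have first: "C * a ^ m * (19 / 20) * (T * (19 / 20)) \<le> (\<Sum>M\<in>Hit. real (Z M))" by simp
  have second: "(\<Sum>M\<in>Hit. (real (Z M))\<^sup>2) \<le> T * (T * (C * (a\<^sup>2) ^ m * exp (1 / 20) * (21 / 20)))"
  proof -
    have sq: "Z M * Z M = card {q \<in> good \<times> good. M \<inter> (zeros (fst q) \<union> zeros (snd q)) = {}}" for M
    proof -
      have "{q \<in> good \<times> good. M \<inter> (zeros (fst q) \<union> zeros (snd q)) = {}}
          = {Q \<in> good. M \<inter> zeros Q = {}} \<times> {Q \<in> good. M \<inter> zeros Q = {}}" by auto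
      then show ?thesis by (simp only: Z_def card_cartesian_product)
    qed
    have "(\<Sum>M\<in>Hit. (real (Z M))\<^sup>2) = real (\<Sum>M\<in>Hit. Z M * Z M)" by (simp add: power2_eq_square)
    also have "(\<Sum>M\<in>Hit. Z M * Z M) \<le> (\<Sum>M\<in>Ms. Z M * Z M)" by (rule sum_mono2[OF finMs HM]) simp
    also have "(\<Sum>M\<in>Ms. Z M * Z M) = (\<Sum>q\<in>good \<times> good. card {M \<in> Ms. M \<inter> (zeros (fst q) \<union> zeros (snd q)) = {}})"
      unfolding sq by (rule sum_multicount_gen[OF finMs]) (use finite_good in auto)
    also have "\<dots> = (\<Sum>Q\<in>good. \<Sum>Q'\<in>good. card {M \<in> Ms. M \<inter> (zeros Q \<union> zeros Q') = {}})"
      unfolding sum.cartesian_product by (rule sum.cong) auto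
    also have "real \<dots> = (\<Sum>Q\<in>good. \<Sum>Q'\<in>good. real (card {M. M \<subseteq> X \<and> card M = m \<and> M \<inter> (zeros Q \<union> zeros Q') = {}}))"
      unfolding of_nat_sum Ms_def by (simp only: mem_Collect_eq conj_assoc)
    also have "\<dots> \<le> (\<Sum>Q\<in>good. T * (C * (a\<^sup>2) ^ m * exp (1 / 20) * (21 / 20)))"
      unfolding T_def C_def a_def by (rule sum_mono) (rule avoid_pairs_sum_le[OF _ Y h3 h4])
    also have "\<dots> = real (card good) * (T * (C * (a\<^sup>2) ^ m * exp (1 / 20) * (21 / 20)))" by simp
    also have "\<dots> \<le> T * (T * (C * (a\<^sup>2) ^ m * exp (1 / 20) * (21 / 20)))"
    proof (rule mult_right_mono)
      have "card good \<le> CARD('p) ^ (t * ?D)"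
        using card_mono[OF finite_tuples, of good] by (auto simp: card_tuples good_def)
      then show "real (card good) \<le> T" unfolding T_def by (simp only: of_nat_power[symmetric] of_nat_le_iff)
    qed (use T C in simp)
    finally show ?thesis by simp
  qed
  define W where "W = T * C * a ^ m"
  have W: "0 < W" using T C a by (simp add: W_def)
  have "(W * (361 / 400))\<^sup>2 \<le> (\<Sum>M\<in>Hit. 1 * real (Z M))\<^sup>2"
    using first W by (intro power_mono) (simp_all add: W_def mult_ac)
  also have "\<dots> \<le> (\<Sum>M\<in>Hit. 1\<^sup>2) * (\<Sum>M\<in>Hit. (real (Z M))\<^sup>2)" by (rule Cauchy_Schwarz_ineq_sum)
  also have "\<dots> \<le> real (card Hit) * (T * (T * (C * (a\<^sup>2) ^ m * exp (1 / 20) * (21 / 20))))"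
  proof -
    have "(\<Sum>M\<in>Hit. 1\<^sup>2) = real (card Hit)" by simp
    then show ?thesis using mult_left_mono[OF second, of "real (card Hit)"] by (simp only: of_nat_0_le_iff)
  qed
  finally have main: "(W * (361 / 400))\<^sup>2 \<le> real (card Hit) * (T * (T * (C * (a\<^sup>2) ^ m * exp (1 / 20) * (21 / 20))))" .
  have "C * (real (card Hit) * (T * (T * (C * (a\<^sup>2) ^ m * exp (1 / 20) * (21 / 20)))))
      = W\<^sup>2 * (real (card Hit) * (exp (1 / 20) * (21 / 20)))"
    unfolding W_def power2_eq_square power_mult_distrib by (simp only: mult_ac)
  moreover have "C * (W * (361 / 400))\<^sup>2 = W\<^sup>2 * (C * (361 / 400)\<^sup>2)"
    unfolding power_mult_distrib by (simp only: mult_ac)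
  ultimately have "W\<^sup>2 * (C * (361 / 400)\<^sup>2) \<le> W\<^sup>2 * (real (card Hit) * (exp (1 / 20) * (21 / 20)))"
    using mult_left_mono[OF main, of C] C by linarith
  then have "C * (361 / 400)\<^sup>2 \<le> real (card Hit) * (exp (1 / 20) * (21 / 20))"
    by (rule mult_left_le_imp_le) (use W in simp)
  also have "\<dots> \<le> real (card Hit) * (111 / 100)"
  proof (rule mult_left_mono)
    have "exp (1 / 20 :: real) \<le> 1 + 1 / 20 + (1 / 20)\<^sup>2" by (rule exp_bound) simp_all
    then show "exp (1 / 20) * (21 / 20) \<le> (111 / 100 :: real)" by (simp add: power2_eq_square)
  qed simp
  finally have "C < 2 * real (card Hit)" using C by (simp add: power2_eq_square)
  then show ?thesis by (simp only: C_def Hit_def)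
qed

end

section \<open>Progressions in zero sets\<close>

lemma degree_prod_linear_le:
  fixes a b :: "'i \<Rightarrow> 'a::comm_ring_1"
  assumes "finite e"
  shows "degree (\<Prod>i\<in>e. [:a i, b i:]) \<le> card e"
    and "Polynomial.coeff (\<Prod>i\<in>e. [:a i, b i:]) (card e) = (\<Prod>i\<in>e. b i)"
  using assms
proof (induction e rule: finite_induct)
  case (insert i e)
  let ?P = "\<Prod>i\<in>e. [:a i, b i:]"
  { case 1
    have "degree ([:a i, b i:] * ?P) \<le> degree [:a i, b i:] + degree ?P" by (rule degree_mult_le)
    also have "\<dots> \<le> 1 + card e" using insert.IH(1) by (intro add_mono) simp_all
    finally show ?case using insert.hyps by simp
  next
    case 2
    have "Polynomial.coeff ?P (Suc (card e)) = 0" using insert.IH(1) by (intro Polynomial.coeff_eq_0) simp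
    then show ?case using insert by simp
  }
qed simp_all

lemma of_nat_mod_ring_inj_on:
  "inj_on (of_nat :: nat \<Rightarrow> 'p::prime_card mod_ring) {..<CARD('p)}"
proof (rule linorder_inj_onI')
  fix i j assume ij: "i \<in> {..<CARD('p)}" "j \<in> {..<CARD('p)}" "i < j"
  show "of_nat i \<noteq> (of_nat j :: 'p mod_ring)"
  proof
    assume "of_nat i = (of_nat j :: 'p mod_ring)"
    then have "(of_nat (j - i) :: 'p mod_ring) = 0" using ij(3) by (simp add: of_nat_diff)
    then have "CARD('p) dvd j - i" by (rule of_nat_0_mod_ring_dvd)
    then show False using ij by (auto dest: dvd_imp_le)
  qed
qed

text \<open>
  As a function of \<open>j\<close>, the value at \<open>x + j d\<close> is a polynomial of degree at most \<open>q\<close> with coefficient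
  \<open>pev vec_prod E c d\<close> at \<open>j ^ q\<close>. It has the \<open>q + 1\<close> roots \<open>0, \<dots>, q\<close>, which are distinct elements of the
  field as \<open>q < p\<close>, so it is zero.
\<close>

lemma pev_difference_eq_0:
  fixes x d :: "'p::prime_card mod_ring Matrix.vec"
  assumes E: "\<And>e. e \<in> E \<Longrightarrow> card e = q \<and> e \<subseteq> {..<n}" and q: "q < CARD('p)"
    and x: "x \<in> carrier_vec n" "d \<in> carrier_vec n"
    and z: "\<And>j. j \<le> q \<Longrightarrow> pev vec_prod E c (x + of_nat j \<cdot>\<^sub>v d) = 0"
  shows "pev vec_prod E c d = 0"
proof -
  define G where "G = (\<Sum>e\<in>E. Polynomial.smult (c e) (\<Prod>i\<in>e. [:x $ i, d $ i:]))"
  have fin: "finite e" if "e \<in> E" for e using E[OF that] by (auto intro: finite_subset)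
  have deg: "degree G \<le> q"
  proof (cases "finite E")
    case True
    show ?thesis unfolding G_def
    proof (rule degree_sum_le[OF True])
      fix e assume e: "e \<in> E"
      have "degree (\<Prod>i\<in>e. [:x $ i, d $ i:]) \<le> q"
        using degree_prod_linear_le(1)[OF fin[OF e]] E[OF e] by simp
      then show "degree (Polynomial.smult (c e) (\<Prod>i\<in>e. [:x $ i, d $ i:])) \<le> q"
        by (rule order_trans[OF Polynomial.degree_smult_le])
    qed
  qed (simp add: G_def)
  have coeff: "Polynomial.coeff G q = pev vec_prod E c d"
    unfolding G_def Polynomial.coeff_sum pev_def vec_prod_def
  proof (rule sum.cong[OF refl])
    fix e assume e: "e \<in> E"
    show "Polynomial.coeff (Polynomial.smult (c e) (\<Prod>i\<in>e. [:x $ i, d $ i:])) q = c e * (\<Prod>i\<in>e. d $ i)"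
      using degree_prod_linear_le(2)[OF fin[OF e], of "\<lambda>i. x $ i" "\<lambda>i. d $ i"] E[OF e] by simp
  qed
  have root: "poly G (of_nat j) = 0" if j: "j \<le> q" for j
  proof -
    have "poly G (of_nat j) = pev vec_prod E c (x + of_nat j \<cdot>\<^sub>v d)"
      unfolding G_def poly_sum pev_def vec_prod_def
    proof (rule sum.cong[OF refl])
      fix e assume e: "e \<in> E"
      have "(\<Prod>i\<in>e. x $ i + of_nat j * d $ i) = (\<Prod>i\<in>e. (x + of_nat j \<cdot>\<^sub>v d) $ i)"
      proof (rule prod.cong[OF refl])
        fix i assume "i \<in> e"
        then have "i < n" using E[OF e] by blast
        then show "x $ i + of_nat j * d $ i = (x + of_nat j \<cdot>\<^sub>v d) $ i" using x by simp
      qed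
      then show "poly (Polynomial.smult (c e) (\<Prod>i\<in>e. [:x $ i, d $ i:])) (of_nat j) = c e * (\<Prod>i\<in>e. (x + of_nat j \<cdot>\<^sub>v d) $ i)"
        by (simp add: poly_prod)
    qed
    then show ?thesis using z[OF j] by simp
  qed
  have "G = 0"
  proof (rule ccontr)
    assume G: "G \<noteq> 0"
    have "inj_on (of_nat :: nat \<Rightarrow> 'p mod_ring) {..q}"
      by (rule inj_on_subset[OF of_nat_mod_ring_inj_on]) (use q in auto)
    then have "Suc q = card ((of_nat :: nat \<Rightarrow> 'p mod_ring) ` {..q})" by (simp add: card_image)
    also have "\<dots> \<le> card {a. poly G a = 0}"
      by (rule card_mono[OF poly_roots_finite[OF G]]) (use root in auto)
    also have "\<dots> \<le> degree G" by (rule card_poly_roots_bound[OF G])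
    finally show False using deg by simp
  qed
  then show ?thesis using coeff by simp
qed

lemma szemeredi_prob_lt_half:
  fixes \<alpha> :: real
  assumes sub: "Hit \<subseteq> {M :: 'p::prime_card mod_ring Matrix.vec set. M \<subseteq> carrier_vec n \<and> card M = m}"
    and fail: "\<And>M. M \<in> Hit \<Longrightarrow> \<not> szemeredi_holds n k \<alpha> M"
    and many: "real (CARD('p) ^ n choose m) < 2 * real (card Hit)"
  shows "szemeredi_prob TYPE('p) n k \<alpha> m < 1 / 2"
proof -
  let ?S = "{M :: 'p mod_ring Matrix.vec set. M \<subseteq> carrier_vec n \<and> card M = m}"
  have card: "card ?S = CARD('p) ^ n choose m"
    by (simp add: n_subsets finite_carrier_vec card_carrier_vec)
  have fin: "finite ?S"
    by (rule finite_subset[of _ "Pow (carrier_vec n)"]) (auto simp: finite_carrier_vec)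
  have finH: "finite Hit" by (rule finite_subset[OF sub fin])
  have cH: "card Hit \<le> card ?S" by (rule card_mono[OF fin sub])
  have S0: "0 < card ?S" using many cH card by (metis card_gt_0_iff fin finH gr0I le_zero_eq mult_zero_right of_nat_0 of_nat_less_0_iff)
  then have ne: "?S \<noteq> {}" by (metis card.empty less_irrefl)
  have "?S \<inter> {M. szemeredi_holds n k \<alpha> M} \<subseteq> ?S - Hit" using fail by blast
  then have "card (?S \<inter> {M. szemeredi_holds n k \<alpha> M}) \<le> card (?S - Hit)"
    by (rule card_mono[rotated]) (simp add: fin)
  also have "\<dots> = card ?S - card Hit" by (rule card_Diff_subset[OF finH sub])
  finally have "2 * real (card (?S \<inter> {M. szemeredi_holds n k \<alpha> M})) < real (card ?S)"
    using many cH unfolding card[symmetric] by linarith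
  then show ?thesis
    unfolding szemeredi_prob_def measure_pmf_of_set[OF ne fin] using S0 by (simp add: divide_less_eq)
qed

text \<open>
  The zero set of a good tuple that misses \<open>M\<close> is a dense set without progressions whose difference lies in
  \<open>M\<close>. The assumptions list what has to be small or large for \<open>good_tuple_avoids\<close>, in a form in which only
  the block size \<open>w\<close> has to tend to infinity.
\<close>

lemma szemeredi_prob_lt_half_of_small:
  fixes n q t w s m :: nat and \<alpha> \<epsilon> \<eta> :: real
  defines "D \<equiv> card (transversals w w (Suc q))"
  assumes q: "Suc q < CARD('p::prime_card)" and p: "3 \<le> CARD('p)" and t: "1 \<le> t"
    and wn: "w * w \<le> n" and s: "1 \<le> s" "s \<le> w"
    and \<eta>: "0 < \<eta>" "\<eta> \<le> 1 / 10" "4 * 2 ^ Suc q \<le> \<eta> * real CARD('p) ^ s"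
    and \<epsilon>: "0 < \<epsilon>" "\<epsilon> \<le> 1"
    and b: "real (4 * Suc q * s * (w * w) ^ Suc q) \<le> \<epsilon> / 4 * real D * real w"
    and D: "20 * real t * real CARD('p) ^ (2 * t) \<le> real CARD('p) powr (\<epsilon> / 2 * real D)"
    and m: "real m * ln (1 / (1 - 1 / real CARD('p) ^ t)) \<le> real t * ((1 - \<epsilon>) * real D * ln (real CARD('p)))"
      "2 * m \<le> CARD('p) ^ n" "real m * (3 * \<eta> + 3 * real m / real CARD('p) ^ n) \<le> 1 / 20"
      "7 * \<eta> * real m \<le> 1 / 20"
    and \<alpha>: "\<eta> \<le> 1 / real CARD('p) ^ t - \<alpha>"
  shows "szemeredi_prob TYPE('p) n (Suc (Suc q)) \<alpha> m < 1 / 2"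
proof -
  let ?p = "real CARD('p)" and ?E = "transversals w w (Suc q)"
    and ?X = "carrier_vec n :: 'p mod_ring Matrix.vec set"
  \<comment> \<open>The bias parameter doubles with each degree of the induction, from \<open>\<theta>\<close> up to \<open>\<eta>\<close>.\<close>
  define \<theta> where "\<theta> = \<eta> / 2 ^ Suc q"
  have w: "1 \<le> w" using s by simp
  have \<theta>: "0 < \<theta>" "4 \<le> \<theta> * ?p ^ s"
    using \<eta> by (simp_all add: \<theta>_def field_simps)
  obtain b' where b': "w * b' \<le> 4 * Suc q * s * (w * w) ^ Suc q"
    and few: "few_biased TYPE('p) {..<w * w} ?E (2 ^ Suc q * \<theta>) (?p ^ b')"
    using few_biased_transversals[OF w s \<theta>, of q] by blast
  have \<theta>\<eta>: "2 ^ Suc q * \<theta> = \<eta>" by (simp add: \<theta>_def)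
  have bD: "real b' \<le> \<epsilon> / 4 * real D"
  proof -
    have "real w * real b' \<le> real (4 * Suc q * s * (w * w) ^ Suc q)"
      using b' by (simp only: of_nat_mult[symmetric] of_nat_le_iff)
    also have "\<dots> \<le> real w * (\<epsilon> / 4 * real D)" using b by (simp only: mult.commute)
    finally show ?thesis by (rule mult_left_le_imp_le) (use w in simp)
  qed
  have X_ne: "?X \<noteq> {}" by (metis zero_carrier_vec empty_iff)
  interpret poly_system ?X ?E "vec_prod :: nat set \<Rightarrow> 'p mod_ring Matrix.vec \<Rightarrow> 'p mod_ring" t \<eta>
    by unfold_locales
      (use finite_carrier_vec finite_transversals t \<eta>(1,2) p X_ne in auto)
  have cX: "real (card ?X) = ?p ^ n" by (simp add: card_carrier_vec)
  have \<beta>: "real (card biased) \<le> ?p powr (\<epsilon> / 4 * real D)"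
  proof -
    have "real (card biased) \<le> ?p ^ b'"
      unfolding biased_def cX
      by (rule card_biased_carrier_vec[OF few[unfolded \<theta>\<eta>] wn transversals_subset])
    also have "\<dots> = ?p powr real b'" using p by (simp add: powr_realpow)
    also have "\<dots> \<le> ?p powr (\<epsilon> / 4 * real D)" using bD p by (intro powr_mono) simp_all
    finally show ?thesis .
  qed
  have p1: "1 < ?p" using p by simp
  have K: "?p ^ (2 * t) * (real t * 20) \<le> ?p powr (\<epsilon> / 2 * real D)" using D by (simp add: mult_ac)
  have pD: "?p ^ D = ?p powr real D" using p1 by (simp add: powr_realpow)
  have h1: "?p ^ t * real (card biased) ^ 2 / ?p ^ card ?E \<le> 1 / 20"
  proof -
    have "real (card biased) ^ 2 \<le> (?p powr (\<epsilon> / 4 * real D)) ^ 2" by (rule power_mono[OF \<beta>]) simp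
    also have "\<dots> = ?p powr (\<epsilon> / 2 * real D)"
      by (simp add: power2_eq_square powr_add[symmetric])
    finally have 1: "real (card biased) ^ 2 \<le> ?p powr (\<epsilon> / 2 * real D)" .
    have 2: "20 * ?p ^ t \<le> ?p powr (\<epsilon> / 2 * real D)"
    proof -
      have "?p ^ t * (1 * 20) \<le> ?p ^ (2 * t) * (real t * 20)"
        using t p1 by (intro mult_mono power_increasing) simp_all
      then show ?thesis using K by simp
    qed
    have "(20 * ?p ^ t) * real (card biased) ^ 2 \<le> ?p powr (\<epsilon> / 2 * real D) * ?p powr (\<epsilon> / 2 * real D)"
      by (rule mult_mono[OF 2 1]) simp_all
    also have "\<dots> = ?p powr (\<epsilon> * real D)" by (simp add: powr_add[symmetric])
    also have "\<dots> \<le> ?p powr real D"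
      using p1 \<epsilon> by (intro powr_mono) (simp_all add: mult_left_le_one_le)
    finally show ?thesis unfolding D_def[symmetric] pD using p1 by (simp add: divide_le_eq)
  qed
  define Y where "Y = (1 - \<epsilon>) * real D * ln ?p"
  have h4: "real t * (?p ^ (2 * t) * real (card biased) * exp Y / ?p ^ card ?E) \<le> 1 / 20"
  proof -
    have Y: "exp Y = ?p powr ((1 - \<epsilon>) * real D)" using p1 by (simp add: Y_def powr_def)
    have "(?p ^ (2 * t) * (real t * 20)) * (real (card biased) * exp Y)
        \<le> ?p powr (\<epsilon> / 2 * real D) * (?p powr (\<epsilon> / 4 * real D) * ?p powr ((1 - \<epsilon>) * real D))"
      unfolding Y by (intro mult_mono K \<beta> order_refl) simp_all
    also have "\<dots> = ?p powr (\<epsilon> / 2 * real D + (\<epsilon> / 4 * real D + (1 - \<epsilon>) * real D))"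
      by (simp only: powr_add)
    also have "\<dots> \<le> ?p powr real D"
    proof (rule powr_mono)
      have "\<epsilon> / 2 * real D + (\<epsilon> / 4 * real D + (1 - \<epsilon>) * real D) = real D - \<epsilon> / 4 * real D"
        by (simp add: algebra_simps)
      then show "\<epsilon> / 2 * real D + (\<epsilon> / 4 * real D + (1 - \<epsilon>) * real D) \<le> real D" using \<epsilon> by simp
    qed (use p1 in simp)
    finally show ?thesis unfolding D_def[symmetric] pD using p1 by (simp add: divide_le_eq mult_ac)
  qed
  define Hit where "Hit = {M. M \<subseteq> ?X \<and> card M = m \<and> (\<exists>Q\<in>good. M \<inter> zeros Q = {})}"
  have many: "real (CARD('p) ^ n choose m) < 2 * real (card Hit)"
    unfolding Hit_def card_carrier_vec[symmetric]
    by (rule good_tuple_avoids[OF _ m(1)[folded Y_def] h1 _ m(4) h4]) (use m in \<open>simp_all add: card_carrier_vec\<close>)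
  show ?thesis
  proof (rule szemeredi_prob_lt_half[OF _ _ many])
    show "Hit \<subseteq> {M. M \<subseteq> ?X \<and> card M = m}" by (auto simp: Hit_def)
  next
    fix M assume "M \<in> Hit"
    then obtain Q where M: "M \<subseteq> ?X" and Q: "Q \<in> good" and disj: "M \<inter> zeros Q = {}"
      by (auto simp: Hit_def)
    show "\<not> szemeredi_holds n (Suc (Suc q)) \<alpha> M"
    proof
      assume hold: "szemeredi_holds n (Suc (Suc q)) \<alpha> M"
      have "\<alpha> * ?p ^ n \<le> (1 / ?p ^ t - \<eta>) * ?p ^ n" using \<alpha> by (intro mult_right_mono) simp_all
      also have "\<dots> \<le> real (card (zeros Q))"
        using card_zeros[OF Q] unfolding cX abs_le_iff left_diff_distrib by linarith
      finally have "\<alpha> * real (CARD('p) ^ n) \<le> real (card (zeros Q))" by simp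
      then obtain x d where x: "x \<in> ?X" "d \<in> M" and AP: "\<forall>j<Suc (Suc q). x + of_nat j \<cdot>\<^sub>v d \<in> zeros Q"
        using hold zeros_subset unfolding szemeredi_holds_def by blast
      have d: "d \<in> ?X" using x M by blast
      have "pev vec_prod ?E (\<lambda>e. Q (i, e)) d = 0" if i: "i < t" for i
      proof (rule pev_difference_eq_0[OF _ q x(1) d])
        fix e assume e: "e \<in> ?E"
        have "e \<subseteq> {..<w * w}" using e transversals_subset by blast
        then show "card e = Suc q \<and> e \<subseteq> {..<n}" using card_in_transversals[OF e] wn by auto
      next
        fix j assume "j \<le> Suc q"
        then show "pev vec_prod ?E (\<lambda>e. Q (i, e)) (x + of_nat j \<cdot>\<^sub>v d) = 0"
          using AP i by (simp add: zeros_def less_Suc_eq_le)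
      qed
      then have "d \<in> zeros Q" using d by (simp add: zeros_def)
      then show False using x(2) disj by blast
    qed
  qed
qed

section \<open>Asymptotics of the number of transversal monomials\<close>

lemma filterlim_floor_sqrt: "filterlim floor_sqrt at_top sequentially"
  unfolding filterlim_at_top
proof
  fix k :: nat
  show "\<forall>\<^sub>F n in sequentially. k \<le> floor_sqrt n"
    using eventually_ge_at_top[of "k\<^sup>2"] by eventually_elim (simp add: le_floor_sqrt_iff)
qed

lemma tendsto_binomial_ratio: "(\<lambda>n. real (n choose q) * fact q / real n ^ q) \<longlonglongrightarrow> 1"
proof -
  have "(\<lambda>n. \<Prod>i = 0..<q. 1 - real i / real n) \<longlonglongrightarrow> (\<Prod>i = 0..<q. 1 - 0)"
    by (intro tendsto_prod tendsto_diff tendsto_const lim_const_over_n)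
  moreover have "\<forall>\<^sub>F n in sequentially. (\<Prod>i = 0..<q. 1 - real i / real n) = real (n choose q) * fact q / real n ^ q"
    using eventually_gt_at_top[of 0]
  proof eventually_elim
    case (elim n)
    have "real (n choose q) * fact q = (\<Prod>i = 0..<q. real n - real i)"
      by (simp add: binomial_gbinomial gbinomial_prod_rev)
    moreover have "(\<Prod>i = 0..<q. 1 - real i / real n) = (\<Prod>i = 0..<q. (real n - real i) / real n)"
      using elim by (intro prod.cong) (simp_all add: diff_divide_distrib)
    ultimately show ?case by (simp add: prod_dividef)
  qed
  ultimately show ?thesis by (simp add: filterlim_cong)
qed

lemma tendsto_floor_sqrt_ratio: "(\<lambda>n. real (floor_sqrt n) ^ 2 / real n) \<longlonglongrightarrow> 1"
proof (rule tendsto_sandwich)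
  show "(\<lambda>n. 1 - 2 / sqrt (real n) - 1 / real n) \<longlonglongrightarrow> 1"
  proof -
    have s: "filterlim (\<lambda>n. sqrt (real n)) at_top sequentially"
      by (rule filterlim_compose[OF sqrt_at_top filterlim_real_sequentially])
    have "(\<lambda>n. 1 - 2 / sqrt (real n) - 1 / real n) \<longlonglongrightarrow> 1 - 0 - 0"
      by (intro tendsto_diff tendsto_const lim_const_over_n
          tendsto_divide_0[OF tendsto_const filterlim_at_top_imp_at_infinity[OF s]])
    then show ?thesis by simp
  qed
  show "(\<lambda>n. 1 :: real) \<longlonglongrightarrow> 1" by (rule tendsto_const)
  show "\<forall>\<^sub>F n in sequentially. real (floor_sqrt n) ^ 2 / real n \<le> 1"
    using eventually_gt_at_top[of 0]
  proof eventually_elim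
    case (elim n)
    have "real ((floor_sqrt n)\<^sup>2) \<le> real n" by (simp only: of_nat_le_iff floor_sqrt_power2_le)
    then show ?case using elim by (simp add: divide_le_eq)
  qed
  show "\<forall>\<^sub>F n in sequentially. 1 - 2 / sqrt (real n) - 1 / real n \<le> real (floor_sqrt n) ^ 2 / real n"
    using eventually_gt_at_top[of 0]
  proof eventually_elim
    case (elim n)
    let ?w = "real (floor_sqrt n)"
    have "real ((floor_sqrt n)\<^sup>2) \<le> real n" by (simp only: of_nat_le_iff floor_sqrt_power2_le)
    then have w: "?w \<le> sqrt (real n)" by (intro real_le_rsqrt) simp
    have "real n \<le> real ((Suc (floor_sqrt n))\<^sup>2)"
      using Suc_floor_sqrt_power2_gt[of n] by (simp only: of_nat_le_iff less_imp_le)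
    also have "\<dots> = ?w ^ 2 + 2 * ?w + 1" by (simp add: power2_eq_square algebra_simps)
    finally have "real n - 2 * sqrt (real n) - 1 \<le> ?w ^ 2" using w by linarith
    then have "(real n - 2 * sqrt (real n) - 1) / real n \<le> ?w ^ 2 / real n" by (rule divide_right_mono) simp
    moreover have "(real n - 2 * sqrt (real n) - 1) / real n = 1 - 2 / sqrt (real n) - 1 / real n"
    proof -
      have "sqrt (real n) / real n = 1 / sqrt (real n)"
        using elim real_div_sqrt[of "real n"] by (simp add: field_simps)
      then have "2 * sqrt (real n) / real n = 2 / sqrt (real n)" by (simp only: times_divide_eq_right[symmetric] mult_1_right)
      then show ?thesis using elim by (simp add: diff_divide_distrib)
    qed
    ultimately show ?case by simp
  qed
qed

text \<open>
  The dimension of the space of polynomials that is used in dimension \<open>n\<close>.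
\<close>

definition transversal_count :: "nat \<Rightarrow> nat \<Rightarrow> nat" where
  "transversal_count q n = card (transversals (floor_sqrt n) (floor_sqrt n) q)"

text \<open>
  Almost all \<open>q\<close>-subsets of the variables are transversal when there are about \<open>sqrt n\<close> blocks, since the
  number of blocks tends to infinity while \<open>q\<close> stays fixed.
\<close>

lemma tendsto_transversal_count_power: "(\<lambda>n. real (transversal_count q n) * fact q / real n ^ q) \<longlonglongrightarrow> 1"
proof -
  let ?w = "\<lambda>n. floor_sqrt n"
  \<comment> \<open>The count is \<open>(w choose q) * w ^ q\<close> with \<open>w\<close> the integer square root of \<open>n\<close>, so both \<open>w choose q\<close> and \<open>w\<^sup>2\<close> have to be compared with powers.\<close>
  have 1: "(\<lambda>n. real (?w n choose q) * fact q / real (?w n) ^ q) \<longlonglongrightarrow> 1"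
    by (rule filterlim_compose[OF tendsto_binomial_ratio filterlim_floor_sqrt])
  have "(\<lambda>n. (real (?w n choose q) * fact q / real (?w n) ^ q) * (real (?w n) ^ 2 / real n) ^ q) \<longlonglongrightarrow> 1 * 1 ^ q"
    by (intro tendsto_mult 1 tendsto_power tendsto_floor_sqrt_ratio)
  moreover have "\<forall>\<^sub>F n in sequentially. (real (?w n choose q) * fact q / real (?w n) ^ q) * (real (?w n) ^ 2 / real n) ^ q
      = real (transversal_count q n) * fact q / real n ^ q"
    using eventually_gt_at_top[of 0]
  proof eventually_elim
    case (elim n)
    have w: "real (?w n) ^ q \<noteq> 0" using elim floor_sqrt_greater_zero_iff[of n] by simp
    have "(real (?w n) ^ 2) ^ q = real (?w n) ^ q * real (?w n) ^ q"
      by (simp add: power2_eq_square power_mult_distrib)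
    then show ?case using w by (simp add: transversal_count_def card_transversals power_divide)
  qed
  ultimately show ?thesis by (simp add: filterlim_cong)
qed

lemma tendsto_transversal_count_binomial: "(\<lambda>n. real (transversal_count q n) / real (n choose q)) \<longlonglongrightarrow> 1"
proof -
  have "(\<lambda>n. (real (transversal_count q n) * fact q / real n ^ q) / (real (n choose q) * fact q / real n ^ q)) \<longlonglongrightarrow> 1 / 1"
    by (intro tendsto_divide tendsto_transversal_count_power tendsto_binomial_ratio) simp
  moreover have "\<forall>\<^sub>F n in sequentially. (real (transversal_count q n) * fact q / real n ^ q) / (real (n choose q) * fact q / real n ^ q)
      = real (transversal_count q n) / real (n choose q)"
    using eventually_gt_at_top[of 0]
  proof eventually_elim
    case (elim n)
    then have "fact q / real n ^ q \<noteq> 0" by simp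
    then have "real (transversal_count q n) * (fact q / real n ^ q) / (real (n choose q) * (fact q / real n ^ q))
        = real (transversal_count q n) / real (n choose q)"
      by (rule nonzero_mult_divide_mult_cancel_right)
    then show ?case by (simp only: times_divide_eq_right)
  qed
  ultimately show ?thesis by (simp add: filterlim_cong)
qed

section \<open>The lower bound for the threshold\<close>

text \<open>
  With the bias parameter \<open>\<eta> = w ^ (- 2 q - 3)\<close> the error terms \<open>\<eta> * m\<close> vanish, as \<open>m\<close> is at most a
  constant times \<open>w ^ (2 q + 2)\<close>. The matching \<open>s\<close> is of order \<open>ln w\<close>, which is small compared with \<open>w\<close>,
  and this makes the number of biased polynomials negligible.
\<close>

lemma eventually_szemeredi_prob_lt_half:
  fixes q t :: nat and \<alpha> \<epsilon> :: real
  defines "c \<equiv> ln (real CARD('p::prime_card) ^ t) / ln (1 + 1 / (real CARD('p) ^ t - 1))"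
  assumes q: "Suc q < CARD('p)" and p: "3 \<le> CARD('p)" and t: "1 \<le> t"
    and \<alpha>: "\<alpha> < 1 / real CARD('p) ^ t" and \<epsilon>: "0 < \<epsilon>" "\<epsilon> \<le> 1"
  shows "\<forall>\<^sub>F w in sequentially. \<forall>n m. w * w \<le> n \<longrightarrow>
    real m \<le> (1 - \<epsilon>) * (c * real (card (transversals w w (Suc q)))) \<longrightarrow>
    szemeredi_prob TYPE('p) n (Suc (Suc q)) \<alpha> m < 1 / 2"
proof -
  let ?p = "real CARD('p)"
  let ?s = "\<lambda>w. nat \<lceil>log ?p (4 * 2 ^ Suc q * real w ^ (2 * q + 3))\<rceil>"
  let ?l = "\<lambda>w. log ?p (4 * 2 ^ Suc q) + 1 + real (2 * q + 3) * log ?p (real w)"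
  define \<delta> where "\<delta> = \<epsilon> / (16 * real (Suc q) ^ (q + 2))"
  have p1: "1 < ?p" using p by simp
  have pt: "3 \<le> ?p ^ t"
    using order_trans[OF _ power_increasing[of 1 t ?p]] t p by simp
  have \<delta>: "0 < \<delta>" using \<epsilon> by (simp add: \<delta>_def)
  have lnp: "0 < ln (1 + 1 / (?p ^ t - 1))" using pt by (intro ln_gt_zero) simp
  have c0: "0 < c"
  proof -
    have "0 < ln (?p ^ t)" using pt by (intro ln_gt_zero) simp
    then show ?thesis unfolding c_def using lnp by (rule divide_pos_pos)
  qed
  have inv: "1 / (1 - 1 / ?p ^ t) = 1 + 1 / (?p ^ t - 1)" using pt by (simp add: field_simps)
  have "(\<lambda>w. (log ?p (4 * 2 ^ Suc q) + 1) / real w + real (2 * q + 3) * (log ?p (real w) / real w)) \<longlonglongrightarrow> 0 + real (2 * q + 3) * 0"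
    by (intro tendsto_add tendsto_mult tendsto_const lim_const_over_n lim_log_over_n)
  then have "\<forall>\<^sub>F w in sequentially. (log ?p (4 * 2 ^ Suc q) + 1) / real w + real (2 * q + 3) * (log ?p (real w) / real w) < \<delta>"
    using \<delta> by (intro order_tendstoD(2)) simp_all
  moreover have "\<forall>\<^sub>F w in sequentially. real w ^ (4 * q + 5) / exp (real w) < 1"
    by (rule order_tendstoD(2)[OF filterlim_compose[OF tendsto_power_div_exp_0 filterlim_real_sequentially]]) simp
  moreover have "\<forall>\<^sub>F w in sequentially. K \<le> real w" for K :: real
    using filterlim_real_sequentially by (simp add: filterlim_at_top)
  note this[of 10] this[of "real (Suc q)"] this[of "140 * c"] this[of "60 * (c + c ^ 2)"] this[of "2 * c"]
    this[of "1 / (1 / ?p ^ t - \<alpha>)"] this[of "2 / \<epsilon> * log ?p (20 * real t * ?p ^ (2 * t))"]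
  ultimately show ?thesis
  proof eventually_elim
    case (elim w)
    define D where "D = card (transversals w w (Suc q))"
    define s where "s = ?s w"
    define \<eta> where "\<eta> = 1 / real w ^ (2 * q + 3)"
    note big = elim(3-9)
    have w0: "1 \<le> real w" using big(1) by simp
    have w00: "0 < real w" using w0 by simp
    have wpow: "real w \<le> real w ^ i" if "1 \<le> i" for i
      using self_le_power[of "real w" i] w0 that by simp
    have log_pos: "0 < log ?p (4 * 2 ^ Suc q * real w ^ (2 * q + 3))"
    proof -
      have "(4::real) * 1 \<le> 4 * 2 ^ Suc q" by (rule mult_left_mono[OF one_le_power]) simp_all
      then have "(4::real) * 1 * 1 \<le> 4 * 2 ^ Suc q * real w ^ (2 * q + 3)"
        by (intro mult_mono[OF _ one_le_power[OF w0]]) simp_all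
      then have "1 < 4 * 2 ^ Suc q * real w ^ (2 * q + 3)" by linarith
      then show ?thesis using p1 by (simp only: zero_less_log_cancel_iff[OF p1] order_less_trans[OF zero_less_one])
    qed
    have sl: "real s \<le> ?l w"
    proof -
      have "real s \<le> log ?p (4 * 2 ^ Suc q * real w ^ (2 * q + 3)) + 1"
        using log_pos unfolding s_def by linarith
      also have "\<dots> = ?l w"
        using w00 p1 by (simp add: log_mult log_nat_power del: power_Suc)
      finally show ?thesis .
    qed
    have s1: "1 \<le> s"
      using log_pos unfolding s_def by linarith
    have s\<delta>: "real s \<le> \<delta> * real w"
    proof -
      have "?l w / real w < \<delta>" using elim(1) by (simp add: add_divide_distrib)
      then have "?l w < \<delta> * real w" using w00 by (simp add: divide_less_eq)
      then show ?thesis using sl by linarith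
    qed
    have \<delta>1: "\<delta> \<le> 1"
    proof -
      have "1 * 1 \<le> 16 * real (Suc q) ^ (q + 2)" by (intro mult_mono one_le_power) simp_all
      then have "\<epsilon> \<le> 16 * real (Suc q) ^ (q + 2)" using \<epsilon> by linarith
      then show ?thesis by (simp add: \<delta>_def divide_le_eq)
    qed
    have sw: "s \<le> w"
    proof -
      have "\<delta> * real w \<le> 1 * real w" by (rule mult_right_mono[OF \<delta>1]) simp
      then show ?thesis using s\<delta> by linarith
    qed
    have \<eta>0: "0 < \<eta>" using w00 by (simp add: \<eta>_def)
    have \<eta>w: "\<eta> \<le> 1 / real w"
      unfolding \<eta>_def using wpow[of "2 * q + 3"] w00 by (intro divide_left_mono) simp_all
    have \<eta>10: "\<eta> \<le> 1 / 10"
    proof -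
      have "1 / real w \<le> 1 / 10" using big(1) by (intro divide_left_mono) simp_all
      then show ?thesis using \<eta>w by linarith
    qed
    have \<eta>s: "4 * 2 ^ Suc q \<le> \<eta> * ?p ^ s"
    proof -
      have "4 * 2 ^ Suc q * real w ^ (2 * q + 3) = ?p powr log ?p (4 * 2 ^ Suc q * real w ^ (2 * q + 3))"
        using p1 w00 by simp
      also have "\<dots> \<le> ?p powr real s" using p1 unfolding s_def by (intro powr_mono) linarith+
      also have "\<dots> = ?p ^ s" using p1 by (simp add: powr_realpow)
      finally show ?thesis using w00 by (simp add: \<eta>_def le_divide_eq del: power_Suc)
    qed
    have Dlow: "real w ^ (2 * Suc q) / real (Suc q) ^ Suc q \<le> real D"
    proof -
      have "(real w / real (Suc q)) ^ Suc q \<le> real w gchoose Suc q"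
        by (rule gbinomial_ge_n_over_k_pow_k) (use big(2) in simp)
      then have "(real w / real (Suc q)) ^ Suc q * real w ^ Suc q \<le> real (w choose Suc q) * real w ^ Suc q"
        unfolding binomial_gbinomial by (rule mult_right_mono) simp
      moreover have "(real w / real (Suc q)) ^ Suc q * real w ^ Suc q = real w ^ (2 * Suc q) / real (Suc q) ^ Suc q"
        by (simp only: power_divide mult_2 power_add times_divide_eq_left)
      ultimately show ?thesis by (simp add: D_def card_transversals)
    qed
    have Dup: "real D \<le> real w ^ (2 * Suc q)"
    proof -
      have "real D \<le> real (w ^ Suc q * w ^ Suc q)"
        unfolding D_def card_transversals of_nat_le_iff by (intro mult_right_mono binomial_le_power) simp
      then show ?thesis by (simp only: mult_2 power_add of_nat_mult of_nat_power)
    qed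
    have Dw: "real w \<le> real D"
    proof -
      have "0 < w choose Suc q" using big(2) by (intro zero_less_binomial) simp
      then have "1 \<le> w choose Suc q" by linarith
      moreover have "w \<le> w ^ Suc q" using w0 by (intro self_le_power) simp_all
      ultimately have "1 * w \<le> (w choose Suc q) * w ^ Suc q" by (rule mult_mono) simp_all
      then show ?thesis unfolding D_def card_transversals of_nat_le_iff by simp
    qed
    have b: "real (4 * Suc q * s * (w * w) ^ Suc q) \<le> \<epsilon> / 4 * real D * real w"
    proof -
      define W where "W = real w ^ (2 * Suc q)"
      have W0: "0 \<le> W" by (simp add: W_def)
      have "real (4 * Suc q * s * (w * w) ^ Suc q) = 4 * real (Suc q) * real s * W"
        unfolding W_def by (simp only: of_nat_mult of_nat_power of_nat_numeral power_mult power2_eq_square)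
      also have "\<dots> \<le> 4 * real (Suc q) * (\<delta> * real w) * W"
        by (intro mult_right_mono mult_left_mono s\<delta> W0) simp
      also have "\<dots> = \<epsilon> / 4 * (W / real (Suc q) ^ Suc q) * real w"
      proof -
        have pw: "real (Suc q) ^ (q + 2) = real (Suc q) * real (Suc q) ^ Suc q" by simp
        show ?thesis unfolding \<delta>_def pw by (simp add: field_simps del: power_Suc of_nat_Suc)
      qed
      also have "\<dots> \<le> \<epsilon> / 4 * real D * real w"
        using Dlow \<epsilon> unfolding W_def by (intro mult_right_mono mult_left_mono) simp_all
      finally show ?thesis .
    qed
    have Dp: "20 * real t * ?p ^ (2 * t) \<le> ?p powr (\<epsilon> / 2 * real D)"
    proof -
      have pos: "0 < 20 * real t * ?p ^ (2 * t)" using t p1 by simp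
      have "log ?p (20 * real t * ?p ^ (2 * t)) \<le> \<epsilon> / 2 * real w"
        using big(7) \<epsilon> by (simp add: field_simps)
      also have "\<dots> \<le> \<epsilon> / 2 * real D" using Dw \<epsilon> by (intro mult_left_mono) simp_all
      finally have "?p powr log ?p (20 * real t * ?p ^ (2 * t)) \<le> ?p powr (\<epsilon> / 2 * real D)"
        using p1 by (intro powr_mono) simp_all
      then show ?thesis using pos p1 by simp
    qed
    have \<eta>\<alpha>: "\<eta> \<le> 1 / ?p ^ t - \<alpha>"
    proof -
      have "0 < 1 / ?p ^ t - \<alpha>" using \<alpha> by simp
      then have "1 / real w \<le> 1 / ?p ^ t - \<alpha>" using big(6) w00 by (simp add: field_simps)
      then show ?thesis using \<eta>w by linarith
    qed
    show ?case
    proof (intro allI impI)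
      fix n m assume wn: "w * w \<le> n" and "real m \<le> (1 - \<epsilon>) * (c * real (card (transversals w w (Suc q))))"
      then have m: "real m \<le> (1 - \<epsilon>) * (c * real D)" by (simp only: D_def)
      have "(1 - \<epsilon>) * (c * real D) \<le> 1 * (c * real D)" using \<epsilon> c0 by (intro mult_right_mono) simp_all
      then have "real m \<le> c * real D" using m by linarith
      also have "\<dots> \<le> c * real w ^ (2 * Suc q)" by (rule mult_left_mono[OF Dup]) (use c0 in simp)
      finally have mw: "real m \<le> c * real w ^ (2 * Suc q)" .
      \<comment> \<open>The exponent makes \<open>m\<^sup>2 / p ^ n\<close> at most \<open>c\<^sup>2 / w\<close>.\<close>
      have N: "real w ^ (4 * q + 5) \<le> ?p ^ n"
      proof -
        have "real w ^ (4 * q + 5) \<le> exp (real w)" using elim(2) by (simp add: divide_less_eq)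
        also have "\<dots> \<le> exp (real n)"
        proof -
          have "w \<le> w * w" by (cases w) simp_all
          then have "w \<le> n" using wn by (rule order_trans)
          then show ?thesis by simp
        qed
        also have "\<dots> = exp 1 ^ n" by (simp flip: exp_of_nat_mult)
        also have "\<dots> \<le> ?p ^ n"
          by (rule power_mono) (use exp_le p in simp_all)
        finally show ?thesis .
      qed
      have \<eta>m: "\<eta> * real m \<le> c / real w"
      proof -
        have "\<eta> * real m \<le> \<eta> * (c * real w ^ (2 * Suc q))" by (rule mult_left_mono[OF mw]) (use \<eta>0 in simp)
        also have "\<dots> = c / real w"
        proof -
          have "real w ^ (2 * q + 3) = real w ^ (2 * Suc q) * real w" by (simp add: numeral_3_eq_3)
          then show ?thesis using w00 unfolding \<eta>_def by (simp del: power_Suc)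
        qed
        finally show ?thesis .
      qed
      have mN: "real m * (real m / ?p ^ n) \<le> c\<^sup>2 / real w"
      proof -
        have "real m * (real m / ?p ^ n) = real m * real m / ?p ^ n" by simp
        also have "\<dots> \<le> (c * real w ^ (2 * Suc q)) * (c * real w ^ (2 * Suc q)) / real w ^ (4 * q + 5)"
          using mw N w00 c0 by (intro frac_le mult_mono) simp_all
        also have "\<dots> = c\<^sup>2 / real w"
        proof -
          have "4 * q + 5 = 2 * Suc q + 2 * Suc q + 1" by simp
          then have "real w ^ (4 * q + 5) = real w ^ (2 * Suc q) * real w ^ (2 * Suc q) * real w"
            by (simp only: power_add power_one_right)
          then show ?thesis using w00 by (simp add: power2_eq_square del: power_Suc mult_Suc_right)
        qed
        finally show ?thesis .
      qed
      show "szemeredi_prob TYPE('p) n (Suc (Suc q)) \<alpha> m < 1 / 2"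
      proof (rule szemeredi_prob_lt_half_of_small[OF q p t wn s1 sw \<eta>0 \<eta>10 \<eta>s \<epsilon> b[unfolded D_def] Dp[unfolded D_def] _ _ _ _ \<eta>\<alpha>])
        have "real m * ln (1 + 1 / (?p ^ t - 1)) \<le> (1 - \<epsilon>) * (c * real D) * ln (1 + 1 / (?p ^ t - 1))"
          by (rule mult_right_mono[OF m]) (use lnp in simp)
        also have "\<dots> = (1 - \<epsilon>) * real D * (c * ln (1 + 1 / (?p ^ t - 1)))" by (simp only: mult_ac)
        also have "c * ln (1 + 1 / (?p ^ t - 1)) = real t * ln ?p"
          using lnp p1 by (simp add: c_def ln_realpow)
        also have "(1 - \<epsilon>) * real D * (real t * ln ?p) = real t * ((1 - \<epsilon>) * real D * ln ?p)" by (simp only: mult_ac)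
        finally show "real m * ln (1 / (1 - 1 / ?p ^ t)) \<le> real t * ((1 - \<epsilon>) * real (card (transversals w w (Suc q))) * ln ?p)"
          unfolding inv D_def .
      next
        have "real (2 * m) \<le> 2 * c * real w ^ (2 * Suc q)" using mw by simp
        also have "\<dots> \<le> real w * real w ^ (2 * Suc q)" by (rule mult_right_mono[OF big(5)]) simp
        also have "\<dots> = real w ^ (2 * Suc q + 1)" by simp
        also have "\<dots> \<le> real w ^ (4 * q + 5)" by (rule power_increasing[OF _ w0]) simp
        also have "\<dots> \<le> real (CARD('p) ^ n)" using N by simp
        finally show "2 * m \<le> CARD('p) ^ n" by (simp only: of_nat_le_iff)
      next
        have "real m * (3 * \<eta> + 3 * real m / ?p ^ n) = 3 * (\<eta> * real m) + 3 * (real m * (real m / ?p ^ n))"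
          by (simp add: algebra_simps)
        also have "\<dots> \<le> 3 * (c / real w) + 3 * (c\<^sup>2 / real w)" using \<eta>m mN by linarith
        also have "\<dots> = 3 * (c + c\<^sup>2) / real w" by (simp add: add_divide_distrib)
        also have "\<dots> \<le> 1 / 20" using big(4) w00 by (simp add: divide_le_eq)
        finally show "real m * (3 * \<eta> + 3 * real m / ?p ^ n) \<le> 1 / 20" .
      next
        have "7 * (c / real w) \<le> 1 / 20" using big(3) w00 by (simp add: divide_le_eq)
        then show "7 * \<eta> * real m \<le> 1 / 20" using \<eta>m by (simp add: mult.assoc)
      qed
    qed
  qed
qed

definition threshold_constant :: "nat \<Rightarrow> nat \<Rightarrow> real" where
  "threshold_constant p t = ln (real p ^ t) / ln (1 + 1 / (real p ^ t - 1))"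

lemma eventually_threshold_ge:
  fixes q t :: nat and \<alpha> \<epsilon> :: real
  assumes q: "Suc q < CARD('p::prime_card)" and p: "3 \<le> CARD('p)" and t: "1 \<le> t"
    and \<alpha>: "\<alpha> < 1 / real CARD('p) ^ t" and \<epsilon>: "0 < \<epsilon>" "\<epsilon> \<le> 1"
  shows "\<forall>\<^sub>F n in sequentially.
    ereal ((1 - \<epsilon>) * (threshold_constant CARD('p) t * real (transversal_count (Suc q) n)))
      \<le> szemeredi_threshold TYPE('p) n \<alpha> (Suc (Suc q)) * ereal (real CARD('p) ^ n)"
proof -
  let ?L = "\<lambda>n. (1 - \<epsilon>) * (threshold_constant CARD('p) t * real (transversal_count (Suc q) n))"
  from eventually_compose_filterlim[OF eventually_szemeredi_prob_lt_half[OF q p t \<alpha> \<epsilon>] filterlim_floor_sqrt]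
  have "\<forall>\<^sub>F n in sequentially. \<forall>n' m. floor_sqrt n * floor_sqrt n \<le> n' \<longrightarrow> real m \<le> ?L n \<longrightarrow>
      szemeredi_prob TYPE('p) n' (Suc (Suc q)) \<alpha> m < 1 / 2"
    unfolding threshold_constant_def transversal_count_def by blast
  then show ?thesis
  proof eventually_elim
    case (elim n)
    let ?N = "real CARD('p) ^ n"
    have N: "0 < ?N" by simp
    have lt: "?L n < real m" if "szemeredi_prob TYPE('p) n (Suc (Suc q)) \<alpha> m \<ge> 1 / 2" for m
    proof (rule ccontr)
      assume "\<not> ?L n < real m"
      moreover have "floor_sqrt n * floor_sqrt n \<le> n"
        using floor_sqrt_power2_le[of n] by (simp only: power2_eq_square)
      ultimately have "szemeredi_prob TYPE('p) n (Suc (Suc q)) \<alpha> m < 1 / 2" using elim by simp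
      then show False using that by simp
    qed
    have "ereal (?L n / ?N) \<le> szemeredi_threshold TYPE('p) n \<alpha> (Suc (Suc q))"
      unfolding szemeredi_threshold_def
    proof (rule Inf_greatest, clarify)
      fix m assume "1 / 2 \<le> szemeredi_prob TYPE('p) n (Suc (Suc q)) \<alpha> m"
      from lt[OF this] have "?L n / ?N \<le> real m / ?N" by (intro divide_right_mono) simp_all
      then show "ereal (?L n / ?N) \<le> ereal (real m / real (CARD('p) ^ n))" by simp
    qed
    then have "ereal (?L n / ?N) * ereal ?N \<le> szemeredi_threshold TYPE('p) n \<alpha> (Suc (Suc q)) * ereal ?N"
      by (rule ereal_mult_right_mono) simp
    moreover have "ereal (?L n / ?N) * ereal ?N = ereal (?L n)" using N by simp
    ultimately show ?case by simp
  qed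
qed

lemma szemeredi_threshold_nonneg: "0 \<le> szemeredi_threshold TYPE('p::prime_card) n \<alpha> k"
  unfolding szemeredi_threshold_def by (rule Inf_greatest) auto

lemma eventually_ge_of_ratio:
  fixes f :: "nat \<Rightarrow> ereal" and D g :: "nat \<Rightarrow> real"
  assumes lower: "\<And>\<epsilon>. 0 < \<epsilon> \<Longrightarrow> \<epsilon> \<le> 1 \<Longrightarrow> \<forall>\<^sub>F n in sequentially. ereal ((1 - \<epsilon>) * D n) \<le> f n"
    and g: "\<forall>\<^sub>F n in sequentially. 0 < g n" and ratio: "(\<lambda>n. D n / g n) \<longlonglongrightarrow> 1"
    and \<epsilon>: "0 < \<epsilon>" "\<epsilon> \<le> 1"
  shows "\<forall>\<^sub>F n in sequentially. ereal ((1 - \<epsilon>) * g n) \<le> f n"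
proof -
  have "\<forall>\<^sub>F n in sequentially. 1 - \<epsilon> / 2 < D n / g n"
    by (rule order_tendstoD(1)[OF ratio]) (use \<epsilon> in simp)
  moreover have "\<forall>\<^sub>F n in sequentially. ereal ((1 - \<epsilon> / 2) * D n) \<le> f n"
    by (rule lower) (use \<epsilon> in simp_all)
  ultimately show ?thesis using g
  proof eventually_elim
    case (elim n)
    have "(1 - \<epsilon>) * g n \<le> ((1 - \<epsilon> / 2) * (1 - \<epsilon> / 2)) * g n"
      using elim(3) by (intro mult_right_mono) (simp_all add: algebra_simps)
    also have "\<dots> = (1 - \<epsilon> / 2) * ((1 - \<epsilon> / 2) * g n)" by (simp only: mult.assoc)
    also have "\<dots> \<le> (1 - \<epsilon> / 2) * D n"
    proof (rule mult_left_mono)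
      show "(1 - \<epsilon> / 2) * g n \<le> D n" using elim(1,3) by (simp add: less_divide_eq)
    qed (use \<epsilon> in simp)
    finally show ?case using elim(2) by (meson ereal_less_eq(3) order_trans)
  qed
qed

text \<open>
  The error sequence is the exact
  relative deficit of \<open>f\<close> below \<open>g\<close>, or \<open>0\<close> if there is none; in the first case \<open>f\<close> is finite.
\<close>

lemma error_term_exists:
  fixes f :: "nat \<Rightarrow> ereal" and g :: "nat \<Rightarrow> real"
  assumes f: "\<And>n. 0 \<le> f n" and g: "\<forall>\<^sub>F n in sequentially. 0 < g n"
    and lower: "\<And>\<epsilon>. 0 < \<epsilon> \<Longrightarrow> \<epsilon> \<le> 1 \<Longrightarrow> \<forall>\<^sub>F n in sequentially. ereal ((1 - \<epsilon>) * g n) \<le> f n"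
  shows "\<exists>e. e \<longlonglongrightarrow> 0 \<and> (\<forall>\<^sub>F n in sequentially. ereal ((1 - e n) * g n) \<le> f n)"
proof -
  define e where "e n = (if ereal (g n) \<le> f n then 0 else 1 - real_of_ereal (f n) / g n)" for n
  have fin: "ereal (real_of_ereal (f n)) = f n" if "\<not> ereal (g n) \<le> f n" for n
  proof (rule ereal_real')
    show "\<bar>f n\<bar> \<noteq> \<infinity>" using f[of n] that by (cases "f n") auto
  qed
  have "\<forall>\<^sub>F n in sequentially. \<bar>e n\<bar> < r" if r: "0 < r" for r
  proof -
    define \<epsilon> where "\<epsilon> = min (r / 2) 1"
    have \<epsilon>: "0 < \<epsilon>" "\<epsilon> \<le> 1" "\<epsilon> < r" using r by (simp_all add: \<epsilon>_def min_def)
    from lower[OF \<epsilon>(1,2)] g show ?thesis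
    proof eventually_elim
      case (elim n)
      show ?case
      proof (cases "ereal (g n) \<le> f n")
        case False
        have "ereal ((1 - \<epsilon>) * g n) \<le> ereal (real_of_ereal (f n))" using elim(1) by (simp only: fin[OF False])
        then have "(1 - \<epsilon>) * g n \<le> real_of_ereal (f n)" by simp
        then have 1: "1 - \<epsilon> \<le> real_of_ereal (f n) / g n" using elim(2) by (simp add: le_divide_eq)
        have "ereal (real_of_ereal (f n)) < ereal (g n)" using False by (simp only: fin[OF False] not_le)
        then have "real_of_ereal (f n) / g n < 1" using elim(2) by (simp add: divide_less_eq)
        then show ?thesis using 1 False \<epsilon>(3) by (simp add: e_def)
      qed (use r in \<open>simp add: e_def\<close>)
    qed
  qed
  then have "e \<longlonglongrightarrow> 0" by (simp add: tendsto_iff dist_real_def)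
  moreover have "\<forall>\<^sub>F n in sequentially. ereal ((1 - e n) * g n) \<le> f n"
    using g
  proof eventually_elim
    case (elim n)
    show ?case
    proof (cases "ereal (g n) \<le> f n")
      case False
      have "(1 - e n) * g n = real_of_ereal (f n)" using False elim by (simp add: e_def)
      then show ?thesis using fin[OF False] by simp
    qed (simp add: e_def)
  qed
  ultimately show ?thesis by blast
qed

definition density_level :: "nat \<Rightarrow> real \<Rightarrow> nat \<Rightarrow> bool" where
  "density_level p \<alpha> t \<longleftrightarrow> 1 \<le> t \<and> 1 / real p ^ (t + 1) \<le> \<alpha> \<and> \<alpha> < 1 / real p ^ t"

lemma density_level_exists:
  assumes p: "2 \<le> p" and \<alpha>: "0 < \<alpha>" "\<alpha> < 1 / real p"
  shows "\<exists>t. density_level p \<alpha> t"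
proof -
  let ?P = "\<lambda>t. 1 / real p ^ (t + 1) \<le> \<alpha>"
  have "\<exists>n. (1 / real p) ^ n < \<alpha>" by (rule real_arch_pow_inv[OF \<alpha>(1)]) (use p in simp)
  then obtain n where n: "(1 / real p) ^ n < \<alpha>" by blast
  have "(1 / real p) ^ (n + 1) \<le> (1 / real p) ^ n" by (rule power_decreasing) (use p in simp_all)
  then have ex: "?P n" using n by (simp add: power_one_over)
  define t where "t = (LEAST t. ?P t)"
  have t: "?P t" unfolding t_def by (rule LeastI[of ?P, OF ex])
  have "t \<noteq> 0"
  proof
    assume "t = 0"
    then show False using t \<alpha>(2) by simp
  qed
  then obtain t' where t': "t = Suc t'" by (cases t) simp_all
  have "\<not> ?P t'" using not_less_Least[of t' ?P] t' unfolding t_def by simp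
  then show ?thesis using t t' by (intro exI[of _ t]) (simp add: density_level_def)
qed

lemma density_level_less:
  assumes p: "2 \<le> p" and "1 / real p ^ (t + 1) \<le> \<alpha>" "\<alpha> < 1 / real p ^ T"
  shows "T \<le> t"
proof (rule ccontr)
  assume "\<not> T \<le> t"
  then have "real p ^ (t + 1) \<le> real p ^ T" using p by (intro power_increasing) simp_all
  then have "1 / real p ^ T \<le> 1 / real p ^ (t + 1)" using p by (intro divide_left_mono) simp_all
  then show False using assms by linarith
qed

lemma density_level_unique:
  assumes "2 \<le> p" "density_level p \<alpha> t" "density_level p \<alpha> t'"
  shows "t = t'"
  using assms density_level_less[of p t \<alpha> t'] density_level_less[of p t' \<alpha> t] by (simp add: density_level_def)

text \<open>
  Uses \<open>ln (1 + x) \<le> x\<close> for the constant, \<open>1 / \<alpha> \<le> p ^ (t + 1)\<close> for the comparison term, and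
  \<open>t + 1 \<le> p ^ t\<close>. The lower bound tends to \<open>1\<close> as \<open>\<alpha>\<close> tends to \<open>0\<close>, because \<open>t\<close>
  then tends to infinity.
\<close>

lemma threshold_constant_ge:
  assumes p: "2 \<le> p" and s: "density_level p \<alpha> t"
  shows "1 - 2 / real (t + 1) \<le> threshold_constant p t / (1 / \<alpha> * ln (1 / \<alpha>) / real p)"
    and "0 < 1 / \<alpha> * ln (1 / \<alpha>) / real p"
proof -
  let ?A = "threshold_constant p t" and ?B = "1 / \<alpha> * ln (1 / \<alpha>) / real p"
  have t: "1 \<le> t" and a1: "1 / real p ^ (t + 1) \<le> \<alpha>" and a2: "\<alpha> < 1 / real p ^ t"
    using s by (simp_all add: density_level_def)
  have p0: "0 < real p" "1 < real p" using p by simp_all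
  have lnp: "0 < ln (real p)" using p0 by simp
  have \<alpha>0: "0 < \<alpha>" by (rule less_le_trans[OF _ a1]) (use p0 in simp)
  have inv: "1 / \<alpha> \<le> real p ^ (t + 1)" using a1 \<alpha>0 p0 by (simp add: field_simps)
  have ptt: "real (t + 1) \<le> real p ^ t"
  proof -
    have "t + 1 \<le> 2 ^ t" using less_exp[of t] by linarith
    also have "\<dots> \<le> p ^ t" using p by (rule power_mono) simp
    finally have "real (t + 1) \<le> real (p ^ t)" by (simp only: of_nat_le_iff)
    then show ?thesis by simp
  qed
  have pt: "1 < real p ^ t" using ptt t by simp
  have a3: "1 < 1 / \<alpha>"
  proof -
    have "real p ^ t * \<alpha> < 1" using a2 p0 by (simp add: field_simps)
    moreover have "1 * \<alpha> < real p ^ t * \<alpha>" by (rule mult_strict_right_mono[OF pt \<alpha>0])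
    ultimately have "\<alpha> < 1" by linarith
    then show ?thesis using \<alpha>0 by simp
  qed
  have B: "?B \<le> real p ^ t * (real (t + 1) * ln (real p))"
  proof -
    have "ln (1 / \<alpha>) \<le> ln (real p ^ (t + 1))" using inv \<alpha>0 p0 by (subst ln_le_cancel_iff) simp_all
    also have "\<dots> = real (t + 1) * ln (real p)" using p0 by (simp only: ln_realpow)
    finally have "1 / \<alpha> * ln (1 / \<alpha>) \<le> real p ^ (t + 1) * (real (t + 1) * ln (real p))"
      using inv a3 by (intro mult_mono) simp_all
    then have "?B \<le> real p ^ (t + 1) * (real (t + 1) * ln (real p)) / real p"
      using p0 by (intro divide_right_mono) simp_all
    then show ?thesis using p0 by simp
  qed
  show Bpos: "0 < ?B" using a3 \<alpha>0 p0 by (intro divide_pos_pos mult_pos_pos ln_gt_zero) simp_all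
  have A: "(real p ^ t - 1) * (real t * ln (real p)) \<le> ?A"
  proof -
    have x: "0 < 1 / (real p ^ t - 1)" using pt by simp
    have l1: "ln (1 + 1 / (real p ^ t - 1)) \<le> 1 / (real p ^ t - 1)"
      by (rule ln_add_one_self_le_self) (use x in linarith)
    have l2: "0 < ln (1 + 1 / (real p ^ t - 1))" using x by (intro ln_gt_zero) linarith
    have "real t * ln (real p) / (1 / (real p ^ t - 1)) \<le> real t * ln (real p) / ln (1 + 1 / (real p ^ t - 1))"
      by (intro divide_left_mono[OF l1] mult_pos_pos[OF x l2]) (use lnp in simp)
    then show ?thesis using p0 by (simp add: threshold_constant_def ln_realpow mult.commute)
  qed
  have "(1 - 2 / real (t + 1)) * ?B \<le> (1 - 2 / real (t + 1)) * (real p ^ t * (real (t + 1) * ln (real p)))"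
    using t by (intro mult_left_mono[OF B]) simp
  also have "\<dots> = real p ^ t * (real t - 1) * ln (real p)"
  proof -
    have "(1 - 2 / real (t + 1)) * real (t + 1) = real t - 1" by (simp add: field_simps)
    then show ?thesis by (metis (no_types, lifting) mult.assoc mult.left_commute)
  qed
  also have "\<dots> \<le> (real p ^ t - 1) * real t * ln (real p)"
  proof (rule mult_right_mono)
    have "real t \<le> real p ^ t" by (rule order_trans[OF _ ptt]) simp
    then have "real p ^ t * real t - real p ^ t \<le> real p ^ t * real t - real t" by (rule diff_left_mono)
    then show "real p ^ t * (real t - 1) \<le> (real p ^ t - 1) * real t"
      by (simp only: left_diff_distrib right_diff_distrib mult_1_left mult_1_right)
  qed (use lnp in simp)
  also have "\<dots> \<le> ?A" using A by (simp only: mult.assoc)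
  finally show "1 - 2 / real (t + 1) \<le> ?A / ?B" using Bpos by (simp only: pos_le_divide_eq)
qed

lemma threshold_constant_pos:
  assumes "2 \<le> p" "1 \<le> t"
  shows "0 < threshold_constant p t"
proof -
  have "1 < real p ^ t" using assms by (intro one_less_power) simp_all
  then show ?thesis unfolding threshold_constant_def by (intro divide_pos_pos ln_gt_zero) simp_all
qed

lemma threshold_error_terms:
  fixes q t :: nat and \<alpha> :: real
  assumes q: "Suc q < CARD('p::prime_card)" and p: "3 \<le> CARD('p)" and t: "1 \<le> t"
    and \<alpha>: "\<alpha> < 1 / real CARD('p) ^ t"
  defines "c \<equiv> threshold_constant CARD('p) t"
    and "f \<equiv> \<lambda>n. szemeredi_threshold TYPE('p) n \<alpha> (Suc (Suc q)) * ereal (real CARD('p) ^ n)"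
  shows "\<exists>e. e \<longlonglongrightarrow> 0 \<and> (\<forall>\<^sub>F n in sequentially. ereal ((1 - e n) * (c * real (n choose Suc q))) \<le> f n)"
    and "\<exists>e. e \<longlonglongrightarrow> 0 \<and> (\<forall>\<^sub>F n in sequentially. ereal ((1 - e n) * (c / fact (Suc q) * real n ^ Suc q)) \<le> f n)"
proof -
  have c: "0 < c" unfolding c_def by (rule threshold_constant_pos) (use p t in simp_all)
  have f: "0 \<le> f n" for n
    unfolding f_def by (intro ereal_0_le_mult szemeredi_threshold_nonneg) simp
  have lower: "\<forall>\<^sub>F n in sequentially. ereal ((1 - \<epsilon>) * (c * real (transversal_count (Suc q) n))) \<le> f n"
    if "0 < \<epsilon>" "\<epsilon> \<le> 1" for \<epsilon>
    unfolding c_def f_def by (rule eventually_threshold_ge[OF q p t \<alpha> that])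
  have g1: "\<forall>\<^sub>F n in sequentially. 0 < c * real (n choose Suc q)"
    using eventually_ge_at_top[of "Suc q"] by eventually_elim (use c in \<open>simp add: zero_less_binomial del: binomial_Suc_Suc\<close>)
  have g2: "\<forall>\<^sub>F n in sequentially. 0 < c / fact (Suc q) * real n ^ Suc q"
    using eventually_gt_at_top[of 0] by eventually_elim (use c in simp)
  have r1: "(\<lambda>n. c * real (transversal_count (Suc q) n) / (c * real (n choose Suc q))) \<longlonglongrightarrow> 1"
    using tendsto_transversal_count_binomial[of "Suc q"] c by simp
  have r2: "(\<lambda>n. c * real (transversal_count (Suc q) n) / (c / fact (Suc q) * real n ^ Suc q)) \<longlonglongrightarrow> 1"
  proof -
    have "c * d / (c / F * m) = d * F / m" for d F m :: real using c by simp
    then show ?thesis using tendsto_transversal_count_power[of "Suc q"] by (simp only:)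
  qed
  show "\<exists>e. e \<longlonglongrightarrow> 0 \<and> (\<forall>\<^sub>F n in sequentially. ereal ((1 - e n) * (c * real (n choose Suc q))) \<le> f n)"
    by (rule error_term_exists[OF f g1]) (rule eventually_ge_of_ratio[OF lower g1 r1])
  show "\<exists>e. e \<longlonglongrightarrow> 0 \<and> (\<forall>\<^sub>F n in sequentially. ereal ((1 - e n) * (c / fact (Suc q) * real n ^ Suc q)) \<le> f n)"
    by (rule error_term_exists[OF f g2]) (rule eventually_ge_of_ratio[OF lower g2 r2])
qed

theorem theorem1p3:
  fixes p k :: nat
  assumes "p = CARD('p::prime_card)" and "odd p" and "k \<ge> 3" and "p > k"
  shows "\<exists>e1 e2 e3 :: real \<Rightarrow> nat \<Rightarrow> real.
    (\<forall>\<alpha>. 0 < \<alpha> \<and> \<alpha> < 1 / real p \<longrightarrow> e1 \<alpha> \<longlonglongrightarrow> 0 \<and> e2 \<alpha> \<longlonglongrightarrow> 0) \<and>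
    (\<forall>\<epsilon>>0. \<forall>\<^sub>F \<alpha> in at_right 0. \<forall>\<^sub>F n in sequentially. \<bar>e3 \<alpha> n\<bar> < \<epsilon>) \<and>
    (\<forall>\<alpha> t. 0 < \<alpha> \<and> \<alpha> < 1 / real p \<and> t \<ge> 1 \<and>
           1 / real p ^ (t + 1) \<le> \<alpha> \<and> \<alpha> < 1 / real p ^ t \<longrightarrow>
       (\<forall>\<^sub>F n in sequentially.
          let N = real p ^ n in
            szemeredi_threshold TYPE('p) n \<alpha> k * ereal N
              \<ge> ereal ((1 - e1 \<alpha> n) *
                   (ln (real p ^ t) / ln (1 + 1 / (real p ^ t - 1))) * real (n choose (k - 1)))
          \<and> szemeredi_threshold TYPE('p) n \<alpha> k * ereal N
              \<ge> ereal ((1 - e2 \<alpha> n) *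
                   (ln (real p ^ t) / (fact (k - 1) * ln (1 + 1 / (real p ^ t - 1)))) *
                   log (real p) N ^ (k - 1))
          \<and> (1 - e2 \<alpha> n) *
                (ln (real p ^ t) / (fact (k - 1) * ln (1 + 1 / (real p ^ t - 1)))) *
                log (real p) N ^ (k - 1)
              \<ge> (1 - e3 \<alpha> n) *
                (1 / \<alpha> * ln (1 / \<alpha>) / (real p * fact (k - 1))) *
                log (real p) N ^ (k - 1)))"
proof -
  define q where "q = k - 2"
  have k: "k = Suc (Suc q)" and k1: "k - 1 = Suc q" using assms(3) by (simp_all add: q_def)
  have p2: "2 \<le> p" and p3: "3 \<le> CARD('p)" and qp: "Suc q < CARD('p)"
    using assms(1,3,4) k by simp_all
  define thr where "thr \<alpha> n = szemeredi_threshold TYPE('p) n \<alpha> k * ereal (real p ^ n)" for \<alpha> n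
  define c where "c = threshold_constant p"
  define errors where "errors \<alpha> e1 e2 \<longleftrightarrow> e1 \<longlonglongrightarrow> 0 \<and> e2 \<longlonglongrightarrow> 0 \<and>
    (\<forall>t. density_level p \<alpha> t \<longrightarrow> (\<forall>\<^sub>F n in sequentially.
      ereal ((1 - e1 n) * (c t * real (n choose (k - 1)))) \<le> thr \<alpha> n \<and>
      ereal ((1 - e2 n) * (c t / fact (k - 1) * real n ^ (k - 1))) \<le> thr \<alpha> n))" for \<alpha> e1 e2
  have errors_exist: "\<exists>e. errors \<alpha> (fst e) (snd e)" for \<alpha>
  proof (cases "\<exists>t. density_level p \<alpha> t")
    case True
    then obtain t where t: "density_level p \<alpha> t" by blast
    have t1: "1 \<le> t" "\<alpha> < 1 / real CARD('p) ^ t" using t assms(1) by (simp_all add: density_level_def)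
    have "\<exists>e. e \<longlonglongrightarrow> 0 \<and> (\<forall>\<^sub>F n in sequentially. ereal ((1 - e n) * (c t * real (n choose (k - 1)))) \<le> thr \<alpha> n)"
      unfolding thr_def c_def k1 unfolding k assms(1) by (rule threshold_error_terms(1)[OF qp p3 t1])
    then obtain e1 where e1: "e1 \<longlonglongrightarrow> 0"
      "\<forall>\<^sub>F n in sequentially. ereal ((1 - e1 n) * (c t * real (n choose (k - 1)))) \<le> thr \<alpha> n"
      by blast
    have "\<exists>e. e \<longlonglongrightarrow> 0 \<and> (\<forall>\<^sub>F n in sequentially. ereal ((1 - e n) * (c t / fact (k - 1) * real n ^ (k - 1))) \<le> thr \<alpha> n)"
      unfolding thr_def c_def k1 unfolding k assms(1) by (rule threshold_error_terms(2)[OF qp p3 t1])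
    then obtain e2 where e2: "e2 \<longlonglongrightarrow> 0"
      "\<forall>\<^sub>F n in sequentially. ereal ((1 - e2 n) * (c t / fact (k - 1) * real n ^ (k - 1))) \<le> thr \<alpha> n"
      by blast
    have "errors \<alpha> e1 e2"
      unfolding errors_def
    proof (intro conjI allI impI)
      fix t' assume "density_level p \<alpha> t'"
      then have "t' = t" using density_level_unique[OF p2] t by blast
      then show "\<forall>\<^sub>F n in sequentially.
        ereal ((1 - e1 n) * (c t' * real (n choose (k - 1)))) \<le> thr \<alpha> n \<and>
        ereal ((1 - e2 n) * (c t' / fact (k - 1) * real n ^ (k - 1))) \<le> thr \<alpha> n"
        using eventually_conj[OF e1(2) e2(2)] by simp
    qed (rule e1(1) e2(1))+
    then show ?thesis by (intro exI[of _ "(e1, e2)"]) simp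
  next
    case False
    then show ?thesis
      by (intro exI[of _ "(\<lambda>_. 0, \<lambda>_. 0)"]) (simp add: errors_def)
  qed
  obtain h where h: "\<And>\<alpha>. errors \<alpha> (fst (h \<alpha>)) (snd (h \<alpha>))"
    using choice[of "\<lambda>\<alpha> e. errors \<alpha> (fst e) (snd e)"] errors_exist by blast
  define E1 where "E1 \<alpha> = fst (h \<alpha>)" for \<alpha>
  define E2 where "E2 \<alpha> = snd (h \<alpha>)" for \<alpha>
  have E: "E1 \<alpha> \<longlonglongrightarrow> 0" "E2 \<alpha> \<longlonglongrightarrow> 0" for \<alpha>
    using h[of \<alpha>] unfolding errors_def E1_def E2_def by blast+
  have thrE: "\<forall>\<^sub>F n in sequentially.
      ereal ((1 - E1 \<alpha> n) * (c t * real (n choose (k - 1)))) \<le> thr \<alpha> n \<and>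
      ereal ((1 - E2 \<alpha> n) * (c t / fact (k - 1) * real n ^ (k - 1))) \<le> thr \<alpha> n" if "density_level p \<alpha> t" for \<alpha> t
    using h[of \<alpha>] that unfolding errors_def E1_def E2_def by blast
  define \<tau> where "\<tau> \<alpha> = (SOME t. density_level p \<alpha> t)" for \<alpha>
  define B where "B \<alpha> = 1 / \<alpha> * ln (1 / \<alpha>) / real p" for \<alpha>
  \<comment> \<open>The third error is chosen to make the last inequality hold; \<open>max\<close> is needed since the two sides differ by a factor that can be as large as \<open>p\<close> in the favourable direction.\<close>
  define E3 where "E3 \<alpha> n = max 0 (1 - (1 - E2 \<alpha> n) * (c (\<tau> \<alpha>) / B \<alpha>))" for \<alpha> n
  have \<tau>: "\<tau> \<alpha> = t" if "density_level p \<alpha> t" for \<alpha> t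
    unfolding \<tau>_def using that density_level_unique[OF p2] by (metis someI)
  have E3_small: "\<forall>\<^sub>F \<alpha> in at_right 0. \<forall>\<^sub>F n in sequentially. \<bar>E3 \<alpha> n\<bar> < \<epsilon>" if \<epsilon>: "0 < \<epsilon>" for \<epsilon>
  proof -
    obtain T :: nat where T: "2 / \<epsilon> < real T" using reals_Archimedean2 by blast
    define T' where "T' = Suc T"
    have "\<forall>\<^sub>F \<alpha> in at_right (0::real). \<alpha> \<in> {0<..<1 / real p ^ T'}"
      by (rule eventually_at_right_real) (use p2 in simp)
    then show ?thesis
    proof eventually_elim
      case (elim \<alpha>)
      have "1 / real p ^ T' \<le> 1 / real p ^ 1"
        using p2 by (intro divide_left_mono power_increasing) (simp_all add: T'_def)
      then obtain t where t: "density_level p \<alpha> t" using density_level_exists[OF p2, of \<alpha>] elim by auto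
      have "T' \<le> t" using density_level_less[OF p2, of t \<alpha> T'] t elim by (simp add: density_level_def)
      then have "real T \<le> real (t + 1)" by (simp add: T'_def)
      then have "2 / \<epsilon> < real (t + 1)" using T by linarith
      then have "1 - \<epsilon> < 1 - 2 / real (t + 1)" using \<epsilon> by (simp add: field_simps)
      also have "\<dots> \<le> c t / B \<alpha>" unfolding c_def B_def by (rule threshold_constant_ge(1)[OF p2 t])
      finally have lt: "1 - \<epsilon> < (1 - 0) * (c t / B \<alpha>)" by simp
      have "(\<lambda>n. (1 - E2 \<alpha> n) * (c t / B \<alpha>)) \<longlonglongrightarrow> (1 - 0) * (c t / B \<alpha>)"
        by (intro tendsto_mult tendsto_diff tendsto_const E(2))
      then have "\<forall>\<^sub>F n in sequentially. 1 - \<epsilon> < (1 - E2 \<alpha> n) * (c t / B \<alpha>)"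
        using lt by (rule order_tendstoD(1))
      then show ?case
        by eventually_elim (use \<epsilon> in \<open>simp add: E3_def \<tau>[OF t] abs_if max_def\<close>)
    qed
  qed
  have main: "\<forall>\<^sub>F n in sequentially.
      ereal ((1 - E1 \<alpha> n) * c t * real (n choose (k - 1))) \<le> thr \<alpha> n \<and>
      ereal ((1 - E2 \<alpha> n) * (c t / fact (k - 1)) * real n ^ (k - 1)) \<le> thr \<alpha> n \<and>
      (1 - E3 \<alpha> n) * (B \<alpha> / fact (k - 1)) * real n ^ (k - 1) \<le> (1 - E2 \<alpha> n) * (c t / fact (k - 1)) * real n ^ (k - 1)"
    if t: "density_level p \<alpha> t" for \<alpha> t
    using thrE[OF t]
  proof eventually_elim
    case (elim n)
    have B: "0 < B \<alpha>" unfolding B_def by (rule threshold_constant_ge(2)[OF p2 t])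
    have "(1 - E3 \<alpha> n) * B \<alpha> \<le> ((1 - E2 \<alpha> n) * (c t / B \<alpha>)) * B \<alpha>"
      unfolding E3_def \<tau>[OF t] by (rule mult_right_mono) (use B in simp_all)
    also have "\<dots> = (1 - E2 \<alpha> n) * c t" using B by simp
    finally have "(1 - E3 \<alpha> n) * B \<alpha> * (real n ^ (k - 1) / fact (k - 1)) \<le> (1 - E2 \<alpha> n) * c t * (real n ^ (k - 1) / fact (k - 1))"
      by (rule mult_right_mono) simp
    then show ?case using elim by (simp add: mult.assoc)
  qed
  have logN: "log (real p) (real p ^ n) = real n" for n
    using p2 by (simp add: log_nat_power)
  have cf: "ln (real p ^ t) / (fact (k - 1) * ln (1 + 1 / (real p ^ t - 1))) = c t / fact (k - 1)" for t
    by (simp add: c_def threshold_constant_def mult.commute)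
  have Bf: "1 / \<alpha> * ln (1 / \<alpha>) / (real p * fact (k - 1)) = B \<alpha> / fact (k - 1)" for \<alpha>
    by (simp add: B_def)
  show ?thesis
  proof (rule exI[of _ E1], rule exI[of _ E2], rule exI[of _ E3], intro conjI allI impI)
    fix \<alpha> t assume "0 < \<alpha> \<and> \<alpha> < 1 / real p \<and> 1 \<le> t \<and> 1 / real p ^ (t + 1) \<le> \<alpha> \<and> \<alpha> < 1 / real p ^ t"
    then have t: "density_level p \<alpha> t" by (simp add: density_level_def)
    show "\<forall>\<^sub>F n in sequentially.
          let N = real p ^ n in
            szemeredi_threshold TYPE('p) n \<alpha> k * ereal N
              \<ge> ereal ((1 - E1 \<alpha> n) *
                   (ln (real p ^ t) / ln (1 + 1 / (real p ^ t - 1))) * real (n choose (k - 1)))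
          \<and> szemeredi_threshold TYPE('p) n \<alpha> k * ereal N
              \<ge> ereal ((1 - E2 \<alpha> n) *
                   (ln (real p ^ t) / (fact (k - 1) * ln (1 + 1 / (real p ^ t - 1)))) *
                   log (real p) N ^ (k - 1))
          \<and> (1 - E2 \<alpha> n) *
                (ln (real p ^ t) / (fact (k - 1) * ln (1 + 1 / (real p ^ t - 1)))) *
                log (real p) N ^ (k - 1)
              \<ge> (1 - E3 \<alpha> n) *
                (1 / \<alpha> * ln (1 / \<alpha>) / (real p * fact (k - 1))) *
                log (real p) N ^ (k - 1)"
      using main[OF t]
      unfolding Let_def logN cf Bf thr_def threshold_constant_def[of p t, folded c_def, symmetric] .
  qed (use E E3_small in blast)+
qed

end
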